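(* Let $\Sigma$ be a closed surface of genus $g\ge2$. For each point $(\Sigma,\sigma)\in\mathcal{T}_g(\Sigma)$, let $U\subset Q(\sigma)$ be an open neighborhood of $0$ and $|\Sigma(\alpha\,dz^2)|:U\to\mathbb{R}$ the area functional of the minimal surfaces $\Sigma(\alpha\,dz^2)$ with data $(\sigma,\alpha\,dz^2)$, as described in the context. Then: (i) The zero quadratic differential $0\in Q(\sigma)$ is a critical point of the area functional $|\Sigma(\alpha\,dz^2)|:U\to\mathbb{R}$. (ii) The area functional is a potential of the Weil–Petersson metric on Teichmüller space: there is a nonzero constant $c$ such that for every $(\Sigma,\sigma)\in\mathcal{T}_g(\Sigma)$ and all $\alpha\,dz^2,\beta\,dz^2\in Q(\sigma)$, $$\left.\frac{\partial^2}{\partial\overline{s}\,\partial t}\right|_{t=s=0}\big|\Sigma(t\alpha\,dz^2+s\beta\,dz^2)\big|=c\,\langle\alpha,\beta\rangle_{WP},$$ where $t,s\in\mathbb{C}$ are small complex parameters.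
   Context: $\mathcal{T}_g(\Sigma)$ is the Teichmüller space of $\Sigma$, a point of which is written $(\Sigma,\sigma)$ with $\sigma$ a conformal structure. $Q(\sigma)$ is the space of holomorphic quadratic differentials on $(\Sigma,\sigma)$, identified with the cotangent space of $\mathcal{T}_g(\Sigma)$ at $(\Sigma,\sigma)$. Let $g_0|dz|^2$ be the unique hyperbolic metric (curvature $-1$) in the conformal class $\sigma$, $dA_{g_0}$ its area element and $\Delta_{g_0}$ its Laplace operator. The Weil–Petersson (co-)metric is the Hermitian form $$\langle\alpha,\beta\rangle_{WP}=\int_\Sigma\frac{\alpha\overline{\beta}}{g_0^2}\,dA_{g_0},\qquad \alpha\,dz^2,\beta\,dz^2\in Q(\sigma).$$ Minimal surfaces (Uhlenbeck): there is an open neighborhood $U$ of $0\in Q(\sigma)$ such that for every $\alpha\,dz^2\in U$ there is a minimal surface $\Sigma(\alpha\,dz^2)$ immersed in some quasi-Fuchsian 3-manifold, with induced metric $e^{2u}g_0|dz|^2$ (so in the conformal class $\sigma$) and second fundamental form equal to the real part of $\alpha\,dz^2$. The function $u$ satisfies the Gauss equation $$\Delta_{g_0}u+1-e^{2u}-\frac{|\alpha|^2}{g_0^2}e^{-2u}=0 .$$ Here $u=u_\alpha$ is the solution in the smooth family of solutions $\alpha\,dz^2\mapsto u_\alpha$ on $U$ with $u_0=0$ (so that $\Sigma(0)$ is totally geodesic in a Fuchsian manifold). The area functional is the induced area $$|\Sigma(\alpha\,dz^2)|=\int_\Sigma e^{2u_\alpha}\,dA_{g_0}.$$ A potential of the Weil–Petersson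 metric is a function (which may be defined only locally, here in a neighborhood of $0\in Q(\sigma)$ for each $(\Sigma,\sigma)$) whose second variation in the direction of two holomorphic quadratic differentials $\alpha\,dz^2,\beta\,dz^2$ equals $\langle\alpha,\beta\rangle_{WP}$ up to a constant. The second variation is the mixed complex derivative $\frac{\partial^2}{\partial\overline{s}\,\partial t}$ at $t=s=0$ of the function evaluated at $t\alpha\,dz^2+s\beta\,dz^2$, with Wirtinger derivatives in $t,s\in\mathbb{C}$. *)

theory Defs
  imports "HOL-Complex_Analysis.Complex_Analysis" "HOL-Homology.Homology"
begin

section \<open>Calculus\<close>

text \<open>Intended for open sets in finite-dimensional spaces, where it is the usual class \<open>C\<^sup>k\<close>.\<close>

primrec Ck_on :: "nat \<Rightarrow> ('a::real_normed_vector \<Rightarrow> 'b::real_normed_vector) \<Rightarrow> 'a set \<Rightarrow> bool" where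
  "Ck_on 0 f S \<longleftrightarrow> continuous_on S f"
| "Ck_on (Suc k) f S \<longleftrightarrow>
     f differentiable_on S \<and> (\<forall>v. Ck_on k (\<lambda>x. frechet_derivative f (at x) v) S)"

definition smooth_on :: "('a::real_normed_vector \<Rightarrow> 'b::real_normed_vector) \<Rightarrow> 'a set \<Rightarrow> bool" where
  "smooth_on f S \<longleftrightarrow> (\<forall>k. Ck_on k f S)"

definition second_derivative ::
  "('a::real_normed_vector \<Rightarrow> 'b::real_normed_vector) \<Rightarrow> 'a \<Rightarrow> 'a \<Rightarrow> 'a \<Rightarrow> 'b" where
  "second_derivative f x v w =
     frechet_derivative (\<lambda>y. frechet_derivative f (at y) v) (at x) w"

definition flat_laplacian :: "(complex \<Rightarrow> real) \<Rightarrow> complex \<Rightarrow> real" where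
  "flat_laplacian f z = second_derivative f z 1 1 + second_derivative f z \<i> \<i>"

text \<open>Wirtinger derivatives \<open>\<partial>f/\<partial>z = (f\<^sub>x - i f\<^sub>y)/2\<close> and
  \<open>\<partial>f/\<partial>\<bar>z = (f\<^sub>x + i f\<^sub>y)/2\<close> of a real-differentiable function.\<close>

definition has_wirtinger_derivative :: "(complex \<Rightarrow> complex) \<Rightarrow> complex \<Rightarrow> complex \<Rightarrow> bool" where
  "has_wirtinger_derivative f D z \<longleftrightarrow>
     (\<exists>f'. (f has_derivative f') (at z) \<and> D = (f' 1 - \<i> * f' \<i>) / 2)"

definition has_conj_wirtinger_derivative :: "(complex \<Rightarrow> complex) \<Rightarrow> complex \<Rightarrow> complex \<Rightarrow> bool" where
  "has_conj_wirtinger_derivative f D z \<longleftrightarrow>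
     (\<exists>f'. (f has_derivative f') (at z) \<and> D = (f' 1 + \<i> * f' \<i>) / 2)"

text \<open>\<open>\<partial>\<^sup>2f/\<partial>\<bar>s\<partial>t\<close> at \<open>t = s = 0\<close>, for a function \<open>f t s\<close> defined near the origin.\<close>

definition has_mixed_wirtinger_derivative :: "(complex \<Rightarrow> complex \<Rightarrow> complex) \<Rightarrow> complex \<Rightarrow> bool" where
  "has_mixed_wirtinger_derivative f D \<longleftrightarrow>
     (\<exists>h. (\<forall>\<^sub>F s in nhds 0. has_wirtinger_derivative (\<lambda>t. f t s) (h s) 0) \<and>
          has_conj_wirtinger_derivative h D 0)"


section \<open>Surfaces and conformal structures\<close>

text \<open>A chart is a domain together with a coordinate function, whose values outside the domain
  are irrelevant.\<close>

type_synonym 'a chart = "'a set \<times> ('a \<Rightarrow> complex)"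

abbreviation chart_range :: "'a chart \<Rightarrow> complex set" where
  "chart_range c \<equiv> snd c ` fst c"

definition chart_inv :: "'a chart \<Rightarrow> complex \<Rightarrow> 'a" where
  "chart_inv c = inv_into (fst c) (snd c)"

definition is_chart :: "'a topology \<Rightarrow> 'a chart \<Rightarrow> bool" where
  "is_chart X c \<longleftrightarrow> openin X (fst c) \<and> open (chart_range c) \<and>
     homeomorphic_map (subtopology X (fst c)) (top_of_set (chart_range c)) (snd c)"

definition transition :: "'a chart \<Rightarrow> 'a chart \<Rightarrow> complex \<Rightarrow> complex" where
  "transition c d = (\<lambda>z. snd d (chart_inv c z))"

definition overlap :: "'a chart \<Rightarrow> 'a chart \<Rightarrow> complex set" where
  "overlap c d = snd c ` (fst c \<inter> fst d)"

definition maximal_atlas ::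
  "'a topology \<Rightarrow> ('a chart \<Rightarrow> 'a chart \<Rightarrow> bool) \<Rightarrow> 'a chart set \<Rightarrow> bool" where
  "maximal_atlas X R \<A> \<longleftrightarrow>
     (\<forall>c\<in>\<A>. is_chart X c) \<and> (\<Union>c\<in>\<A>. fst c) = topspace X \<and>
     (\<forall>c\<in>\<A>. \<forall>d\<in>\<A>. R c d) \<and>
     (\<forall>c. is_chart X c \<and> (\<forall>d\<in>\<A>. R c d \<and> R d c) \<longrightarrow> c \<in> \<A>)"

text \<open>\<open>Im (cnj T\<^sub>x * T\<^sub>y)\<close> is the Jacobian determinant of \<open>T\<close>.\<close>

definition oriented_compatible :: "'a chart \<Rightarrow> 'a chart \<Rightarrow> bool" where
  "oriented_compatible c d \<longleftrightarrow> smooth_on (transition c d) (overlap c d) \<and>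
     (\<forall>z\<in>overlap c d. 0 < Im (cnj (frechet_derivative (transition c d) (at z) 1)
                               * frechet_derivative (transition c d) (at z) \<i>))"

definition holomorphic_compatible :: "'a chart \<Rightarrow> 'a chart \<Rightarrow> bool" where
  "holomorphic_compatible c d \<longleftrightarrow> transition c d holomorphic_on overlap c d"

text \<open>A closed connected oriented smooth surface; the genus is half the rank of \<open>H\<^sub>1\<close>.\<close>

definition closed_surface :: "nat \<Rightarrow> 'a topology \<Rightarrow> 'a chart set \<Rightarrow> bool" where
  "closed_surface genus X \<A> \<longleftrightarrow>
     compact_space X \<and> connected_space X \<and> Hausdorff_space X \<and>
     maximal_atlas X oriented_compatible \<A> \<and>
     homology_group 1 X \<cong> free_Abelian_group {..<2 * genus}"

definition conformal_structures :: "'a topology \<Rightarrow> 'a chart set \<Rightarrow> 'a chart set set" where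
  "conformal_structures X \<A> = {\<sigma>. \<sigma> \<subseteq> \<A> \<and> maximal_atlas X holomorphic_compatible \<sigma>}"

text \<open>Two structures are identified if a homeomorphism isotopic to the identity pulls the charts
  of the second back to charts of the first, i.e. is biholomorphic between the two.\<close>

definition teichmueller_rel :: "'a topology \<Rightarrow> 'a chart set \<Rightarrow> ('a chart set \<times> 'a chart set) set" where
  "teichmueller_rel X \<A> =
     {(\<sigma>, \<sigma>'). \<sigma> \<in> conformal_structures X \<A> \<and> \<sigma>' \<in> conformal_structures X \<A> \<and>
        (\<exists>f. homotopic_with (\<lambda>h. homeomorphic_map X X h) X X f id \<and>
             (\<forall>d\<in>\<sigma>'. ({p \<in> topspace X. f p \<in> fst d}, snd d \<circ> f) \<in> \<sigma>))}"

definition teichmueller_space :: "'a topology \<Rightarrow> 'a chart set \<Rightarrow> 'a chart set set set" where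
  "teichmueller_space X \<A> = conformal_structures X \<A> // teichmueller_rel X \<A>"

text \<open>A fixed choice of coordinate at each point, used only for chart-independent expressions.\<close>

definition chart_at :: "'a chart set \<Rightarrow> 'a \<Rightarrow> 'a chart" where
  "chart_at \<sigma> p = (SOME c. c \<in> \<sigma> \<and> p \<in> fst c)"


section \<open>Conformal metrics\<close>

text \<open>A metric \<open>g |dz|\<^sup>2\<close> is given by its coefficient \<open>g c p\<close> in each chart \<open>c\<close> at each point \<open>p\<close>
  of the chart domain.\<close>

type_synonym 'a metric = "'a chart \<Rightarrow> 'a \<Rightarrow> real"

definition conformal_metric :: "'a chart set \<Rightarrow> 'a metric \<Rightarrow> bool" where
  "conformal_metric \<sigma> g \<longleftrightarrow>
     (\<forall>c\<in>\<sigma>. smooth_on (\<lambda>z. g c (chart_inv c z)) (chart_range c) \<and> (\<forall>p\<in>fst c. 0 < g c p)) \<and>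
     (\<forall>c\<in>\<sigma>. \<forall>d\<in>\<sigma>. \<forall>p\<in>fst c \<inter> fst d.
        g c p = g d p * (cmod (deriv (transition c d) (snd c p)))\<^sup>2)"

definition curvature :: "'a metric \<Rightarrow> 'a chart \<Rightarrow> 'a \<Rightarrow> real" where
  "curvature g c p = - flat_laplacian (\<lambda>z. ln (g c (chart_inv c z))) (snd c p) / (2 * g c p)"

definition hyperbolic_metric :: "'a chart set \<Rightarrow> 'a metric \<Rightarrow> bool" where
  "hyperbolic_metric \<sigma> g \<longleftrightarrow>
     conformal_metric \<sigma> g \<and> (\<forall>c\<in>\<sigma>. \<forall>p\<in>fst c. curvature g c p = -1)"

definition laplace_beltrami :: "'a chart set \<Rightarrow> 'a metric \<Rightarrow> ('a \<Rightarrow> real) \<Rightarrow> 'a \<Rightarrow> real" where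
  "laplace_beltrami \<sigma> g u p =
     (let c = chart_at \<sigma> p in flat_laplacian (\<lambda>z. u (chart_inv c z)) (snd c p) / g c p)"

text \<open>The area element of \<open>g |dz|\<^sup>2\<close>: the Borel measure that is \<open>g dx dy\<close> in every chart.\<close>

definition area_measure :: "'a topology \<Rightarrow> 'a chart set \<Rightarrow> 'a metric \<Rightarrow> 'a measure" where
  "area_measure X \<sigma> g =
     (THE \<mu>. space \<mu> = topspace X \<and> sets \<mu> = sigma_sets (topspace X) {W. openin X W} \<and>
        (\<forall>c\<in>\<sigma>. \<forall>B\<in>sets \<mu>. B \<subseteq> fst c \<longrightarrow>
           emeasure \<mu> B = (\<integral>\<^sup>+z\<in>snd c ` B. ennreal (g c (chart_inv c z)) \<partial>lborel)))"


section \<open>Holomorphic quadratic differentials\<close>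

text \<open>\<open>\<alpha> dz\<^sup>2\<close> is given by its coefficient \<open>\<alpha> c p\<close> in each chart \<open>c\<close> at each point \<open>p\<close> of the chart
  domain; coefficients at meaningless arguments are \<open>0\<close>, so that equal differentials are equal
  functions.\<close>

type_synonym 'a qdiff = "'a chart \<Rightarrow> 'a \<Rightarrow> complex"

definition quadratic_differentials :: "'a chart set \<Rightarrow> 'a qdiff set" where
  "quadratic_differentials \<sigma> =
     {\<alpha>. (\<forall>c\<in>\<sigma>. (\<lambda>z. \<alpha> c (chart_inv c z)) holomorphic_on chart_range c) \<and>
         (\<forall>c\<in>\<sigma>. \<forall>d\<in>\<sigma>. \<forall>p\<in>fst c \<inter> fst d.
            \<alpha> c p = \<alpha> d p * (deriv (transition c d) (snd c p))\<^sup>2) \<and>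
         (\<forall>c p. c \<notin> \<sigma> \<or> p \<notin> fst c \<longrightarrow> \<alpha> c p = 0)}"

definition qzero :: "'a qdiff" where
  "qzero = (\<lambda>c p. 0)"

definition qcomb :: "complex \<Rightarrow> 'a qdiff \<Rightarrow> complex \<Rightarrow> 'a qdiff \<Rightarrow> 'a qdiff" where
  "qcomb t \<alpha> s \<beta> = (\<lambda>c p. t * \<alpha> c p + s * \<beta> c p)"

abbreviation qdiff_minus :: "'a qdiff \<Rightarrow> 'a qdiff \<Rightarrow> 'a qdiff" where
  "qdiff_minus \<alpha> \<beta> \<equiv> qcomb 1 \<alpha> (-1) \<beta>"

text \<open>The supremum norm \<open>sup |\<alpha>|/g\<close>.  The space \<open>Q(\<sigma>)\<close> is finite-dimensional, so this norm induces
  its only Hausdorff vector space topology.\<close>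

definition qnorm :: "'a topology \<Rightarrow> 'a chart set \<Rightarrow> 'a metric \<Rightarrow> 'a qdiff \<Rightarrow> real" where
  "qnorm X \<sigma> g \<alpha> =
     (SUP p\<in>topspace X. cmod (\<alpha> (chart_at \<sigma> p) p) / g (chart_at \<sigma> p) p)"

definition weil_petersson ::
  "'a topology \<Rightarrow> 'a chart set \<Rightarrow> 'a metric \<Rightarrow> 'a qdiff \<Rightarrow> 'a qdiff \<Rightarrow> complex" where
  "weil_petersson X \<sigma> g \<alpha> \<beta> =
     (\<integral>p. (let c = chart_at \<sigma> p in \<alpha> c p * cnj (\<beta> c p) / of_real ((g c p)\<^sup>2))
        \<partial>area_measure X \<sigma> g)"

definition open_in_qdiffs ::
  "'a topology \<Rightarrow> 'a chart set \<Rightarrow> 'a metric \<Rightarrow> 'a qdiff set \<Rightarrow> bool" where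
  "open_in_qdiffs X \<sigma> g U \<longleftrightarrow> U \<subseteq> quadratic_differentials \<sigma> \<and>
     (\<forall>\<alpha>\<in>U. \<exists>\<epsilon>>0. \<forall>\<beta>\<in>quadratic_differentials \<sigma>.
        qnorm X \<sigma> g (qdiff_minus \<beta> \<alpha>) < \<epsilon> \<longrightarrow> \<beta> \<in> U)"

text \<open>The Frechet derivative of \<open>F : U \<rightarrow> \<real>\<close> at \<open>\<alpha>\<close> exists and vanishes.\<close>

definition critical_point ::
  "'a topology \<Rightarrow> 'a chart set \<Rightarrow> 'a metric \<Rightarrow> 'a qdiff set \<Rightarrow> ('a qdiff \<Rightarrow> real) \<Rightarrow> 'a qdiff \<Rightarrow> bool" where
  "critical_point X \<sigma> g U F \<alpha> \<longleftrightarrow> \<alpha> \<in> U \<and>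
     (\<forall>\<epsilon>>0. \<exists>\<delta>>0. \<forall>\<beta>\<in>U. qnorm X \<sigma> g (qdiff_minus \<beta> \<alpha>) < \<delta> \<longrightarrow>
        \<bar>F \<beta> - F \<alpha>\<bar> \<le> \<epsilon> * qnorm X \<sigma> g (qdiff_minus \<beta> \<alpha>))"

definition continuous_on_qdiffs ::
  "'a topology \<Rightarrow> 'a chart set \<Rightarrow> 'a metric \<Rightarrow> 'a qdiff set \<Rightarrow> complex set
     \<Rightarrow> ('a qdiff \<Rightarrow> complex \<Rightarrow> real) \<Rightarrow> bool" where
  "continuous_on_qdiffs X \<sigma> g U V \<Psi> \<longleftrightarrow>
     (\<forall>\<alpha>\<in>U. \<forall>z\<in>V. \<forall>\<epsilon>>0. \<exists>\<delta>>0. \<forall>\<beta>\<in>U. \<forall>w\<in>V.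
        qnorm X \<sigma> g (qdiff_minus \<beta> \<alpha>) < \<delta> \<and> dist w z < \<delta> \<longrightarrow> \<bar>\<Psi> \<beta> w - \<Psi> \<alpha> z\<bar> < \<epsilon>)"

text \<open>Joint \<open>C\<^sup>k\<close> regularity of \<open>\<Psi>\<close> on the open subset \<open>U \<times> V\<close> of \<open>Q(\<sigma>) \<times> \<complex>\<close>: directional derivatives
  in all directions \<open>(\<beta>, w)\<close>, iterated up to \<open>k\<close> times, exist and are continuous.  By finite
  dimensionality of \<open>Q(\<sigma>)\<close> this is the usual notion.\<close>

primrec Ck_on_qdiffs ::
  "nat \<Rightarrow> 'a topology \<Rightarrow> 'a chart set \<Rightarrow> 'a metric \<Rightarrow> 'a qdiff set \<Rightarrow> complex set
     \<Rightarrow> ('a qdiff \<Rightarrow> complex \<Rightarrow> real) \<Rightarrow> bool" where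
  "Ck_on_qdiffs 0 X \<sigma> g U V \<Psi> \<longleftrightarrow> continuous_on_qdiffs X \<sigma> g U V \<Psi>"
| "Ck_on_qdiffs (Suc k) X \<sigma> g U V \<Psi> \<longleftrightarrow> continuous_on_qdiffs X \<sigma> g U V \<Psi> \<and>
     (\<forall>\<beta>\<in>quadratic_differentials \<sigma>. \<forall>w. \<exists>\<Psi>'.
        (\<forall>\<alpha>\<in>U. \<forall>z\<in>V.
           ((\<lambda>r. \<Psi> (qcomb 1 \<alpha> (of_real r) \<beta>) (z + of_real r * w)) has_real_derivative \<Psi>' \<alpha> z) (at 0)) \<and>
        Ck_on_qdiffs k X \<sigma> g U V \<Psi>')"

definition smooth_family ::
  "'a topology \<Rightarrow> 'a chart set \<Rightarrow> 'a metric \<Rightarrow> 'a qdiff set \<Rightarrow> ('a qdiff \<Rightarrow> 'a \<Rightarrow> real) \<Rightarrow> bool" where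
  "smooth_family X \<sigma> g U u \<longleftrightarrow>
     (\<forall>c\<in>\<sigma>. \<forall>k. Ck_on_qdiffs k X \<sigma> g U (chart_range c) (\<lambda>\<alpha> z. u \<alpha> (chart_inv c z)))"


section \<open>Quasi-Fuchsian 3-manifolds\<close>

text \<open>Hyperbolic 3-space in the hyperboloid model; its orientation-preserving isometry group is
  \<open>SO\<^sup>+(3,1)\<close>.\<close>

definition lorentz :: "real^4 \<Rightarrow> real^4 \<Rightarrow> real" where
  "lorentz x y = x$1 * y$1 + x$2 * y$2 + x$3 * y$3 - x$4 * y$4"

definition hyperbolic_space :: "(real^4) set" where
  "hyperbolic_space = {x. lorentz x x = -1 \<and> x$4 > 0}"

definition isometries :: "(real^4^4) set" where
  "isometries = {A. (\<forall>x y. lorentz (A *v x) (A *v y) = lorentz x y) \<and> det A = 1 \<and>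
                    (\<forall>x\<in>hyperbolic_space. A *v x \<in> hyperbolic_space)}"

definition orbit_of :: "(real^4^4) set \<Rightarrow> real^4 \<Rightarrow> (real^4) set" where
  "orbit_of \<Gamma> x = (\<lambda>A. A *v x) ` \<Gamma>"

definition torsion_free_kleinian :: "(real^4^4) set \<Rightarrow> bool" where
  "torsion_free_kleinian \<Gamma> \<longleftrightarrow> \<Gamma> \<subseteq> isometries \<and>
     mat 1 \<in> \<Gamma> \<and> (\<forall>A\<in>\<Gamma>. \<forall>B\<in>\<Gamma>. A ** B \<in> \<Gamma>) \<and> (\<forall>A\<in>\<Gamma>. matrix_inv A \<in> \<Gamma>) \<and>
     (\<exists>\<epsilon>>0. \<forall>A\<in>\<Gamma>. A \<noteq> mat 1 \<longrightarrow> \<epsilon> \<le> dist A (mat 1)) \<and>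
     (\<forall>A\<in>\<Gamma>. \<forall>x\<in>hyperbolic_space. A *v x = x \<longrightarrow> A = mat 1)"

text \<open>The sphere at infinity is the set of light-like vectors \<open>\<xi>\<close> with \<open>\<xi>\<^sub>4 = 1\<close>; a sequence in
  hyperbolic space converges to \<open>\<xi>\<close> if it leaves every compact set and its projectivization
  converges to \<open>\<xi>\<close>.\<close>

definition limit_set :: "(real^4^4) set \<Rightarrow> (real^4) set" where
  "limit_set \<Gamma> = {\<xi>. \<exists>x\<in>hyperbolic_space. \<exists>A. (\<forall>n::nat. A n \<in> \<Gamma>) \<and>
     filterlim (\<lambda>n. (A n *v x) $ 4) at_top sequentially \<and>
     (\<lambda>n. (1 / (A n *v x) $ 4) *\<^sub>R (A n *v x)) \<longlonglongrightarrow> \<xi>}"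

text \<open>The manifold \<open>\<H>\<^sup>3/\<Gamma>\<close> is homeomorphic to \<open>\<Sigma> \<times> \<real>\<close> (there is a quotient map from \<open>\<H>\<^sup>3\<close> to
  \<open>\<Sigma> \<times> \<real>\<close> whose fibres are the \<open>\<Gamma>\<close>-orbits) and its limit set is a Jordan curve.\<close>

definition quasi_fuchsian :: "'a topology \<Rightarrow> (real^4^4) set \<Rightarrow> bool" where
  "quasi_fuchsian X \<Gamma> \<longleftrightarrow> torsion_free_kleinian \<Gamma> \<and>
     (\<exists>\<gamma>. simple_path \<gamma> \<and> pathfinish \<gamma> = pathstart \<gamma> \<and> path_image \<gamma> = limit_set \<Gamma>) \<and>
     (\<exists>q. quotient_map (top_of_set hyperbolic_space) (prod_topology X euclideanreal) q \<and>
        (\<forall>x\<in>hyperbolic_space. \<forall>y\<in>hyperbolic_space. q x = q y \<longleftrightarrow> y \<in> orbit_of \<Gamma> x))"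


section \<open>Minimal surfaces\<close>

definition first_form :: "(complex \<Rightarrow> real^4) \<Rightarrow> complex \<Rightarrow> complex \<Rightarrow> complex \<Rightarrow> real" where
  "first_form F z v w =
     lorentz (frechet_derivative F (at z) v) (frechet_derivative F (at z) w)"

text \<open>The unit normal is tangent to \<open>\<H>\<^sup>3\<close> (orthogonal to the position vector) and is chosen by a
  sign convention invariant under \<open>SO\<^sup>+(3,1)\<close> and holomorphic changes of coordinate.\<close>

definition unit_normal :: "(complex \<Rightarrow> real^4) \<Rightarrow> complex \<Rightarrow> real^4" where
  "unit_normal F z = (THE \<nu>. lorentz \<nu> \<nu> = 1 \<and> lorentz \<nu> (F z) = 0 \<and>
     (\<forall>v. lorentz \<nu> (frechet_derivative F (at z) v) = 0) \<and>
     0 < det (vector [F z, frechet_derivative F (at z) 1, frechet_derivative F (at z) \<i>, \<nu>] :: real^4^4))"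

text \<open>The component of the flat second derivative normal to the hyperboloid is proportional to
  \<open>F z\<close>, hence orthogonal to the unit normal; so no Christoffel terms are needed.\<close>

definition second_form :: "(complex \<Rightarrow> real^4) \<Rightarrow> complex \<Rightarrow> complex \<Rightarrow> complex \<Rightarrow> real" where
  "second_form F z v w = lorentz (second_derivative F z v w) (unit_normal F z)"

definition mean_curvature :: "(complex \<Rightarrow> real^4) \<Rightarrow> complex \<Rightarrow> real" where
  "mean_curvature F z =
     (first_form F z 1 1 * second_form F z \<i> \<i> - 2 * first_form F z 1 \<i> * second_form F z 1 \<i>
        + first_form F z \<i> \<i> * second_form F z 1 1)
     / (2 * (first_form F z 1 1 * first_form F z \<i> \<i> - (first_form F z 1 \<i>)\<^sup>2))"

text \<open>Points of \<open>\<H>\<^sup>3/\<Gamma>\<close> are \<open>\<Gamma>\<close>-orbits.  A map \<open>f\<close> from the surface to \<open>\<H>\<^sup>3/\<Gamma>\<close> is studied through its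
  lifts to \<open>\<H>\<^sup>3\<close> over chart domains.\<close>

definition local_lift ::
  "(real^4^4) set \<Rightarrow> ('a \<Rightarrow> (real^4) set) \<Rightarrow> 'a chart \<Rightarrow> (complex \<Rightarrow> real^4) \<Rightarrow> bool" where
  "local_lift \<Gamma> f c F \<longleftrightarrow> smooth_on F (chart_range c) \<and>
     (\<forall>p\<in>fst c. F (snd c p) \<in> hyperbolic_space \<and> f p = orbit_of \<Gamma> (F (snd c p)))"

definition immersion ::
  "'a topology \<Rightarrow> 'a chart set \<Rightarrow> (real^4^4) set \<Rightarrow> ('a \<Rightarrow> (real^4) set) \<Rightarrow> bool" where
  "immersion X \<sigma> \<Gamma> f \<longleftrightarrow>
     (\<forall>p\<in>topspace X. \<exists>c\<in>\<sigma>. p \<in> fst c \<and> (\<exists>F. local_lift \<Gamma> f c F)) \<and>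
     (\<forall>c\<in>\<sigma>. \<forall>F. local_lift \<Gamma> f c F \<longrightarrow>
        (\<forall>z\<in>chart_range c. inj (frechet_derivative F (at z))))"

definition minimal_immersion ::
  "'a topology \<Rightarrow> 'a chart set \<Rightarrow> (real^4^4) set \<Rightarrow> ('a \<Rightarrow> (real^4) set) \<Rightarrow> bool" where
  "minimal_immersion X \<sigma> \<Gamma> f \<longleftrightarrow> immersion X \<sigma> \<Gamma> f \<and>
     (\<forall>c\<in>\<sigma>. \<forall>F. local_lift \<Gamma> f c F \<longrightarrow> (\<forall>z\<in>chart_range c. mean_curvature F z = 0))"

text \<open>The induced metric is \<open>e\<^sup>2\<^sup>u g |dz|\<^sup>2\<close>, the second fundamental form is \<open>Re (\<alpha> dz\<^sup>2)\<close>.\<close>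

definition has_fundamental_forms ::
  "'a chart set \<Rightarrow> 'a metric \<Rightarrow> (real^4^4) set \<Rightarrow> ('a \<Rightarrow> (real^4) set) \<Rightarrow> ('a \<Rightarrow> real) \<Rightarrow> 'a qdiff \<Rightarrow> bool" where
  "has_fundamental_forms \<sigma> g \<Gamma> f u \<alpha> \<longleftrightarrow>
     (\<forall>c\<in>\<sigma>. \<forall>F. local_lift \<Gamma> f c F \<longrightarrow> (\<forall>p\<in>fst c. \<forall>v w.
        first_form F (snd c p) v w = exp (2 * u p) * g c p * (v \<bullet> w) \<and>
        second_form F (snd c p) v w = Re (\<alpha> c p * v * w)))"

definition gauss_equation ::
  "'a topology \<Rightarrow> 'a chart set \<Rightarrow> 'a metric \<Rightarrow> 'a qdiff \<Rightarrow> ('a \<Rightarrow> real) \<Rightarrow> bool" where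
  "gauss_equation X \<sigma> g \<alpha> u \<longleftrightarrow>
     (\<forall>p\<in>topspace X.
        laplace_beltrami \<sigma> g u p + 1 - exp (2 * u p)
        - (let c = chart_at \<sigma> p in (cmod (\<alpha> c p))\<^sup>2 / (g c p)\<^sup>2) * exp (- 2 * u p) = 0)"

definition minimal_surface_family ::
  "'a topology \<Rightarrow> 'a chart set \<Rightarrow> 'a metric \<Rightarrow> 'a qdiff set \<Rightarrow> ('a qdiff \<Rightarrow> 'a \<Rightarrow> real) \<Rightarrow> bool" where
  "minimal_surface_family X \<sigma> g U u \<longleftrightarrow>
     open_in_qdiffs X \<sigma> g U \<and> qzero \<in> U \<and>
     (\<forall>\<alpha>\<in>U. gauss_equation X \<sigma> g \<alpha> (u \<alpha>) \<and>
        (\<exists>\<Gamma> f. quasi_fuchsian X \<Gamma> \<and> minimal_immersion X \<sigma> \<Gamma> f \<and>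
                has_fundamental_forms \<sigma> g \<Gamma> f (u \<alpha>) \<alpha>)) \<and>
     smooth_family X \<sigma> g U u \<and> (\<forall>p\<in>topspace X. u qzero p = 0)"

definition area_functional ::
  "'a topology \<Rightarrow> 'a chart set \<Rightarrow> 'a metric \<Rightarrow> ('a qdiff \<Rightarrow> 'a \<Rightarrow> real) \<Rightarrow> 'a qdiff \<Rightarrow> real" where
  "area_functional X \<sigma> g u \<alpha> = (\<integral>p. exp (2 * u \<alpha> p) \<partial>area_measure X \<sigma> g)"

end

theory Submission
  imports Defs
begin

text \<open>
  The theorem rests on the integrated Gauss equation. The surface is closed, so the integral of
  \<open>\<Delta>u\<close> vanishes, and integrating the Gauss equation for \<open>u = u\<^sub>\<alpha>\<close> gives
    \<open>|\<Sigma>(\<alpha>)| = |\<Sigma>(0)| - \<integral> |\<alpha>|\<^sup>2/g\<^sup>2 e\<^sup>-\<^sup>2\<^sup>u dA\<close>.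
  The integral is quadratic in \<open>\<alpha>\<close> up to the factor \<open>e\<^sup>-\<^sup>2\<^sup>u\<close>, which is continuous in \<open>\<alpha>\<close> and equals \<open>1\<close>
  at \<open>\<alpha> = 0\<close>. Hence the area changes by \<open>O(\<parallel>\<alpha>\<parallel>\<^sup>2)\<close>, so \<open>0\<close> is a critical point.

  For the second variation, expand \<open>|t\<alpha> + s\<beta>|\<^sup>2\<close>. At \<open>t = 0\<close> the term \<open>|t|\<^sup>2|\<alpha>|\<^sup>2\<close> has zero derivative
  in \<open>t\<close>; the mixed term \<open>2 Re (t cnj s \<alpha> cnj \<beta>)\<close> contributes \<open>-cnj s \<integral> \<alpha>cnj \<beta>/g\<^sup>2 e\<^sup>-\<^sup>2\<^sup>u dA\<close> to \<open>\<partial>/\<partial>t\<close>, with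
  \<open>u\<close> taken at \<open>s\<beta>\<close>; the term \<open>|s|\<^sup>2|\<beta>|\<^sup>2\<close> depends on \<open>t\<close> only through \<open>u\<close> and contributes
  \<open>O(|s|\<^sup>2)\<close>, because the derivative of \<open>u\<close> in the parameters is bounded near \<open>0\<close>. Therefore
  \<open>\<partial>\<^sup>2/(\<partial>cnj s \<partial>t)\<close> at \<open>0\<close> is \<open>-\<langle>\<alpha>,\<beta>\<rangle>\<close>: the constant is \<open>c = -1\<close>.

  The supporting facts are these. The area measure is characterized by its values in charts; it
  exists because the area of a set can be computed in any chart containing it
  (\<open>chart_area_compatible\<close>, by the change of variables for injective holomorphic maps), so that the
  charts of a finite cover can be glued. The divergence theorem \<open>integral_laplace_beltrami_eq_0\<close>
  follows by a partition of unity from the planar case, where the integral of a directional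
  derivative of a compactly supported function vanishes by translation invariance. Compactness of
  the surface, through finite covers by coordinate discs, turns the joint regularity of \<open>u\<close> in
  charts into uniform bounds, which is what differentiation under the integral sign requires.
\<close>

section \<open>Functions of class \<open>C\<^sup>k\<close>\<close>

lemma frechet_derivative_cong_open:
  assumes "open S" "x \<in> S" "\<And>y. y \<in> S \<Longrightarrow> f y = g y"
  shows "frechet_derivative f (at x) = frechet_derivative g (at x)"
proof -
  have "(f has_derivative D) (at x) \<longleftrightarrow> (g has_derivative D) (at x)" for D
    using has_derivative_transform_within_open[OF _ assms(1,2), of f D UNIV g]
      has_derivative_transform_within_open[OF _ assms(1,2), of g D UNIV f] assms(3) by auto
  then show ?thesis
    by (simp add: frechet_derivative_def)
qed

lemma Ck_on_cong:
  assumes "open S" "\<And>x. x \<in> S \<Longrightarrow> f x = g x" "Ck_on k f S"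
  shows "Ck_on k g S"
  using assms(2,3)
proof (induction k arbitrary: f g)
  case 0
  then show ?case by (simp cong: continuous_on_cong)
next
  case (Suc k)
  have "g differentiable_on S"
    unfolding differentiable_on_def
  proof
    fix x assume x: "x \<in> S"
    then have "f differentiable (at x)"
      using Suc.prems(2) assms(1) by (simp add: differentiable_on_eq_differentiable_at)
    then obtain D where "(f has_derivative D) (at x)"
      by (auto simp: differentiable_def)
    then have "(g has_derivative D) (at x)"
      using has_derivative_transform_within_open[OF _ assms(1) x] Suc.prems(1) by blast
    then show "g differentiable (at x within S)"
      using differentiable_at_withinI differentiableI by blast
  qed
  moreover have "Ck_on k (\<lambda>x. frechet_derivative g (at x) v) S" for v
  proof (rule Suc.IH)
    show "Ck_on k (\<lambda>x. frechet_derivative f (at x) v) S"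
      using Suc.prems(2) by simp
    show "frechet_derivative f (at x) v = frechet_derivative g (at x) v" if "x \<in> S" for x
      using frechet_derivative_cong_open[OF assms(1) that, of f g] Suc.prems(1) by simp
  qed
  ultimately show ?case by simp
qed

lemma Ck_on_subset:
  assumes "Ck_on k f S" "T \<subseteq> S"
  shows "Ck_on k f T"
  using assms(1)
proof (induction k arbitrary: f)
  case 0
  then show ?case using assms(2) by (auto intro: continuous_on_subset)
next
  case (Suc k)
  then have "f differentiable_on T" "Ck_on k (\<lambda>x. frechet_derivative f (at x) v) T" for v
    using assms(2) by (auto intro: differentiable_on_subset)
  then show ?case by simp
qed

lemma Ck_on_SucI:
  assumes "open S" "\<And>x. x \<in> S \<Longrightarrow> (f has_derivative f' x) (at x)"
    and "\<And>v. Ck_on k (\<lambda>x. f' x v) S"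
  shows "Ck_on (Suc k) f S"
proof -
  have "f differentiable_on S"
    using assms(2) by (auto intro!: differentiable_at_imp_differentiable_on intro: differentiableI)
  moreover have "Ck_on k (\<lambda>x. frechet_derivative f (at x) v) S" for v
    by (rule Ck_on_cong[OF assms(1) _ assms(3)]) (simp add: frechet_derivative_at[OF assms(2), symmetric])
  ultimately show ?thesis by simp
qed

lemma Ck_on_SucD:
  assumes "Ck_on (Suc k) f S" "open S" "x \<in> S"
  shows "(f has_derivative frechet_derivative f (at x)) (at x)"
  using assms by (simp add: differentiable_on_eq_differentiable_at frechet_derivative_works)

lemma Ck_on_Un:
  assumes "open S" "open T" "Ck_on k f S" "Ck_on k f T"
  shows "Ck_on k f (S \<union> T)"
  using assms(3,4)
proof (induction k arbitrary: f)
  case 0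
  then show ?case using assms(1,2) by (simp add: continuous_on_open_Un)
next
  case (Suc k)
  show ?case
  proof (rule Ck_on_SucI)
    show "(f has_derivative frechet_derivative f (at x)) (at x)" if "x \<in> S \<union> T" for x
      using that Ck_on_SucD[OF Suc.prems(1) assms(1)] Ck_on_SucD[OF Suc.prems(2) assms(2)] by blast
    show "Ck_on k (\<lambda>x. frechet_derivative f (at x) v) (S \<union> T)" for v
      using Suc.prems by (intro Suc.IH) simp_all
  qed (use assms in auto)
qed

lemma Ck_on_Suc_imp: "Ck_on (Suc k) f S \<Longrightarrow> Ck_on k f S"
proof (induction k arbitrary: f)
  case 0
  then have "f differentiable_on S"
    by simp
  then show ?case by (simp add: differentiable_imp_continuous_on)
next
  case (Suc k)
  have 1: "f differentiable_on S" and 2: "\<forall>v. Ck_on (Suc k) (\<lambda>x. frechet_derivative f (at x) v) S"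
    using Suc.prems unfolding Ck_on.simps(2)[of "Suc k" f S] by blast+
  have "Ck_on k (\<lambda>x. frechet_derivative f (at x) v) S" for v
    by (rule Suc.IH, rule 2[rule_format])
  with 1 show ?case
    unfolding Ck_on.simps(2)[of k f S] by blast
qed

lemma Ck_on_imp_continuous_on: "Ck_on k f S \<Longrightarrow> continuous_on S f"
proof (induction k)
  case (Suc k)
  from Suc.IH[OF Ck_on_Suc_imp[OF Suc.prems]] show ?case .
qed simp

lemma Ck_on_const:
  assumes "open S"
  shows "Ck_on k (\<lambda>x. c) S"
proof (induction k arbitrary: c)
  case (Suc k)
  show ?case
  proof (rule Ck_on_SucI[OF assms])
    show "((\<lambda>x. c) has_derivative (\<lambda>v. 0)) (at x)" for x :: 'a
      by (rule has_derivative_const)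
    show "Ck_on k (\<lambda>x::'a. 0::'b) S" for v :: 'a
      by (rule Suc)
  qed
qed (simp add: continuous_on_const)

lemma Ck_on_add:
  assumes "open S" "Ck_on k f S" "Ck_on k g S"
  shows "Ck_on k (\<lambda>x. f x + g x) S"
  using assms(2,3)
proof (induction k arbitrary: f g)
  case 0
  then show ?case by (simp add: continuous_on_add)
next
  case (Suc k)
  show ?case
  proof (rule Ck_on_SucI[OF assms(1)])
    show "((\<lambda>x. f x + g x) has_derivative
        (\<lambda>v. frechet_derivative f (at x) v + frechet_derivative g (at x) v)) (at x)" if "x \<in> S" for x
      using Ck_on_SucD[OF Suc.prems(1) assms(1) that] Ck_on_SucD[OF Suc.prems(2) assms(1) that]
      by (rule has_derivative_add)
    show "Ck_on k (\<lambda>x. frechet_derivative f (at x) v + frechet_derivative g (at x) v) S" for v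
      using Suc.prems by (intro Suc.IH) simp_all
  qed
qed

lemma Ck_on_sum:
  assumes "open S" "\<And>i. i \<in> I \<Longrightarrow> Ck_on k (f i) S"
  shows "Ck_on k (\<lambda>x. \<Sum>i\<in>I. f i x) S"
  using assms(2)
proof (induction I rule: infinite_finite_induct)
  case (insert i I)
  have "Ck_on k (\<lambda>x. f i x + (\<Sum>i\<in>I. f i x)) S"
    using insert.prems by (intro Ck_on_add assms(1) insert.IH) simp_all
  then show ?case using insert.hyps by simp
qed (simp_all add: Ck_on_const[OF assms(1)])

lemma Ck_on_mult:
  fixes f g :: "'a::real_normed_vector \<Rightarrow> real"
  assumes "open S" "Ck_on k f S" "Ck_on k g S"
  shows "Ck_on k (\<lambda>x. f x * g x) S"
  using assms(2,3)
proof (induction k arbitrary: f g)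
  case 0
  then show ?case by (simp add: continuous_on_mult)
next
  case (Suc k)
  show ?case
  proof (rule Ck_on_SucI[OF assms(1)])
    show "((\<lambda>x. f x * g x) has_derivative
        (\<lambda>v. f x * frechet_derivative g (at x) v + frechet_derivative f (at x) v * g x)) (at x)"
      if "x \<in> S" for x
      using Ck_on_SucD[OF Suc.prems(1) assms(1) that] Ck_on_SucD[OF Suc.prems(2) assms(1) that]
      by (rule has_derivative_mult)
    show "Ck_on k (\<lambda>x. f x * frechet_derivative g (at x) v + frechet_derivative f (at x) v * g x) S" for v
      using Suc.prems Ck_on_Suc_imp[OF Suc.prems(1)] Ck_on_Suc_imp[OF Suc.prems(2)]
      by (intro Ck_on_add assms(1) Suc.IH) simp_all
  qed
qed

lemma Ck_on_inverse:
  fixes f :: "'a::real_normed_vector \<Rightarrow> real"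
  assumes "open S" "Ck_on k f S" "\<And>x. x \<in> S \<Longrightarrow> f x \<noteq> 0"
  shows "Ck_on k (\<lambda>x. inverse (f x)) S"
  using assms(2)
proof (induction k)
  case 0
  then show ?case using assms(3) by (simp add: continuous_on_inverse)
next
  case (Suc k)
  show ?case
  proof (rule Ck_on_SucI[OF assms(1)])
    show "((\<lambda>x. inverse (f x)) has_derivative
        (\<lambda>v. - (inverse (f x) * frechet_derivative f (at x) v * inverse (f x)))) (at x)"
      if "x \<in> S" for x
      by (rule Deriv.has_derivative_inverse[OF assms(3)[OF that] Ck_on_SucD[OF Suc.prems assms(1) that]])
    have "Ck_on k (\<lambda>x. (- 1) * (inverse (f x) * frechet_derivative f (at x) v * inverse (f x))) S" for v
      using Suc.prems Suc.IH[OF Ck_on_Suc_imp[OF Suc.prems]]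
      by (intro Ck_on_mult Ck_on_const assms(1)) simp_all
    then show "Ck_on k (\<lambda>x. - (inverse (f x) * frechet_derivative f (at x) v * inverse (f x))) S" for v
      by simp
  qed
qed

lemma Ck_on_Re_holomorphic:
  assumes "open S" "h holomorphic_on S"
  shows "Ck_on k (\<lambda>z. Re (h z)) S"
  using assms(2)
proof (induction k arbitrary: h)
  case 0
  then show ?case
    by (simp add: continuous_on_Re holomorphic_on_imp_continuous_on)
next
  case (Suc k)
  show ?case
  proof (rule Ck_on_SucI[OF assms(1)])
    show "((\<lambda>z. Re (h z)) has_derivative (\<lambda>v. Re (deriv h x * v))) (at x)" if "x \<in> S" for x
      using has_derivative_Re[OF holomorphic_derivI[OF Suc.prems assms(1) that,
            unfolded has_field_derivative_def]] .
    show "Ck_on k (\<lambda>x. Re (deriv h x * v)) S" for v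
      using Suc.IH[of "\<lambda>x. deriv h x * v"] holomorphic_deriv[OF Suc.prems assms(1)]
      by (simp add: holomorphic_intros)
  qed
qed

lemma complex_linear_expand:
  fixes L :: "complex \<Rightarrow> 'b::real_vector"
  assumes "linear L"
  shows "L w = Re w *\<^sub>R L 1 + Im w *\<^sub>R L \<i>"
proof -
  have "w = Re w *\<^sub>R 1 + Im w *\<^sub>R \<i>"
    by (simp add: complex_eq_iff)
  then have "L w = L (Re w *\<^sub>R 1 + Im w *\<^sub>R \<i>)"
    by simp
  then show ?thesis
    by (simp only: linear_add[OF assms] linear_cmul[OF assms])
qed

lemma Ck_on_compose_holomorphic:
  fixes f :: "complex \<Rightarrow> real"
  assumes S: "open S" and V: "open V" and T: "T holomorphic_on S" "T ` S \<subseteq> V" and f: "Ck_on k f V"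
  shows "Ck_on k (\<lambda>z. f (T z)) S"
  using f
proof (induction k arbitrary: f)
  case 0
  then show ?case
    using continuous_on_compose2[OF _ holomorphic_on_imp_continuous_on[OF T(1)] T(2), of f] by simp
next
  case (Suc k)
  let ?D = "\<lambda>x. frechet_derivative f (at x)"
  show ?case
  proof (rule Ck_on_SucI[OF S])
    fix x assume x: "x \<in> S"
    then have D: "(f has_derivative ?D (T x)) (at (T x))"
      using Ck_on_SucD[OF Suc.prems V] T by blast
    have "(T has_derivative (\<lambda>v. deriv T x * v)) (at x)"
      using holomorphic_derivI[OF T(1) S x] by (simp add: has_field_derivative_def)
    from has_derivative_compose[OF this D]
    have "((\<lambda>z. f (T z)) has_derivative (\<lambda>v. ?D (T x) (deriv T x * v))) (at x)" .
    moreover have "?D (T x) (deriv T x * v) =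
        Re (deriv T x * v) * ?D (T x) 1 + Re (- \<i> * (deriv T x * v)) * ?D (T x) \<i>" for v
      by (subst complex_linear_expand[OF has_derivative_linear[OF D]]) simp
    ultimately show "((\<lambda>z. f (T z)) has_derivative
       (\<lambda>v. Re (deriv T x * v) * ?D (T x) 1 + Re (- \<i> * (deriv T x * v)) * ?D (T x) \<i>)) (at x)"
      by simp
  next
    fix v
    have "Ck_on k (\<lambda>x. ?D x w) V" for w
      using Suc.prems unfolding Ck_on.simps(2)[of k f V] by blast
    from Suc.IH[OF this] have "Ck_on k (\<lambda>x. ?D (T x) w) S" for w .
    moreover have hol: "(\<lambda>x. deriv T x * v) holomorphic_on S"
      by (rule holomorphic_on_mult[OF holomorphic_deriv[OF T(1) S] holomorphic_on_const])
    have "Ck_on k (\<lambda>x. Re (deriv T x * v)) S" "Ck_on k (\<lambda>x. Re (- \<i> * (deriv T x * v))) S"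
      by (rule Ck_on_Re_holomorphic[OF S hol]
          Ck_on_Re_holomorphic[OF S holomorphic_on_mult[OF holomorphic_on_const hol]])+
    ultimately show "Ck_on k (\<lambda>x. Re (deriv T x * v) * ?D (T x) 1 + Re (- \<i> * (deriv T x * v)) * ?D (T x) \<i>) S"
      by (intro Ck_on_add Ck_on_mult S) assumption+
  qed
qed

text \<open>Bump functions of class \<open>C\<^sup>2\<close> suffice for integrating a Laplacian by parts. A power of the
  positive part of a smooth function is such a bump: each derivative costs one power, and the one-sided
  derivatives at the zero set agree as long as the exponent is at least two.\<close>

lemma has_derivative_max_power:
  assumes "(q has_derivative q') (at x)"
  shows "((\<lambda>x. max 0 (q x :: real) ^ Suc (Suc n)) has_derivative
           (\<lambda>v. real (Suc (Suc n)) * max 0 (q x) ^ Suc n * q' v)) (at x)"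
proof -
  have "((\<lambda>y::real. max 0 y ^ Suc (Suc n)) has_real_derivative
           real (Suc (Suc n)) * max 0 y ^ Suc n) (at y)" for y
  proof -
    consider "y > 0" | "y < 0" | "y = 0" by linarith
    then show ?thesis
    proof cases
      case 1
      have "((\<lambda>y::real. y ^ Suc (Suc n)) has_real_derivative real (Suc (Suc n)) * max 0 y ^ Suc n) (at y)"
        using 1 DERIV_pow[of "Suc (Suc n)" y] by simp
      then show ?thesis
        by (rule has_field_derivative_transform_within_open[where S="{0<..}"]) (use 1 in auto)
    next
      case 2
      have "((\<lambda>y::real. 0) has_real_derivative real (Suc (Suc n)) * max 0 y ^ Suc n) (at y)"
        using 2 by auto
      then show ?thesis
        by (rule has_field_derivative_transform_within_open[where S="{..<0}"]) (use 2 in auto)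
    next
      case 3
      have "((\<lambda>h::real. max 0 h ^ Suc (Suc n) / h) \<longlongrightarrow> 0) (at 0)"
      proof (rule Lim_null_comparison)
        show "\<forall>\<^sub>F h in at (0::real). norm (max 0 h ^ Suc (Suc n) / h) \<le> max 0 h ^ Suc n"
          by (rule always_eventually) (auto simp: max_def)
        show "((\<lambda>h::real. max 0 h ^ Suc n) \<longlongrightarrow> 0) (at 0)"
          by (auto intro!: tendsto_eq_intros)
      qed
      then show ?thesis
        using 3 by (simp add: has_field_derivative_iff)
    qed
  qed
  from has_derivative_compose[OF assms this[of "q x", unfolded has_field_derivative_def]]
  show ?thesis by simp
qed

lemma Ck_on_max_power:
  assumes "open S" "\<And>m. Ck_on m q S"
  shows "Ck_on k (\<lambda>x. max 0 (q x :: real) ^ Suc k) S"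
proof (induction k)
  case 0
  show ?case
    using Ck_on_imp_continuous_on[OF assms(2)[of 0]] by (simp add: continuous_on_max)
next
  case (Suc k)
  show ?case
  proof (rule Ck_on_SucI[OF assms(1)])
    show "((\<lambda>x. max 0 (q x) ^ Suc (Suc k)) has_derivative
       (\<lambda>v. real (Suc (Suc k)) * max 0 (q x) ^ Suc k * frechet_derivative q (at x) v)) (at x)"
      if "x \<in> S" for x
      using Ck_on_SucD[OF assms(2)[of "Suc 0"] assms(1) that] by (rule has_derivative_max_power)
    show "Ck_on k (\<lambda>x. real (Suc (Suc k)) * max 0 (q x) ^ Suc k * frechet_derivative q (at x) v) S" for v
      using assms(2)[of "Suc k"]
      by (intro Ck_on_mult Ck_on_const assms(1) Suc) auto
  qed
qed

text \<open>Differentiability along lines is always given at the parameter value \<open>0\<close>; moving the base point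
  along the line turns it into differentiability at every parameter value.\<close>

lemma has_real_derivative_along_line:
  fixes f :: "complex \<Rightarrow> real"
  assumes "((\<lambda>h. f (z + of_real r * w + of_real h * w)) has_real_derivative D) (at 0)"
  shows "((\<lambda>r. f (z + of_real r * w)) has_real_derivative D) (at r)"
proof -
  have "((\<lambda>h. f (z + of_real (h + r) * w)) has_real_derivative D) (at 0)"
    using assms by (simp add: algebra_simps)
  then show ?thesis
    using DERIV_shift[of "\<lambda>r. f (z + of_real r * w)" D 0 r] by simp
qed

text \<open>Move from \<open>z\<close> to \<open>y\<close> first horizontally, then vertically, and apply the mean value inequality on
  each leg; continuity of the partial derivatives makes both errors \<open>o(|y - z|)\<close>.\<close>

lemma has_derivative_of_continuous_partials:
  fixes f p q :: "complex \<Rightarrow> real"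
  assumes V: "open V" "z \<in> V"
    and p: "\<And>y. y \<in> V \<Longrightarrow> ((\<lambda>r. f (y + of_real r)) has_real_derivative p y) (at 0)"
    and q: "\<And>y. y \<in> V \<Longrightarrow> ((\<lambda>r. f (y + of_real r * \<i>)) has_real_derivative q y) (at 0)"
    and cont: "continuous_on V p" "continuous_on V q"
  shows "(f has_derivative (\<lambda>w. Re w * p z + Im w * q z)) (at z)"
  unfolding has_derivative_at_alt
proof (intro conjI allI impI)
  show "bounded_linear (\<lambda>w. Re w * p z + Im w * q z)"
    by (intro bounded_linear_intros bounded_linear_Re bounded_linear_Im)
  fix e :: real assume e: "e > 0"
  have "isCont p z" "isCont q z"
    using cont V by (simp_all add: continuous_on_eq_continuous_at)
  then obtain d1 d2 where d: "d1 > 0" "d2 > 0"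
    "\<And>y. dist y z < d1 \<Longrightarrow> dist (p y) (p z) < e/2"
    "\<And>y. dist y z < d2 \<Longrightarrow> dist (q y) (q z) < e/2"
    using half_gt_zero[OF e] unfolding continuous_at_eps_delta by blast
  obtain d3 where d3: "d3 > 0" "ball z d3 \<subseteq> V"
    using V openE by blast
  define d where "d = min d1 (min d2 d3)"
  have dpos: "d > 0" using d d3 by (simp add: d_def)
  have inV: "y \<in> V" if "norm (y - z) < d" for y
    using that d3(2) by (intro subsetD[OF d3(2)]) (simp add: d_def dist_norm norm_minus_commute)
  have pz: "\<bar>p y - p z\<bar> \<le> e/2" if "norm (y - z) < d" for y
    using d(3)[of y] that unfolding dist_norm d_def by simp
  have qz: "\<bar>q y - q z\<bar> \<le> e/2" if "norm (y - z) < d" for y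
    using d(4)[of y] that unfolding dist_norm d_def by simp
  show "\<exists>d>0. \<forall>y. norm (y - z) < d \<longrightarrow>
          norm (f y - f z - (Re (y - z) * p z + Im (y - z) * q z)) \<le> e * norm (y - z)"
  proof (rule exI[of _ d], intro conjI allI impI dpos)
    fix y assume y: "norm (y - z) < d"
    define a b where "a = Re (y - z)" and "b = Im (y - z)"
    have yz: "y = z + of_real a + of_real b * \<i>"
      by (simp add: a_def b_def complex_eq_iff)
    have ab: "\<bar>a\<bar> \<le> norm (y - z)" "\<bar>b\<bar> \<le> norm (y - z)"
      unfolding a_def b_def by (rule abs_Re_le_cmod abs_Im_le_cmod)+
    have b_le: "norm (z + of_real a + of_real r * \<i> - z) < d" if "\<bar>r\<bar> \<le> \<bar>b\<bar>" for r
    proof -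
      have "norm (z + of_real a + of_real r * \<i> - z) = norm (Complex a r)"
        by (rule arg_cong[where f=norm]) (simp add: complex_eq_iff)
      also have "\<dots> \<le> norm (Complex a b)"
        using that by (simp add: complex_norm abs_le_square_iff)
      also have "Complex a b = y - z"
        by (simp add: a_def b_def complex_eq_iff)
      finally show ?thesis
        using y by linarith
    qed
    have "norm ((f (z + of_real a) - a * p z) - (f (z + of_real 0) - 0 * p z)) \<le> (e/2) * norm (a - 0)"
    proof (rule field_differentiable_bound[where f'="\<lambda>r. p (z + of_real r) - p z" and S="cball 0 \<bar>a\<bar>"])
      fix r :: real assume r: "r \<in> cball 0 \<bar>a\<bar>"
      have "norm (z + of_real r - z) = \<bar>r\<bar>" by simp
      also have "\<dots> \<le> \<bar>a\<bar>" using r by simp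
      finally have *: "norm (z + of_real r - z) < d"
        using ab y by linarith
      have "((\<lambda>r. f (z + of_real r)) has_real_derivative p (z + of_real r)) (at r)"
        by (rule has_real_derivative_along_line[of f z r 1, unfolded mult_1_right, OF p[OF inV[OF *]]])
      then show "((\<lambda>r. f (z + of_real r) - r * p z) has_real_derivative p (z + of_real r) - p z)
          (at r within cball 0 \<bar>a\<bar>)"
        by (rule has_field_derivative_at_within[OF DERIV_diff]) (auto intro!: derivative_eq_intros)
      show "norm (p (z + of_real r) - p z) \<le> e/2"
        using pz[OF *] by simp
    qed auto
    moreover
    have "norm ((f (z + of_real a + of_real b * \<i>) - b * q z) - (f (z + of_real a + of_real 0 * \<i>) - 0 * q z)) \<le> (e/2) * norm (b - 0)"
    proof (rule field_differentiable_bound[where f'="\<lambda>r. q (z + of_real a + of_real r * \<i>) - q z" and S="cball 0 \<bar>b\<bar>"])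
      fix r :: real assume r: "r \<in> cball 0 \<bar>b\<bar>"
      then have *: "norm (z + of_real a + of_real r * \<i> - z) < d"
        by (intro b_le) simp
      have "((\<lambda>r. f (z + of_real a + of_real r * \<i>)) has_real_derivative q (z + of_real a + of_real r * \<i>)) (at r)"
        by (rule has_real_derivative_along_line[of f "z + of_real a" r "\<i>", OF q[OF inV[OF *]]])
      then show "((\<lambda>r. f (z + of_real a + of_real r * \<i>) - r * q z) has_real_derivative q (z + of_real a + of_real r * \<i>) - q z)
          (at r within cball 0 \<bar>b\<bar>)"
        by (rule has_field_derivative_at_within[OF DERIV_diff]) (auto intro!: derivative_eq_intros)
      show "norm (q (z + of_real a + of_real r * \<i>) - q z) \<le> e/2"
        using qz[OF *] by simp
    qed auto
    ultimately have "norm (f y - f z - (a * p z + b * q z)) \<le> (e/2) * \<bar>a\<bar> + (e/2) * \<bar>b\<bar>"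
      unfolding real_norm_def yz[symmetric] by (simp only: of_real_0 mult_zero_left add_0_right diff_0_right)
    also have "\<dots> \<le> e * norm (y - z)"
    proof -
      have "e * \<bar>a\<bar> \<le> e * norm (y - z)" "e * \<bar>b\<bar> \<le> e * norm (y - z)"
        using ab e by (simp_all add: mult_left_mono)
      then show ?thesis by simp
    qed
    finally show "norm (f y - f z - (Re (y - z) * p z + Im (y - z) * q z)) \<le> e * norm (y - z)"
      by (simp add: a_def b_def)
  qed
qed


lemma finite_positive_lower_bound:
  fixes d :: "'i \<Rightarrow> real"
  assumes "finite I" "\<And>i. i \<in> I \<Longrightarrow> 0 < d i"
  obtains e where "0 < e" "\<And>i. i \<in> I \<Longrightarrow> e \<le> d i"
proof
  show "0 < Min (insert 1 (d ` I))" using assms by simp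
  show "Min (insert 1 (d ` I)) \<le> d i" if "i \<in> I" for i using assms(1) that by simp
qed

text \<open>The linear factor vanishes at \<open>0\<close>, so continuity of the other factor at \<open>0\<close> makes the product
  differentiable there. The terms of the area that are linear in \<open>t\<close> or \<open>cnj s\<close> are differentiated
  in this way.\<close>

lemma has_derivative_mult_at_0:
  fixes \<phi> :: "complex \<Rightarrow> complex"
  assumes l: "bounded_linear l" and \<phi>: "isCont \<phi> 0"
  shows "((\<lambda>x. l x * \<phi> x) has_derivative (\<lambda>x. l x * \<phi> 0)) (at (0::complex))"
proof -
  interpret l: bounded_linear l by (rule l)
  obtain K where K: "\<And>x. norm (l x) \<le> norm x * K" using l.bounded by blast
  have "bounded_linear (\<lambda>x. l x * \<phi> 0)"
    by (rule bounded_linear_mult_const[OF l])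
  moreover have "((\<lambda>h. norm (l (0 + h) * \<phi> (0 + h) - l 0 * \<phi> 0 - l h * \<phi> 0) / norm h) \<longlongrightarrow> 0) (at 0)"
  proof (rule Lim_null_comparison)
    show "\<forall>\<^sub>F h in at 0. norm (norm (l (0 + h) * \<phi> (0 + h) - l 0 * \<phi> 0 - l h * \<phi> 0) / norm h)
        \<le> K * norm (\<phi> h - \<phi> 0)"
    proof (rule eventually_at_filter[THEN iffD2, OF always_eventually], intro allI impI)
      fix h :: complex assume "h \<noteq> 0"
      have "norm (l h * (\<phi> h - \<phi> 0)) \<le> (norm h * K) * norm (\<phi> h - \<phi> 0)"
        unfolding norm_mult by (intro mult_right_mono K) simp
      then show "norm (norm (l (0 + h) * \<phi> (0 + h) - l 0 * \<phi> 0 - l h * \<phi> 0) / norm h) \<le> K * norm (\<phi> h - \<phi> 0)"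
        using \<open>h \<noteq> 0\<close> by (simp add: right_diff_distrib divide_le_eq mult_ac)
    qed
    have "((\<lambda>h. \<phi> h - \<phi> 0) \<longlongrightarrow> 0) (at 0)"
      using \<phi> by (simp add: isCont_def LIM_zero)
    then show "((\<lambda>h. K * norm (\<phi> h - \<phi> 0)) \<longlongrightarrow> 0) (at 0)"
      by (intro tendsto_mult_right_zero tendsto_norm_zero)
  qed
  ultimately show ?thesis
    unfolding has_derivative_at by blast
qed

lemma flat_laplacian_cong_open:
  assumes "open S" "z \<in> S" "\<And>y. y \<in> S \<Longrightarrow> f y = g y"
  shows "flat_laplacian f z = flat_laplacian g z"
proof -
  have "frechet_derivative (\<lambda>y. frechet_derivative f (at y) v) (at z)
      = frechet_derivative (\<lambda>y. frechet_derivative g (at y) v) (at z)" for v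
    by (rule frechet_derivative_cong_open[OF assms(1,2)])
      (simp add: frechet_derivative_cong_open[OF assms(1) _ assms(3)])
  then show ?thesis
    by (simp add: flat_laplacian_def second_derivative_def)
qed

lemma flat_laplacianI:
  assumes "open S" "z \<in> S" "\<And>y. y \<in> S \<Longrightarrow> (f has_derivative f' y) (at y)"
    and "((\<lambda>y. f' y 1) has_derivative fx) (at z)" "((\<lambda>y. f' y \<i>) has_derivative fy) (at z)"
  shows "flat_laplacian f z = fx 1 + fy \<i>"
proof -
  have "frechet_derivative (\<lambda>y. frechet_derivative f (at y) v) (at z)
      = frechet_derivative (\<lambda>y. f' y v) (at z)" for v
    by (rule frechet_derivative_cong_open[OF assms(1,2)])
      (simp add: frechet_derivative_at[OF assms(3), symmetric])
  then show ?thesis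
    by (simp add: flat_laplacian_def second_derivative_def
        frechet_derivative_at[OF assms(4), symmetric] frechet_derivative_at[OF assms(5), symmetric])
qed

lemma C2_second_derivative:
  assumes "Ck_on 2 f S" "open S" "z \<in> S"
  shows "((\<lambda>y. frechet_derivative f (at y) v) has_derivative
           (\<lambda>w. second_derivative f z v w)) (at z)"
proof -
  have "Ck_on (Suc 0) (\<lambda>y. frechet_derivative f (at y) v) S"
    using assms(1) unfolding numeral_2_eq_2 Ck_on.simps(2)[of "Suc 0" f S] by blast
  from Ck_on_SucD[OF this assms(2,3)] show ?thesis
    unfolding second_derivative_def .
qed

lemma C2_derivative:
  assumes "Ck_on 2 f S" "open S" "z \<in> S"
  shows "(f has_derivative frechet_derivative f (at z)) (at z)"
  using Ck_on_SucD[OF _ assms(2,3), of 1 f] assms(1) by (simp add: numeral_2_eq_2)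

lemma continuous_on_flat_laplacian:
  assumes "Ck_on 2 f S" "open S"
  shows "continuous_on S (flat_laplacian f)"
proof -
  have C1: "Ck_on (Suc 0) (\<lambda>x. frechet_derivative f (at x) v) S" for v
    using assms(1) unfolding numeral_2_eq_2 Ck_on.simps(2)[of "Suc 0" f] by blast
  have "continuous_on S (\<lambda>x. second_derivative f x v w)" for v w
    using C1[of v] unfolding second_derivative_def Ck_on.simps by blast
  then show ?thesis
    unfolding flat_laplacian_def[abs_def] by (intro continuous_on_add)
qed

lemma flat_laplacian_sum:
  fixes f :: "'i \<Rightarrow> complex \<Rightarrow> real"
  assumes "open S" "z \<in> S" "\<And>i. i \<in> I \<Longrightarrow> Ck_on 2 (f i) S"
  shows "flat_laplacian (\<lambda>y. \<Sum>i\<in>I. f i y) z = (\<Sum>i\<in>I. flat_laplacian (f i) z)"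
proof -
  have "flat_laplacian (\<lambda>y. \<Sum>i\<in>I. f i y) z =
     (\<Sum>i\<in>I. second_derivative (f i) z 1 1) + (\<Sum>i\<in>I. second_derivative (f i) z \<i> \<i>)"
  proof (rule flat_laplacianI[OF assms(1,2), where fx="\<lambda>w. \<Sum>i\<in>I. second_derivative (f i) z 1 w"
          and fy="\<lambda>w. \<Sum>i\<in>I. second_derivative (f i) z \<i> w"])
    show "((\<lambda>y. \<Sum>i\<in>I. f i y) has_derivative (\<lambda>v. \<Sum>i\<in>I. frechet_derivative (f i) (at y) v)) (at y)"
      if "y \<in> S" for y
      by (rule has_derivative_sum) (rule C2_derivative[OF assms(3,1) that])
  qed (rule has_derivative_sum, rule C2_second_derivative[OF assms(3,1,2)], assumption)+
  then show ?thesis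
    by (simp add: flat_laplacian_def sum.distrib)
qed

text \<open>The Laplacian is conformally covariant: in the second derivatives of \<open>f \<circ> T\<close> the terms with
  \<open>T''\<close> cancel because \<open>T'' \<cdot> 1 \<cdot> 1 + T'' \<cdot> \<i> \<cdot> \<i> = 0\<close>, and multiplication by \<open>T'\<close> is a rotation
  followed by a dilation by \<open>|T'|\<close>.\<close>

lemma flat_laplacian_compose_holomorphic:
  fixes f :: "complex \<Rightarrow> real"
  assumes S: "open S" and V: "open V" and T: "T holomorphic_on S" "T ` S \<subseteq> V"
    and f: "Ck_on 2 f V" and z: "z \<in> S"
  shows "flat_laplacian (\<lambda>y. f (T y)) z = (cmod (deriv T z))\<^sup>2 * flat_laplacian f (T z)"
proof -
  let ?D = "\<lambda>v y. frechet_derivative f (at y) v"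
  let ?H = "second_derivative f (T z)"
  let ?T' = "deriv T" and ?T'' = "deriv (deriv T)"
  have dT: "(T has_derivative (\<lambda>v. ?T' y * v)) (at y)" if "y \<in> S" for y
    using holomorphic_derivI[OF T(1) S that] by (simp add: has_field_derivative_def)
  have dT': "(?T' has_derivative (\<lambda>w. ?T'' z * w)) (at z)"
    using holomorphic_derivI[OF holomorphic_deriv[OF T(1) S] S z] by (simp add: has_field_derivative_def)
  have D1: "((\<lambda>y. f (T y)) has_derivative
      (\<lambda>v. Re (?T' y * v) * ?D 1 (T y) + Im (?T' y * v) * ?D \<i> (T y))) (at y)" if "y \<in> S" for y
  proof -
    have Df: "(f has_derivative (\<lambda>v. ?D v (T y))) (at (T y))"
      using T(2) that by (intro C2_derivative[OF f V]) auto
    have "?D (?T' y * v) (T y) = Re (?T' y * v) * ?D 1 (T y) + Im (?T' y * v) * ?D \<i> (T y)" for v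
      by (subst complex_linear_expand[OF has_derivative_linear[OF Df]]) simp
    with has_derivative_compose[OF dT[OF that] Df] show ?thesis by simp
  qed
  have Tz: "T z \<in> V" using T(2) z by blast
  have D2: "((\<lambda>y. ?D v (T y)) has_derivative
      (\<lambda>w. Re (?T' z * w) * ?H v 1 + Im (?T' z * w) * ?H v \<i>)) (at z)" for v
  proof -
    note H = C2_second_derivative[OF f V Tz, of v]
    have "?H v (?T' z * w) = Re (?T' z * w) * ?H v 1 + Im (?T' z * w) * ?H v \<i>" for w
      by (subst complex_linear_expand[OF has_derivative_linear[OF H]]) simp
    with has_derivative_compose[OF dT[OF z] H] show ?thesis by simp
  qed
  have D3: "((\<lambda>y. Re (?T' y * v) * ?D 1 (T y) + Im (?T' y * v) * ?D \<i> (T y)) has_derivative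
     (\<lambda>w. Re (?T' z * v) * (Re (?T' z * w) * ?H 1 1 + Im (?T' z * w) * ?H 1 \<i>)
        + Re (?T'' z * w * v) * ?D 1 (T z)
        + (Im (?T' z * v) * (Re (?T' z * w) * ?H \<i> 1 + Im (?T' z * w) * ?H \<i> \<i>)
        + Im (?T'' z * w * v) * ?D \<i> (T z)))) (at z)" for v
    by (intro has_derivative_add has_derivative_mult has_derivative_Re has_derivative_Im
        has_derivative_mult_left dT' D2)
  have "flat_laplacian (\<lambda>y. f (T y)) z =
      ((Re (?T' z))\<^sup>2 + (Im (?T' z))\<^sup>2) * (?H 1 1 + ?H \<i> \<i>)"
    by (subst flat_laplacianI[OF S z D1 D3 D3]) (simp_all add: algebra_simps power2_eq_square)
  then show ?thesis
    by (simp only: cmod_power2 flat_laplacian_def[of f])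
qed


section \<open>Differentiation under the integral sign\<close>

text \<open>The mean value inequality bounds the difference quotients by \<open>w\<close>, so they may be integrated to
  the limit by dominated convergence along every sequence tending to \<open>0\<close>.\<close>

lemma has_real_derivative_integral:
  fixes \<phi> :: "real \<Rightarrow> 'b \<Rightarrow> real"
  assumes d: "d > 0"
    and int: "\<And>r. \<bar>r\<bar> < d \<Longrightarrow> integrable M (\<phi> r)"
    and der: "\<And>r x. \<bar>r\<bar> < d \<Longrightarrow> x \<in> space M \<Longrightarrow> ((\<lambda>r. \<phi> r x) has_real_derivative \<phi>' r x) (at r)"
    and bound: "\<And>r x. \<bar>r\<bar> < d \<Longrightarrow> x \<in> space M \<Longrightarrow> \<bar>\<phi>' r x\<bar> \<le> w x"
    and w: "integrable M w"
  shows "integrable M (\<phi>' 0)"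
    and "((\<lambda>r. \<integral>x. \<phi> r x \<partial>M) has_real_derivative (\<integral>x. \<phi>' 0 x \<partial>M)) (at 0)"
proof -
  have quotient: "integrable M (\<phi>' 0) \<and>
      (\<lambda>n. ((\<integral>x. \<phi> (X n) x \<partial>M) - (\<integral>x. \<phi> 0 x \<partial>M)) / X n) \<longlonglongrightarrow> (\<integral>x. \<phi>' 0 x \<partial>M)"
    if X: "X \<longlonglongrightarrow> 0" "\<And>n. X n \<noteq> 0" for X :: "nat \<Rightarrow> real"
  proof -
    define s where "s n x = (if \<bar>X n\<bar> < d then (\<phi> (X n) x - \<phi> 0 x) / X n else 0)" for n x
    have small: "eventually (\<lambda>n. \<bar>X n\<bar> < d) sequentially"
      using tendstoD[OF X(1) d] by (simp add: dist_real_def)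
    have int_s: "integrable M (s n)" for n
      unfolding s_def using int[of "X n"] int[of 0] d by (cases "\<bar>X n\<bar> < d") simp_all
    have lim: "(\<lambda>n. s n x) \<longlonglongrightarrow> \<phi>' 0 x" if "x \<in> space M" for x
    proof -
      have "((\<lambda>r. (\<phi> r x - \<phi> 0 x) / (r - 0)) \<longlongrightarrow> \<phi>' 0 x) (at 0)"
        using der[of 0 x] d that by (simp add: has_field_derivative_iff)
      then have "(\<lambda>n. (\<phi> (X n) x - \<phi> 0 x) / X n) \<longlonglongrightarrow> \<phi>' 0 x"
        using X unfolding tendsto_at_iff_sequentially comp_def by simp
      then show ?thesis
        by (rule Lim_transform_eventually)
          (use small in \<open>auto simp: s_def elim!: eventually_mono\<close>)
    qed
    have meas: "\<phi>' 0 \<in> borel_measurable M"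
      by (rule borel_measurable_LIMSEQ_real[OF lim borel_measurable_integrable[OF int_s]])
    have le: "norm (s n x) \<le> w x" if x: "x \<in> space M" for n x
    proof (cases "\<bar>X n\<bar> < d")
      case True
      have "norm (\<phi> (X n) x - \<phi> 0 x) \<le> w x * norm (X n - 0)"
      proof (rule field_differentiable_bound[where S="cball 0 \<bar>X n\<bar>" and f'="\<lambda>r. \<phi>' r x"])
        fix r :: real assume "r \<in> cball 0 \<bar>X n\<bar>"
        then have r: "\<bar>r\<bar> < d" using True by simp
        show "((\<lambda>r. \<phi> r x) has_real_derivative \<phi>' r x) (at r within cball 0 \<bar>X n\<bar>)"
          using der[OF r x] by (rule has_field_derivative_at_within)
        show "norm (\<phi>' r x) \<le> w x" using bound[OF r x] by simp
      qed auto
      then show ?thesis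
        using True X(2)[of n] by (simp add: s_def divide_le_eq)
    next
      case False
      then show ?thesis using bound[of 0 x] d x by (simp add: s_def order_trans[OF abs_ge_zero])
    qed
    note dom = meas borel_measurable_integrable[OF int_s] w AE_I2[OF lim] AE_I2[OF le]
    have "integrable M (\<phi>' 0)" "(\<lambda>n. \<integral>x. s n x \<partial>M) \<longlonglongrightarrow> (\<integral>x. \<phi>' 0 x \<partial>M)"
      using integrable_dominated_convergence[OF dom] integral_dominated_convergence[OF dom] by blast+
    moreover have "eventually (\<lambda>n. (\<integral>x. s n x \<partial>M) =
        ((\<integral>x. \<phi> (X n) x \<partial>M) - (\<integral>x. \<phi> 0 x \<partial>M)) / X n) sequentially"
      using small by eventually_elim (use d int in \<open>simp add: s_def\<close>)
    ultimately show ?thesis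
      by (blast intro: Lim_transform_eventually)
  qed
  have "(\<lambda>n. inverse (real (Suc n))) \<longlonglongrightarrow> 0" by (rule LIMSEQ_inverse_real_of_nat)
  from quotient[OF this] show "integrable M (\<phi>' 0)" by simp
  show "((\<lambda>r. \<integral>x. \<phi> r x \<partial>M) has_real_derivative (\<integral>x. \<phi>' 0 x \<partial>M)) (at 0)"
    using quotient by (auto simp: has_field_derivative_iff tendsto_at_iff_sequentially comp_def)
qed

lemma integrable_continuous_compact_support:
  fixes f :: "'a::euclidean_space \<Rightarrow> real"
  assumes "continuous_on UNIV f" "\<And>z. z \<notin> cball a R \<Longrightarrow> f z = 0"
  shows "integrable lborel f"
proof -
  have "integrable lborel (\<lambda>z. indicator (cball a R) z *\<^sub>R f z)"
    using borel_integrable_compact[of "cball a R" f] continuous_on_subset[OF assms(1)]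
    by (simp add: scaleR_conv_of_real indicator_def if_distrib cong: if_cong)
  moreover have "(\<lambda>z. indicator (cball a R) z *\<^sub>R f z) = f"
    using assms(2) by (intro ext) (auto simp: indicator_def simp del: mem_cball)
  ultimately show ?thesis by simp
qed

text \<open>Translation invariance of Lebesgue measure replaces Fubini's theorem here: the integral of
  the translates of \<open>f\<close> is constant, and differentiating it gives the integral of a directional
  derivative.\<close>

lemma integral_directional_derivative_eq_0:
  fixes f :: "complex \<Rightarrow> real"
  assumes f: "Ck_on (Suc 0) f UNIV" and supp: "\<And>z. z \<notin> cball a R \<Longrightarrow> f z = 0"
  shows "integrable lborel (\<lambda>z. frechet_derivative f (at z) v)"
    and "(\<integral>z. frechet_derivative f (at z) v \<partial>lborel) = 0"
proof -
  let ?D = "\<lambda>z. frechet_derivative f (at z) v"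
  have contD: "continuous_on UNIV ?D" and contf: "continuous_on UNIV f"
    using f Ck_on_imp_continuous_on[OF f] by auto
  have suppD: "?D z = 0" if "z \<notin> cball a R" for z
  proof -
    have "frechet_derivative f (at z) = frechet_derivative (\<lambda>_. 0) (at z)"
      by (rule frechet_derivative_cong_open[of "- cball a R"]) (use that supp in auto)
    then show ?thesis by simp
  qed
  have "bounded (?D ` cball a R)"
    by (intro compact_imp_bounded compact_continuous_image continuous_on_subset[OF contD]) auto
  then obtain B where B: "\<And>z. z \<in> cball a R \<Longrightarrow> \<bar>?D z\<bar> \<le> B"
    unfolding bounded_iff by fastforce
  define R' where "R' = \<bar>R\<bar> + norm v"
  let ?w = "\<lambda>z. \<bar>B\<bar> * indicator (cball a R') z"
  have shift: "integrable lborel (\<lambda>z. f (z + of_real r * v)) \<and>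
      (\<integral>z. f (z + of_real r * v) \<partial>lborel) = (\<integral>z. f z \<partial>lborel)" for r
  proof -
    have [measurable]: "f \<in> borel_measurable borel"
      using contf by (rule borel_measurable_continuous_onI)
    have intf: "integrable (distr lborel borel ((+) (of_real r * v))) f"
      using integrable_continuous_compact_support[OF contf supp] lborel_distr_plus[of "of_real r * v"] by simp
    have "integrable lborel (\<lambda>z. f (of_real r * v + z))"
      using intf by (subst (asm) integrable_distr_eq) auto
    moreover have "(\<integral>z. f z \<partial>distr lborel borel ((+) (of_real r * v))) = (\<integral>z. f (of_real r * v + z) \<partial>lborel)"
      by (subst integral_distr) auto
    ultimately show ?thesis
      by (simp add: lborel_distr_plus add.commute)
  qed
  have D: "((\<lambda>r. f (z + of_real r * v)) has_real_derivative ?D (z + of_real r * v)) (at r)" for z r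
  proof -
    let ?y = "z + of_real r * v"
    have L: "(f has_derivative frechet_derivative f (at ?y)) (at ?y)"
      using Ck_on_SucD[OF f] by simp
    have "((\<lambda>r. z + of_real r * v) has_derivative (\<lambda>h. of_real h * v)) (at r)"
      by (auto intro!: derivative_eq_intros)
    from has_derivative_compose[OF this L]
    have "((\<lambda>r. f (z + of_real r * v)) has_derivative
        (\<lambda>h. frechet_derivative f (at ?y) (of_real h * v))) (at r)" .
    moreover have "frechet_derivative f (at ?y) (of_real h * v) = ?D ?y * h" for h
      using linear_cmul[OF has_derivative_linear[OF L], of h v] by (simp add: scaleR_conv_of_real)
    ultimately show ?thesis
      by (simp add: has_field_derivative_def)
  qed
  have bound: "\<bar>?D (z + of_real r * v)\<bar> \<le> ?w z" if "\<bar>r\<bar> < 1" for z r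
  proof (cases "z + of_real r * v \<in> cball a R")
    case True
    have "norm (of_real r * v) \<le> 1 * norm v"
      unfolding norm_mult using that by (intro mult_right_mono) auto
    moreover have "dist a z \<le> dist a (z + of_real r * v) + dist (z + of_real r * v) z"
      by (rule dist_triangle)
    ultimately have "z \<in> cball a R'"
      using True by (simp add: R'_def dist_norm)
    with B[OF True] show ?thesis by simp
  qed (simp add: suppD)
  have w: "integrable lborel ?w"
    using emeasure_bounded_finite[OF bounded_cball[of a R']]
    by (intro integrable_mult_right integrable_real_indicator) auto
  note * = has_real_derivative_integral[of 1 lborel "\<lambda>r z. f (z + of_real r * v)"
      "\<lambda>r z. ?D (z + of_real r * v)" ?w, OF _ _ D bound w]
  show "integrable lborel ?D"
    using *(1) shift by simp
  have "((\<lambda>r. \<integral>z. f z \<partial>lborel) has_real_derivative (\<integral>z. ?D z \<partial>lborel)) (at (0::real))"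
    using *(2) shift by simp
  then show "(\<integral>z. ?D z \<partial>lborel) = 0"
    using DERIV_unique[OF _ DERIV_const] by blast
qed

lemma integral_flat_laplacian_eq_0:
  assumes f: "Ck_on 2 f UNIV" and supp: "\<And>z. z \<notin> cball a R \<Longrightarrow> f z = 0"
  shows "integrable lborel (flat_laplacian f)" and "(\<integral>z. flat_laplacian f z \<partial>lborel) = 0"
proof -
  have C1: "Ck_on (Suc 0) (\<lambda>z. frechet_derivative f (at z) v) UNIV" for v
    using f unfolding numeral_2_eq_2 Ck_on.simps(2)[of "Suc 0" f] by blast
  have supp1: "frechet_derivative f (at z) v = 0" if "z \<notin> cball a R" for z v
  proof -
    have "frechet_derivative f (at z) = frechet_derivative (\<lambda>_. 0) (at z)"
      by (rule frechet_derivative_cong_open[of "- cball a R"]) (use that supp in auto)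
    then show ?thesis by simp
  qed
  have *: "integrable lborel (\<lambda>z. second_derivative f z v v)"
    "(\<integral>z. second_derivative f z v v \<partial>lborel) = 0" for v
    unfolding second_derivative_def
    by (rule integral_directional_derivative_eq_0[OF C1 supp1], assumption)+
  show "integrable lborel (flat_laplacian f)" "(\<integral>z. flat_laplacian f z \<partial>lborel) = 0"
    unfolding flat_laplacian_def[abs_def] using *[of 1] *[of \<i>] by simp_all
qed


section \<open>Change of variables for injective holomorphic maps\<close>

definition vec2_of_complex :: "complex \<Rightarrow> real^2" where
  "vec2_of_complex z = vector [Re z, Im z]"

definition complex_of_vec2 :: "real^2 \<Rightarrow> complex" where
  "complex_of_vec2 x = Complex (x$1) (x$2)"

lemma complex_of_vec2_inverse [simp]: "vec2_of_complex (complex_of_vec2 x) = x"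
  by (simp add: vec2_of_complex_def complex_of_vec2_def vec_eq_iff forall_2)

lemma vec2_of_complex_inverse [simp]: "complex_of_vec2 (vec2_of_complex z) = z"
  by (simp add: vec2_of_complex_def complex_of_vec2_def)

lemma linear_vec2_of_complex: "linear vec2_of_complex"
  by (rule linearI) (simp_all add: vec2_of_complex_def vec_eq_iff forall_2)

lemma linear_complex_of_vec2: "linear complex_of_vec2"
  by (rule linearI) (simp_all add: complex_of_vec2_def complex_eq_iff)

lemma borel_measurable_vec2_of_complex [measurable]: "vec2_of_complex \<in> borel \<rightarrow>\<^sub>M borel"
  by (intro borel_measurable_continuous_onI linear_continuous_on linear_vec2_of_complex
      linear_conv_bounded_linear[THEN iffD1])

lemma borel_measurable_complex_of_vec2 [measurable]: "complex_of_vec2 \<in> borel \<rightarrow>\<^sub>M borel"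
  by (intro borel_measurable_continuous_onI linear_continuous_on linear_complex_of_vec2
      linear_conv_bounded_linear[THEN iffD1])

text \<open>Boxes correspond to boxes with the same sides, hence the identification of the complex plane with
  \<open>real^2\<close> preserves Lebesgue measure, and the change of variables theorem for \<open>real^2\<close> carries over
  to holomorphic maps.\<close>

lemma lborel_eq_distr_vec2_of_complex: "lborel = distr lborel borel vec2_of_complex"
proof (rule lborel_eqI)
  fix l u :: "real^2" assume le: "\<And>b. b \<in> Basis \<Longrightarrow> l \<bullet> b \<le> u \<bullet> b"
  have le': "l $ i \<le> u $ i" for i
    using le[of "axis i 1"] by (simp add: inner_axis)
  have "vec2_of_complex -` box l u = box (complex_of_vec2 l) (complex_of_vec2 u)"
    by (auto simp: box_def Basis_complex_def Basis_vec_def inner_axis forall_2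
        vec2_of_complex_def complex_of_vec2_def)
  then have "emeasure (distr lborel borel vec2_of_complex) (box l u) =
      emeasure lborel (box (complex_of_vec2 l) (complex_of_vec2 u))"
    by (simp add: emeasure_distr)
  also have "\<dots> = (\<Prod>b\<in>Basis. (complex_of_vec2 u - complex_of_vec2 l) \<bullet> b)"
    by (rule emeasure_lborel_box) (use le' in \<open>auto simp: Basis_complex_def complex_of_vec2_def\<close>)
  also have "(\<Prod>b\<in>Basis. (complex_of_vec2 u - complex_of_vec2 l) \<bullet> b) = (\<Prod>b\<in>Basis. (u - l) \<bullet> b)"
  proof -
    have Basis: "Basis = {axis 1 1, axis 2 1 :: real^2}"
      by (auto simp: Basis_vec_def exhaust_2 UNIV_2)
    have "axis 1 1 \<noteq> (axis 2 1 :: real^2)"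
      by (simp add: axis_eq_axis)
    then have "(\<Prod>b\<in>{axis 1 1, axis 2 1 :: real^2}. (u - l) \<bullet> b)
        = (u - l) \<bullet> axis 1 1 * ((u - l) \<bullet> axis 2 1)"
      by (simp del: inner_diff_left)
    then have "(\<Prod>b\<in>Basis. (u - l) \<bullet> b) = (u - l) \<bullet> axis 1 1 * ((u - l) \<bullet> axis 2 1)"
      unfolding Basis .
    then show ?thesis
      by (simp add: Basis_complex_def complex_of_vec2_def inner_axis)
  qed
  finally show "emeasure (distr lborel borel vec2_of_complex) (box l u) =
      (\<Prod>b\<in>Basis. (u - l) \<bullet> b)" .
qed simp

lemma image_vec2_of_complex: "vec2_of_complex ` B = complex_of_vec2 -` B"
  by (auto simp: image_iff) (metis complex_of_vec2_inverse)

lemma borel_vec2_of_complex: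
  assumes "B \<in> sets borel"
  shows "vec2_of_complex ` B \<in> sets borel"
  using measurable_sets[OF borel_measurable_complex_of_vec2 assms] by (simp add: image_vec2_of_complex)

lemma nn_integral_vec2_of_complex:
  assumes "f \<in> borel_measurable borel"
  shows "(\<integral>\<^sup>+x. f x \<partial>lborel) = (\<integral>\<^sup>+z. f (vec2_of_complex z) \<partial>lborel)"
  using assms by (subst lborel_eq_distr_vec2_of_complex) (simp add: nn_integral_distr)

lemma emeasure_vec2_of_complex:
  assumes "B \<in> sets borel"
  shows "emeasure lborel (vec2_of_complex ` B) = emeasure lborel B"
proof -
  have "vec2_of_complex -` vec2_of_complex ` B = B"
    by (auto simp: image_vec2_of_complex)
  then show ?thesis
    using borel_vec2_of_complex[OF assms]
    by (subst lborel_eq_distr_vec2_of_complex) (simp add: emeasure_distr)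
qed

lemma borel_preimage_continuous_on:
  fixes g :: "'a::topological_space \<Rightarrow> 'b::topological_space"
  assumes "continuous_on A g" "A \<in> sets borel" "B \<in> sets borel"
  shows "{x \<in> A. g x \<in> B} \<in> sets borel"
proof -
  have "g \<in> restrict_space borel A \<rightarrow>\<^sub>M borel"
    using assms(1) by (rule borel_measurable_continuous_on_restrict)
  from measurable_sets[OF this assms(3)] have "g -` B \<inter> A \<in> sets (restrict_space borel A)"
    by (simp add: space_restrict_space)
  moreover have "g -` B \<inter> A = {x \<in> A. g x \<in> B}" by auto
  ultimately show ?thesis
    using assms(2) by (auto simp: sets_restrict_space)
qed

lemma borel_image_holomorphic:
  assumes S: "open S" and T: "T holomorphic_on S" "inj_on T S" and B: "B \<in> sets borel" "B \<subseteq> S"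
  shows "T ` B \<in> sets borel"
proof -
  obtain h where h: "h holomorphic_on T ` S" "\<And>z. z \<in> S \<Longrightarrow> h (T z) = z"
    using holomorphic_has_inverse[OF T(1) S T(2)] by metis
  have "open (T ` S)"
    by (rule open_mapping_thm3[OF T(1) S T(2)])
  then have "{w \<in> T ` S. h w \<in> B} \<in> sets borel"
    using B(1) by (intro borel_preimage_continuous_on holomorphic_on_imp_continuous_on[OF h(1)]) auto
  moreover have "{w \<in> T ` S. h w \<in> B} = T ` B"
    using h(2) B(2) by auto
  ultimately show ?thesis by simp
qed

text \<open>As a real linear map of the plane, multiplication by \<open>T'\<close> has determinant \<open>|T'|\<^sup>2\<close>. Sets of infinite
  measure are included: the real-valued theorem says that the image has finite measure exactly if
  the Jacobian is integrable.\<close>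

lemma emeasure_holomorphic_image:
  assumes S: "open S" and T: "T holomorphic_on S" "inj_on T S" and B: "B \<in> sets borel" "B \<subseteq> S"
  shows "emeasure lborel (T ` B) = (\<integral>\<^sup>+z\<in>B. ennreal ((cmod (deriv T z))\<^sup>2) \<partial>lborel)"
proof -
  let ?\<phi> = vec2_of_complex and ?\<psi> = complex_of_vec2
  define F where "F = (\<lambda>x. ?\<phi> (T (?\<psi> x)))"
  define F' where "F' x = (\<lambda>v. ?\<phi> (deriv T (?\<psi> x) * ?\<psi> v))" for x
  define J where "J x = \<bar>det (matrix (F' x))\<bar>" for x
  have J: "J x = (cmod (deriv T (?\<psi> x)))\<^sup>2" for x
  proof -
    have "det (matrix (F' x)) = (cmod (deriv T (?\<psi> x)))\<^sup>2"
      unfolding cmod_power2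
      by (simp add: det_2 matrix_def F'_def vec2_of_complex_def complex_of_vec2_def axis_def
          power2_eq_square)
    then show ?thesis by (simp add: J_def)
  qed
  have \<phi>B: "?\<phi> ` B \<in> sets borel" "?\<phi> ` B \<in> sets lebesgue"
    using borel_vec2_of_complex[OF B(1)] by auto
  have TB: "T ` B \<in> sets borel"
    by (rule borel_image_holomorphic[OF S T B])
  have FB: "F ` ?\<phi> ` B = ?\<phi> ` T ` B"
    by (simp add: F_def image_image)
  have bl: "(?\<phi> has_derivative ?\<phi>) (at z)" "(?\<psi> has_derivative ?\<psi>) (at x)" for z x
    using linear_vec2_of_complex linear_complex_of_vec2
    by (simp_all add: linear_conv_bounded_linear bounded_linear_imp_has_derivative)
  have der: "(F has_derivative F' x) (at x within ?\<phi> ` B)" if x: "x \<in> ?\<phi> ` B" for x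
  proof -
    have "?\<psi> x \<in> S" using x B(2) by (auto simp: image_vec2_of_complex)
    then have "(T has_derivative (\<lambda>v. deriv T (?\<psi> x) * v)) (at (?\<psi> x))"
      using holomorphic_derivI[OF T(1) S] by (simp add: has_field_derivative_def)
    from has_derivative_compose[OF has_derivative_compose[OF bl(2) this] bl(1)]
    have "(F has_derivative F' x) (at x)"
      unfolding F_def F'_def .
    then show ?thesis by (rule has_derivative_at_withinI)
  qed
  have inj: "inj_on F (?\<phi> ` B)"
    using inj_on_subset[OF T(2) B(2)]
    unfolding inj_on_def F_def by (metis vec2_of_complex_inverse imageE)
  note CV = has_measure_differentiable_image[OF \<phi>B(2) der inj, folded J_def]
  have Jmeas: "(\<lambda>x. J x * indicator (?\<phi> ` B) x) \<in> borel_measurable borel"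
  proof -
    have "continuous_on S (\<lambda>z. (cmod (deriv T z))\<^sup>2)"
      by (intro continuous_intros holomorphic_on_imp_continuous_on holomorphic_deriv T S)
    then have "(\<lambda>z. (cmod (deriv T z))\<^sup>2) \<in> borel_measurable (restrict_space borel S)"
      by (rule borel_measurable_continuous_on_restrict)
    then have "(\<lambda>z. (cmod (deriv T z))\<^sup>2 * indicator S z) \<in> borel_measurable borel"
      using S by (subst (asm) borel_measurable_restrict_space_iff) (auto simp: mult.commute)
    then have "(\<lambda>z. (cmod (deriv T z))\<^sup>2 * indicator S z * indicator B z) \<in> borel_measurable borel"
      using B(1) by measurable
    then have "(\<lambda>x. (cmod (deriv T (?\<psi> x)))\<^sup>2 * indicator S (?\<psi> x) * indicator B (?\<psi> x)) \<in> borel_measurable borel"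
      by measurable
    also have "(\<lambda>x. (cmod (deriv T (?\<psi> x)))\<^sup>2 * indicator S (?\<psi> x) * indicator B (?\<psi> x))
        = (\<lambda>x. J x * indicator (?\<phi> ` B) x)"
      using B(2) by (intro ext) (auto simp: J image_vec2_of_complex indicator_def)
    finally show ?thesis .
  qed
  define I where "I = (\<integral>\<^sup>+x. ennreal (J x * indicator (?\<phi> ` B) x) \<partial>lborel)"
  have Jnn: "0 \<le> J x * indicator (?\<phi> ` B) x" for x
    by (simp add: J_def)
  have has_int: "(J has_integral m) (?\<phi> ` B) \<longleftrightarrow> I = ennreal m \<and> 0 \<le> m" for m
  proof -
    have "(J has_integral m) (?\<phi> ` B) \<longleftrightarrow> ((\<lambda>x. J x * indicator (?\<phi> ` B) x) has_integral m) UNIV"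
    proof -
      have "(\<lambda>x. J x * indicator (?\<phi> ` B) x) = (\<lambda>x. if x \<in> ?\<phi> ` B then J x else 0)"
        by (intro ext) (simp add: indicator_def)
      then show ?thesis by (simp only: has_integral_restrict_UNIV)
    qed
    also have "\<dots> \<longleftrightarrow> I = ennreal m \<and> 0 \<le> m"
      using Jmeas unfolding has_integral_iff_nn_integral_lebesgue[OF Jnn] I_def
      by (simp add: nn_integral_completion measurable_completion)
    finally show ?thesis .
  qed
  have "emeasure lborel (?\<phi> ` T ` B) = I"
  proof (cases "?\<phi> ` T ` B \<in> lmeasurable")
    case True
    then have "I = ennreal (measure lebesgue (?\<phi> ` T ` B))"
      using CV[of "measure lebesgue (?\<phi> ` T ` B)"] by (simp add: FB has_int)
    also have "\<dots> = emeasure lebesgue (?\<phi> ` T ` B)"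
      using True by (simp add: emeasure_eq_measure2)
    finally show ?thesis
      using borel_vec2_of_complex[OF TB] by simp
  next
    case False
    then have "emeasure lborel (?\<phi> ` T ` B) = \<infinity>"
      using borel_vec2_of_complex[OF TB] by (simp add: fmeasurable_def less_top[symmetric])
    moreover have "I = \<infinity>"
    proof (rule ccontr)
      assume "I \<noteq> \<infinity>"
      then have "I = ennreal (enn2real I) \<and> 0 \<le> enn2real I"
        by (simp add: less_top)
      with has_int CV False show False by (metis FB)
    qed
    ultimately show ?thesis by simp
  qed
  also have "I = (\<integral>\<^sup>+z. ennreal (J (?\<phi> z) * indicator (?\<phi> ` B) (?\<phi> z)) \<partial>lborel)"
    unfolding I_def by (rule nn_integral_vec2_of_complex[OF measurable_compose[OF Jmeas measurable_ennreal]])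
  also have "\<dots> = (\<integral>\<^sup>+z\<in>B. ennreal ((cmod (deriv T z))\<^sup>2) \<partial>lborel)"
    by (intro nn_integral_cong) (auto simp: J image_vec2_of_complex indicator_def)
  finally show ?thesis
    using emeasure_vec2_of_complex[OF TB] by simp
qed

text \<open>By the formula for the measure of images, Lebesgue measure on \<open>T ` S\<close> is the image of the measure
  with density \<open>|T'|\<^sup>2\<close> on \<open>S\<close>. Everything is restricted to \<open>S\<close> and \<open>T ` S\<close>, because chart
  expressions are meaningful, and continuous, only there.\<close>

lemma nn_integral_holomorphic_substitution:
  assumes S: "open S" and T: "T holomorphic_on S" "inj_on T S" and B: "B \<in> sets borel" "B \<subseteq> S"
    and f: "continuous_on (T ` S) f"
  shows "(\<integral>\<^sup>+w\<in>T ` B. ennreal (f w) \<partial>lborel) =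
         (\<integral>\<^sup>+z\<in>B. ennreal (f (T z)) * ennreal ((cmod (deriv T z))\<^sup>2) \<partial>lborel)"
proof -
  let ?L = "restrict_space lborel S" and ?R = "restrict_space lborel (T ` S)"
  let ?j = "\<lambda>z. ennreal ((cmod (deriv T z))\<^sup>2)"
  have TS: "open (T ` S)"
    by (rule open_mapping_thm3[OF T(1) S T(2)])
  have TB: "T ` B \<in> sets borel"
    by (rule borel_image_holomorphic[OF S T B])
  have rb: "restrict_space lborel A \<rightarrow>\<^sub>M N = restrict_space borel A \<rightarrow>\<^sub>M N" for A :: "complex set" and N :: "'x measure"
    by (intro measurable_cong_sets sets_restrict_space_cong) auto
  have j: "?j \<in> borel_measurable ?L"
  proof -
    have "continuous_on S (\<lambda>z. (cmod (deriv T z))\<^sup>2)"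
      by (intro continuous_intros holomorphic_on_imp_continuous_on holomorphic_deriv T S)
    then have "(\<lambda>z. (cmod (deriv T z))\<^sup>2) \<in> borel_measurable ?L"
      unfolding rb by (rule borel_measurable_continuous_on_restrict)
    then show ?thesis by measurable
  qed
  have fm: "(\<lambda>w. ennreal (f w) * indicator (T ` B) w) \<in> borel_measurable ?R"
  proof -
    have "f \<in> borel_measurable ?R"
      unfolding rb using f by (rule borel_measurable_continuous_on_restrict)
    moreover have "indicator (T ` B) \<in> borel_measurable ?R"
      using TB unfolding rb by (intro measurable_restrict_space1) simp
    ultimately show ?thesis by measurable
  qed
  have Tm: "T \<in> ?L \<rightarrow>\<^sub>M ?R"
  proof (rule measurable_restrict_space2)
    show "T \<in> ?L \<rightarrow>\<^sub>M lborel"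
      using borel_measurable_continuous_on_restrict[OF holomorphic_on_imp_continuous_on[OF T(1)]]
      by (simp add: rb)
  qed (auto simp: space_restrict_space)
  have eq: "?R = distr (density ?L ?j) ?R T"
  proof (rule measure_eqI)
    fix A assume A: "A \<in> sets ?R"
    then have A': "A \<subseteq> T ` S" "A \<in> sets borel"
      using TS by (auto simp: sets_restrict_space)
    have pre: "T -` A \<inter> S \<in> sets borel"
      using borel_preimage_continuous_on[OF holomorphic_on_imp_continuous_on[OF T(1)] _ A'(2)] S
      by (simp add: vimage_def Int_def conj_commute)
    have im: "T ` (T -` A \<inter> S) = A"
      using A'(1) by auto
    have preL: "T -` A \<inter> S \<in> sets ?L"
      using measurable_sets[OF Tm A] S by (simp add: space_restrict_space)
    have "emeasure (distr (density ?L ?j) ?R T) A = emeasure (density ?L ?j) (T -` A \<inter> S)"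
      using Tm A S by (subst emeasure_distr) (simp_all add: space_restrict_space)
    also have "\<dots> = (\<integral>\<^sup>+z. ?j z * indicator (T -` A \<inter> S) z \<partial>?L)"
      using j preL by (rule emeasure_density)
    also have "\<dots> = (\<integral>\<^sup>+z\<in>(T -` A \<inter> S). ?j z \<partial>lborel)"
      using S by (subst nn_integral_restrict_space) (auto intro!: nn_integral_cong simp: indicator_def)
    also have "\<dots> = emeasure lborel (T ` (T -` A \<inter> S))"
      by (rule emeasure_holomorphic_image[OF S T pre, symmetric]) auto
    also have "\<dots> = emeasure ?R A"
      unfolding im using A' TS by (simp add: emeasure_restrict_space)
    finally show "emeasure ?R A = emeasure (distr (density ?L ?j) ?R T) A" by simp
  qed simp
  have "(\<integral>\<^sup>+w\<in>T ` B. ennreal (f w) \<partial>lborel) = (\<integral>\<^sup>+w. ennreal (f w) * indicator (T ` B) w \<partial>?R)"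
  proof -
    have "T z \<in> T ` S" if "z \<in> B" for z using that B(2) by blast
    then show ?thesis
      using TS by (subst nn_integral_restrict_space) (auto intro!: nn_integral_cong simp: indicator_def)
  qed
  also have "\<dots> = (\<integral>\<^sup>+w. ennreal (f w) * indicator (T ` B) w \<partial>distr (density ?L ?j) ?R T)"
    using eq by simp
  also have "\<dots> = (\<integral>\<^sup>+z. ennreal (f (T z)) * indicator (T ` B) (T z) \<partial>density ?L ?j)"
    using Tm fm by (subst nn_integral_distr) auto
  also have "\<dots> = (\<integral>\<^sup>+z. ?j z * (ennreal (f (T z)) * indicator (T ` B) (T z)) \<partial>?L)"
    using j measurable_compose[OF Tm fm] by (subst nn_integral_density) auto
  also have "\<dots> = (\<integral>\<^sup>+z\<in>B. ennreal (f (T z)) * ?j z \<partial>lborel)"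
  proof (subst nn_integral_restrict_space, use S in simp, rule nn_integral_cong)
    fix z
    show "?j z * (ennreal (f (T z)) * indicator (T ` B) (T z)) * indicator S z =
        ennreal (f (T z)) * ?j z * indicator B z"
    proof (cases "z \<in> S")
      case True
      then have "T z \<in> T ` B \<longleftrightarrow> z \<in> B"
        using T(2) B(2) by (simp add: inj_on_image_mem_iff)
      then show ?thesis using True by (simp add: indicator_def mult.commute)
    qed (use B(2) in \<open>auto simp: indicator_def\<close>)
  qed
  finally show ?thesis .
qed


section \<open>Charts of a compact Riemann surface\<close>

locale riemann_surface =
  fixes X :: "'a topology" and \<sigma> :: "'a chart set"
  assumes compact: "compact_space X" and Hausdorff: "Hausdorff_space X"
    and atlas: "maximal_atlas X holomorphic_compatible \<sigma>"
begin

lemma is_chart: "c \<in> \<sigma> \<Longrightarrow> is_chart X c"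
  and topspace_eq: "(\<Union>c\<in>\<sigma>. fst c) = topspace X"
  and compatible: "c \<in> \<sigma> \<Longrightarrow> d \<in> \<sigma> \<Longrightarrow> holomorphic_compatible c d"
proof -
  note a = atlas[unfolded maximal_atlas_def]
  show "c \<in> \<sigma> \<Longrightarrow> is_chart X c"
    by (rule bspec[OF conjunct1[OF a]])
  show "(\<Union>c\<in>\<sigma>. fst c) = topspace X"
    by (rule conjunct1[OF conjunct2[OF a]])
  show "c \<in> \<sigma> \<Longrightarrow> d \<in> \<sigma> \<Longrightarrow> holomorphic_compatible c d"
    by (rule bspec[OF bspec[OF conjunct1[OF conjunct2[OF conjunct2[OF a]]]]])
qed

lemma chart:
  assumes "c \<in> \<sigma>"
  shows open_chart_domain: "openin X (fst c)"
    and open_chart_range: "open (chart_range c)"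
    and chart_domain_subset: "fst c \<subseteq> topspace X"
    and homeo_chart: "homeomorphic_map (subtopology X (fst c)) (top_of_set (chart_range c)) (snd c)"
  using is_chart[OF assms] openin_subset[of X "fst c"] unfolding is_chart_def by simp_all

lemma charts_cover: "p \<in> topspace X \<Longrightarrow> \<exists>c\<in>\<sigma>. p \<in> fst c"
  using topspace_eq by blast

lemma chart_at: "p \<in> topspace X \<Longrightarrow> chart_at \<sigma> p \<in> \<sigma>" "p \<in> topspace X \<Longrightarrow> p \<in> fst (chart_at \<sigma> p)"
  using someI_ex[of "\<lambda>c. c \<in> \<sigma> \<and> p \<in> fst c"] charts_cover unfolding chart_at_def by blast+

lemma inj_on_chart:
  assumes "c \<in> \<sigma>" shows "inj_on (snd c) (fst c)"
  using homeomorphic_imp_injective_map[OF homeo_chart[OF assms]] chart_domain_subset[OF assms]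
  by (simp add: Int_absorb1 Int_commute)

lemma chart_inv [simp]: "c \<in> \<sigma> \<Longrightarrow> p \<in> fst c \<Longrightarrow> chart_inv c (snd c p) = p"
  unfolding chart_inv_def by (simp add: inv_into_f_f inj_on_chart)

lemma chart_inv_in [simp]: "z \<in> chart_range c \<Longrightarrow> chart_inv c z \<in> fst c"
  unfolding chart_inv_def by (rule inv_into_into)

lemma chart_chart_inv [simp]: "z \<in> chart_range c \<Longrightarrow> snd c (chart_inv c z) = z"
  unfolding chart_inv_def by (rule f_inv_into_f)

lemma chart_inv_in_space: "c \<in> \<sigma> \<Longrightarrow> z \<in> chart_range c \<Longrightarrow> chart_inv c z \<in> topspace X"
  by (rule subsetD[OF chart_domain_subset chart_inv_in])

lemma chart_image_eq: "c \<in> \<sigma> \<Longrightarrow> snd c ` (W \<inter> fst c) = {z \<in> chart_range c. chart_inv c z \<in> W}"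
  by (auto simp: image_iff)

lemma open_chart_image:
  assumes c: "c \<in> \<sigma>" and W: "openin X W"
  shows "open {z \<in> chart_range c. chart_inv c z \<in> W}"
proof -
  have "openin (subtopology X (fst c)) (W \<inter> fst c)"
    using W by (auto simp: openin_subtopology)
  then have "openin (top_of_set (chart_range c)) (snd c ` (W \<inter> fst c))"
    using homeomorphic_map_openness[OF homeo_chart[OF c] openin_subset] by blast
  then show ?thesis
    using open_chart_range[OF c] by (simp add: chart_image_eq[OF c] openin_open_eq)
qed

lemma openin_chart_inv_image:
  assumes c: "c \<in> \<sigma>" and V: "open V" "V \<subseteq> chart_range c"
  shows "openin X (chart_inv c ` V)"
proof -
  have eq: "snd c ` (chart_inv c ` V) = V"
    unfolding image_image by (rule image_cong[OF refl, THEN trans, OF chart_chart_inv[OF subsetD[OF V(2)]]]) simp_all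
  have sub: "chart_inv c ` V \<subseteq> topspace (subtopology X (fst c))"
    using chart_inv_in_space[OF c subsetD[OF V(2)]] chart_inv_in[OF subsetD[OF V(2)]] by auto
  have "openin (top_of_set (chart_range c)) (snd c ` (chart_inv c ` V))"
    unfolding eq using V by (simp add: openin_open_eq open_chart_range[OF c])
  then have "openin (subtopology X (fst c)) (chart_inv c ` V)"
    using homeomorphic_map_openness[OF homeo_chart[OF c] sub] by simp
  then show ?thesis
    by (rule openin_trans_full[OF _ open_chart_domain[OF c]])
qed

text \<open>A function supported in a coordinate disc can be extended by \<open>0\<close> to the whole surface because the
  complement of the disc is open.\<close>

lemma closedin_chart_inv_image:
  assumes c: "c \<in> \<sigma>" and K: "compact K" "K \<subseteq> chart_range c"
  shows "closedin X (chart_inv c ` K)"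
proof (rule compactin_imp_closedin[OF Hausdorff])
  have "compactin X (chart_inv c ` K)"
    unfolding compactin_def
  proof (intro conjI allI impI)
    show "chart_inv c ` K \<subseteq> topspace X"
      using chart_inv_in_space[OF c subsetD[OF K(2)]] by blast
    fix \<U> assume \<U>: "Ball \<U> (openin X) \<and> chart_inv c ` K \<subseteq> \<Union>\<U>"
    have cov: "K \<subseteq> (\<Union>W\<in>\<U>. {z \<in> chart_range c. chart_inv c z \<in> W})"
    proof
      fix z assume z: "z \<in> K"
      then have "chart_inv c z \<in> \<Union>\<U>" using \<U> by blast
      then show "z \<in> (\<Union>W\<in>\<U>. {z \<in> chart_range c. chart_inv c z \<in> W})"
        using subsetD[OF K(2) z] by blast
    qed
    obtain \<V> where "\<V> \<subseteq> \<U>" "finite \<V>" "K \<subseteq> (\<Union>W\<in>\<V>. {z \<in> chart_range c. chart_inv c z \<in> W})"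
      by (rule compactE_image[OF K(1), of \<U> "\<lambda>W. {z \<in> chart_range c. chart_inv c z \<in> W}"])
        (use \<U> open_chart_image[OF c] cov in blast)+
    then show "\<exists>\<F>. finite \<F> \<and> \<F> \<subseteq> \<U> \<and> chart_inv c ` K \<subseteq> \<Union>\<F>"
      by (intro exI[of _ \<V>]) auto
  qed
  then show "compactin X (chart_inv c ` K)" .
qed

lemma overlap_eq: "c \<in> \<sigma> \<Longrightarrow> overlap c d = {z \<in> chart_range c. chart_inv c z \<in> fst d}"
  unfolding overlap_def using chart_image_eq[of c "fst d"] by (simp add: Int_commute)

lemma transition:
  assumes c: "c \<in> \<sigma>" and d: "d \<in> \<sigma>"
  shows open_overlap: "open (overlap c d)"
    and holomorphic_transition: "transition c d holomorphic_on overlap c d"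
    and inj_transition: "inj_on (transition c d) (overlap c d)"
    and transition_image: "transition c d ` overlap c d \<subseteq> chart_range d"
    and chart_inv_transition: "\<And>z. z \<in> overlap c d \<Longrightarrow> chart_inv d (transition c d z) = chart_inv c z"
proof -
  show "open (overlap c d)"
    unfolding overlap_eq[OF c] by (rule open_chart_image[OF c open_chart_domain[OF d]])
  show "transition c d holomorphic_on overlap c d"
    using compatible[OF c d] unfolding holomorphic_compatible_def .
  show inv: "chart_inv d (transition c d z) = chart_inv c z" if "z \<in> overlap c d" for z
    using that d by (simp add: overlap_eq[OF c] transition_def)
  show "inj_on (transition c d) (overlap c d)"
  proof (rule inj_onI)
    fix z w assume *: "z \<in> overlap c d" "w \<in> overlap c d" "transition c d z = transition c d w"
    then have "chart_inv c z = chart_inv c w"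
      using inv[OF *(1)] inv[OF *(2)] by simp
    then have "snd c (chart_inv c z) = snd c (chart_inv c w)"
      by simp
    then show "z = w"
      using *(1,2) by (simp add: overlap_eq[OF c])
  qed
  show "transition c d ` overlap c d \<subseteq> chart_range d"
    by (auto simp: overlap_eq[OF c] transition_def)
qed

lemma deriv_transition_nonzero:
  assumes "c \<in> \<sigma>" "d \<in> \<sigma>" "z \<in> overlap c d"
  shows "deriv (transition c d) z \<noteq> 0"
  by (rule holomorphic_injective_imp_regular[OF holomorphic_transition open_overlap inj_transition])
    (rule assms)+

definition chart_continuous :: "('a \<Rightarrow> 'b::topological_space) \<Rightarrow> bool" where
  "chart_continuous F \<longleftrightarrow> (\<forall>c\<in>\<sigma>. continuous_on (chart_range c) (\<lambda>z. F (chart_inv c z)))"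

lemma openin_chart_continuous:
  assumes F: "chart_continuous F" and W: "open W"
  shows "openin X {p \<in> topspace X. F p \<in> W}"
proof -
  have eq: "{p \<in> topspace X. F p \<in> W} = (\<Union>c\<in>\<sigma>. chart_inv c ` {z \<in> chart_range c. F (chart_inv c z) \<in> W})"
    (is "?L = ?R")
  proof
    show "?L \<subseteq> ?R"
    proof
      fix p assume p: "p \<in> ?L"
      then obtain c where c: "c \<in> \<sigma>" "p \<in> fst c" using charts_cover by blast
      have "p \<in> chart_inv c ` {z \<in> chart_range c. F (chart_inv c z) \<in> W}"
        by (rule image_eqI[of _ _ "snd c p"]) (use c p in simp_all)
      with c(1) show "p \<in> ?R" by blast
    qed
    show "?R \<subseteq> ?L" using chart_inv_in_space by auto
  qed
  have "openin X (chart_inv c ` {z \<in> chart_range c. F (chart_inv c z) \<in> W})" if c: "c \<in> \<sigma>" for c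
  proof (rule openin_chart_inv_image[OF c])
    show "open {z \<in> chart_range c. F (chart_inv c z) \<in> W}"
      using continuous_open_preimage[OF F[unfolded chart_continuous_def, rule_format, OF c]
          open_chart_range[OF c] W]
      by (simp add: vimage_def Int_def)
  qed auto
  then show ?thesis
    unfolding eq by (intro openin_Union) blast
qed

text \<open>The chart chosen by \<open>chart_at\<close> need not vary continuously with the point. Independence of the chart
  lets a fixed chart replace it on the domain of that chart.\<close>

lemma chart_continuous_chart_at:
  assumes "\<And>c. c \<in> \<sigma> \<Longrightarrow> continuous_on (chart_range c) (\<lambda>z. q c (chart_inv c z))"
    and "\<And>c d p. c \<in> \<sigma> \<Longrightarrow> d \<in> \<sigma> \<Longrightarrow> p \<in> fst c \<Longrightarrow> p \<in> fst d \<Longrightarrow> q c p = q d p"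
  shows "chart_continuous (\<lambda>p. q (chart_at \<sigma> p) p)"
  unfolding chart_continuous_def
proof
  fix c assume c: "c \<in> \<sigma>"
  have "q (chart_at \<sigma> (chart_inv c z)) (chart_inv c z) = q c (chart_inv c z)" if "z \<in> chart_range c" for z
    using chart_inv_in_space[OF c that] chart_at chart_inv_in[OF that] c by (intro assms(2)) auto
  then show "continuous_on (chart_range c) (\<lambda>z. q (chart_at \<sigma> (chart_inv c z)) (chart_inv c z))"
    using assms(1)[OF c] by (simp cong: continuous_on_cong)
qed

text \<open>The closed discs lie in the ranges of their charts, so continuous functions are bounded on them and
  bump functions supported in them extend to the surface. The open discs already cover, so the sum of
  these bump functions is positive.\<close>

definition disc_cover :: "('a chart \<times> complex \<times> real) set \<Rightarrow> bool" where
  "disc_cover I \<longleftrightarrow> finite I \<and>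
     (\<forall>(c, a, r)\<in>I. c \<in> \<sigma> \<and> 0 < r \<and> cball a r \<subseteq> chart_range c) \<and>
     (\<forall>p\<in>topspace X. \<exists>(c, a, r)\<in>I. p \<in> fst c \<and> snd c p \<in> ball a r)"

lemma disc_cover_exists: "\<exists>I. disc_cover I"
proof -
  define \<D> where "\<D> = {(c, a, r). c \<in> \<sigma> \<and> 0 < r \<and> cball a r \<subseteq> chart_range c}"
  define disc where "disc = (\<lambda>(c::'a chart, a::complex, r). chart_inv c ` ball a r)"
  have openin_disc: "openin X (disc i)" if "i \<in> \<D>" for i
    using that ball_subset_cball unfolding \<D>_def disc_def
    by (auto intro!: openin_chart_inv_image)
  have cover: "topspace X \<subseteq> \<Union>(disc ` \<D>)"
  proof
    fix p assume p: "p \<in> topspace X"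
    obtain c where c: "c \<in> \<sigma>" "p \<in> fst c" using charts_cover[OF p] by blast
    then obtain r where "r > 0" "cball (snd c p) r \<subseteq> chart_range c"
      using open_contains_cball[THEN iffD1, OF open_chart_range[OF c(1)]] by blast
    then have "(c, snd c p, r) \<in> \<D>" "p \<in> disc (c, snd c p, r)"
      using c image_eqI[of p "chart_inv c" "snd c p"] by (auto simp: \<D>_def disc_def)
    then show "p \<in> \<Union>(disc ` \<D>)" by blast
  qed
  have "compactin X (topspace X)"
    using compact by (simp add: compact_space_def)
  then obtain \<F> where \<F>: "finite \<F>" "\<F> \<subseteq> disc ` \<D>" "topspace X \<subseteq> \<Union>\<F>"
    using cover openin_disc unfolding compactin_def by (elim conjE allE[of _ "disc ` \<D>"]) auto
  then obtain I where I: "finite I" "I \<subseteq> \<D>" "\<F> = disc ` I"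
    using finite_subset_image[of \<F> disc \<D>] by blast
  have "\<exists>(c, a, r)\<in>I. p \<in> fst c \<and> snd c p \<in> ball a r" if p: "p \<in> topspace X" for p
  proof -
    obtain c a r where i: "(c, a, r) \<in> I" "p \<in> disc (c, a, r)"
      using p \<F>(3) I(3) by auto
    then obtain z where z: "z \<in> ball a r" "p = chart_inv c z"
      by (auto simp: disc_def)
    have "z \<in> chart_range c"
      using i(1) I(2) z(1) ball_subset_cball[of a r] unfolding \<D>_def by blast
    then have "p \<in> fst c \<and> snd c p \<in> ball a r"
      using z by simp
    with i(1) show ?thesis by blast
  qed
  then have "disc_cover I"
    using I(1,2) unfolding disc_cover_def \<D>_def by blast
  then show ?thesis by blast
qed

lemma disc_coverD:
  assumes "disc_cover I" "(c, a, r) \<in> I"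
  shows "c \<in> \<sigma>" "0 < r" "cball a r \<subseteq> chart_range c"
  using assms unfolding disc_cover_def by auto

lemma disc_coverE:
  assumes "disc_cover I" "p \<in> topspace X"
  obtains c a r where "(c, a, r) \<in> I" "p \<in> fst c" "snd c p \<in> ball a r"
  using assms unfolding disc_cover_def by auto

text \<open>Only finitely many compact sets \<open>K \<times> cball a r\<close> are involved, one for each disc of a cover.\<close>

lemma compact_parameter_bound:
  fixes F :: "'k::topological_space \<Rightarrow> 'a \<Rightarrow> 'b::real_normed_vector"
  assumes K: "compact K"
    and F: "\<And>c. c \<in> \<sigma> \<Longrightarrow> continuous_on (K \<times> chart_range c) (\<lambda>(k, z). F k (chart_inv c z))"
  shows "\<exists>B. \<forall>k\<in>K. \<forall>p\<in>topspace X. norm (F k p) \<le> B"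
proof -
  obtain I where I: "disc_cover I" using disc_cover_exists ..
  have "\<exists>B. \<forall>k\<in>K. \<forall>z\<in>cball a r. norm (F k (chart_inv c z)) \<le> B" if "(c, a, r) \<in> I" for c a r
  proof -
    note c = disc_coverD(1,3)[OF I that]
    have "continuous_on (K \<times> cball a r) (\<lambda>(k, z). F k (chart_inv c z))"
      by (rule continuous_on_subset[OF F[OF c(1)]]) (use c(2) in auto)
    then have "bounded ((\<lambda>(k, z). F k (chart_inv c z)) ` (K \<times> cball a r))"
      by (intro compact_imp_bounded compact_continuous_image compact_Times K compact_cball)
    then show ?thesis
      unfolding bounded_iff by fastforce
  qed
  then have "\<forall>i\<in>I. \<exists>B. case i of (c, a, r) \<Rightarrow> \<forall>k\<in>K. \<forall>z\<in>cball a r. norm (F k (chart_inv c z)) \<le> B"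
    by auto
  then obtain B' where B': "\<forall>i\<in>I. case i of (c, a, r) \<Rightarrow> \<forall>k\<in>K. \<forall>z\<in>cball a r. norm (F k (chart_inv c z)) \<le> B' i"
    using bchoice[of I "\<lambda>i B. case i of (c, a, r) \<Rightarrow> \<forall>k\<in>K. \<forall>z\<in>cball a r. norm (F k (chart_inv c z)) \<le> B"] by blast
  define B where "B c a r = B' (c, a, r)" for c a r
  have B: "norm (F k (chart_inv c z)) \<le> B c a r" if "(c, a, r) \<in> I" "k \<in> K" "z \<in> cball a r" for c a r k z
    using bspec[OF B' that(1)] that(2,3) by (simp add: B_def)
  let ?B = "\<Sum>(c, a, r)\<in>I. \<bar>B c a r\<bar>"
  have "norm (F k p) \<le> ?B" if k: "k \<in> K" and p: "p \<in> topspace X" for k p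
  proof -
    obtain c a r where i: "(c, a, r) \<in> I" "p \<in> fst c" "snd c p \<in> ball a r"
      using I p by (rule disc_coverE)
    have c: "c \<in> \<sigma>" by (rule disc_coverD(1)[OF I i(1)])
    have "norm (F k p) \<le> B c a r"
      using B[OF i(1) k, of "snd c p"] i c by simp
    also have "\<dots> \<le> \<bar>B c a r\<bar>" by simp
    also have "\<dots> \<le> ?B"
      using member_le_sum[OF i(1), of "\<lambda>(c, a, r). \<bar>B c a r\<bar>"] I unfolding disc_cover_def by auto
    finally show ?thesis .
  qed
  then show ?thesis by blast
qed

lemma chart_continuous_bound:
  fixes F :: "'a \<Rightarrow> 'b::real_normed_vector"
  assumes "chart_continuous F"
  shows "\<exists>B. \<forall>p\<in>topspace X. norm (F p) \<le> B"
proof -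
  have "continuous_on ({0::real} \<times> chart_range c) (\<lambda>(k, z). F (chart_inv c z))" if "c \<in> \<sigma>" for c
    unfolding case_prod_unfold
    by (rule continuous_on_compose2[OF assms[unfolded chart_continuous_def, rule_format, OF that]])
      (auto intro: continuous_intros)
  from compact_parameter_bound[of "{0::real}" "\<lambda>_. F", OF _ this] show ?thesis by simp
qed


subsection \<open>The Borel sets of the surface\<close>

definition borelX :: "'a measure" where
  "borelX = sigma (topspace X) {W. openin X W}"

lemma openin_subset_Pow: "{W. openin X W} \<subseteq> Pow (topspace X)"
  using openin_subset by auto

lemma space_borelX [simp]: "space borelX = topspace X"
  and sets_borelX: "sets borelX = sigma_sets (topspace X) {W. openin X W}"
  unfolding borelX_def using openin_subset_Pow by (simp_all add: space_measure_of sets_measure_of)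

lemma openin_borelX: "openin X W \<Longrightarrow> W \<in> sets borelX"
  by (simp add: sets_borelX sigma_sets.Basic)

lemma chart_domain_borelX: "c \<in> \<sigma> \<Longrightarrow> fst c \<in> sets borelX"
  by (simp add: openin_borelX open_chart_domain)

lemma borel_measurable_chart_continuous:
  "chart_continuous F \<Longrightarrow> F \<in> borel_measurable borelX"
proof (rule borel_measurableI)
  fix W :: "'b set" assume "chart_continuous F" "open W"
  from openin_borelX[OF openin_chart_continuous[OF this]]
  have "{p \<in> topspace X. F p \<in> W} \<in> sets borelX" .
  moreover have "F -` W \<inter> space borelX = {p \<in> topspace X. F p \<in> W}" by auto
  ultimately show "F -` W \<inter> space borelX \<in> sets borelX" by simp
qed

lemma measurable_chart_inv:
  assumes c: "c \<in> \<sigma>"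
  shows "chart_inv c \<in> restrict_space lborel (chart_range c) \<rightarrow>\<^sub>M borelX"
  unfolding borelX_def
proof (rule measurable_measure_of[OF openin_subset_Pow])
  show "chart_inv c \<in> space (restrict_space lborel (chart_range c)) \<rightarrow> topspace X"
    using chart_inv_in_space[OF c] by (auto simp: space_restrict_space)
  fix W assume "W \<in> {W. openin X W}"
  then have "open {z \<in> chart_range c. chart_inv c z \<in> W}"
    using open_chart_image[OF c] by simp
  then show "chart_inv c -` W \<inter> space (restrict_space lborel (chart_range c))
      \<in> sets (restrict_space lborel (chart_range c))"
    by (auto simp: sets_restrict_space space_restrict_space image_iff intro!: bexI[of _ "{z \<in> chart_range c. chart_inv c z \<in> W}"])
qed

lemma borel_chart_image:
  assumes c: "c \<in> \<sigma>" and B: "B \<in> sets borelX" "B \<subseteq> fst c"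
  shows "snd c ` B \<in> sets borel"
proof -
  have "chart_inv c -` B \<inter> chart_range c \<in> sets (restrict_space lborel (chart_range c))"
    using measurable_sets[OF measurable_chart_inv[OF c] B(1)] by (simp add: space_restrict_space)
  moreover have "chart_inv c -` B \<inter> chart_range c = snd c ` B"
    using chart_image_eq[OF c, of B] B(2) by (auto simp: Int_absorb2)
  ultimately show ?thesis
    using open_chart_range[OF c] by (auto simp: sets_restrict_space)
qed

end


section \<open>The area measure of a conformal metric\<close>

locale conformal_surface = riemann_surface +
  fixes g :: "'a metric"
  assumes metric: "conformal_metric \<sigma> g"
begin

lemma metric_properties:
  assumes "c \<in> \<sigma>"
  shows smooth_metric: "smooth_on (\<lambda>z. g c (chart_inv c z)) (chart_range c)"
    and metric_pos: "\<And>p. p \<in> fst c \<Longrightarrow> 0 < g c p"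
proof -
  note a = bspec[OF conjunct1[OF metric[unfolded conformal_metric_def]] assms]
  show "smooth_on (\<lambda>z. g c (chart_inv c z)) (chart_range c)" by (rule conjunct1[OF a])
  show "0 < g c p" if "p \<in> fst c" for p by (rule bspec[OF conjunct2[OF a] that])
qed

lemma metric_transition:
  assumes "c \<in> \<sigma>" "d \<in> \<sigma>" "p \<in> fst c" "p \<in> fst d"
  shows "g c p = g d p * (cmod (deriv (transition c d) (snd c p)))\<^sup>2"
  using bspec[OF bspec[OF bspec[OF conjunct2[OF metric[unfolded conformal_metric_def]] assms(1)] assms(2)], of p]
    assms(3,4) by simp

lemma Ck_on_metric: "c \<in> \<sigma> \<Longrightarrow> Ck_on k (\<lambda>z. g c (chart_inv c z)) (chart_range c)"
  using smooth_metric by (simp add: smooth_on_def)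

lemma continuous_on_metric: "c \<in> \<sigma> \<Longrightarrow> continuous_on (chart_range c) (\<lambda>z. g c (chart_inv c z))"
  using Ck_on_metric[of c 0] by simp

text \<open>The area as it is seen in a single chart; it is concentrated on the domain of the chart.\<close>

definition chart_area :: "'a chart \<Rightarrow> 'a measure" where
  "chart_area c = distr (density (restrict_space lborel (chart_range c)) (\<lambda>z. ennreal (g c (chart_inv c z))))
     borelX (chart_inv c)"

lemma borel_measurable_metric:
  assumes "c \<in> \<sigma>"
  shows "(\<lambda>z. g c (chart_inv c z)) \<in> borel_measurable (restrict_space lborel (chart_range c))"
proof -
  have "(\<lambda>z. g c (chart_inv c z)) \<in> borel_measurable (restrict_space borel (chart_range c))"
    by (rule borel_measurable_continuous_on_restrict[OF continuous_on_metric[OF assms]])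
  also have "borel_measurable (restrict_space borel (chart_range c))
      = borel_measurable (restrict_space lborel (chart_range c))"
    by (intro measurable_cong_sets sets_restrict_space_cong) auto
  finally show ?thesis .
qed

lemma sets_chart_area [simp]: "sets (chart_area c) = sets borelX"
  and space_chart_area [simp]: "space (chart_area c) = topspace X"
  by (simp_all add: chart_area_def)

lemma emeasure_chart_area:
  assumes c: "c \<in> \<sigma>" and B: "B \<in> sets borelX"
  shows "emeasure (chart_area c) B = (\<integral>\<^sup>+z\<in>snd c ` (B \<inter> fst c). ennreal (g c (chart_inv c z)) \<partial>lborel)"
proof -
  let ?L = "restrict_space lborel (chart_range c)" and ?j = "\<lambda>z. ennreal (g c (chart_inv c z))"
  have j: "?j \<in> borel_measurable ?L"
    using borel_measurable_metric[OF c] by measurable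
  have pre: "chart_inv c -` B \<inter> chart_range c \<in> sets ?L"
    using measurable_sets[OF measurable_chart_inv[OF c] B] by (simp add: space_restrict_space)
  have inv: "chart_inv c \<in> density ?L ?j \<rightarrow>\<^sub>M borelX"
    using measurable_chart_inv[OF c] by simp
  have "emeasure (chart_area c) B = emeasure (density ?L ?j) (chart_inv c -` B \<inter> chart_range c)"
    unfolding chart_area_def using emeasure_distr[OF inv B] by (simp add: space_restrict_space)
  also have "\<dots> = (\<integral>\<^sup>+z. ?j z * indicator (chart_inv c -` B \<inter> chart_range c) z \<partial>?L)"
    by (rule emeasure_density[OF j pre])
  also have "\<dots> = (\<integral>\<^sup>+z. ?j z * indicator (chart_inv c -` B \<inter> chart_range c) z * indicator (chart_range c) z \<partial>lborel)"
    using open_chart_range[OF c] by (intro nn_integral_restrict_space) simp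
  also have "\<dots> = (\<integral>\<^sup>+z\<in>snd c ` (B \<inter> fst c). ?j z \<partial>lborel)"
  proof (rule nn_integral_cong)
    fix z
    show "?j z * indicator (chart_inv c -` B \<inter> chart_range c) z * indicator (chart_range c) z
        = ?j z * indicator (snd c ` (B \<inter> fst c)) z"
      unfolding chart_image_eq[OF c] by (cases "z \<in> chart_range c") (simp_all add: indicator_def)
  qed
  finally show ?thesis .
qed

text \<open>Under a change of chart the density \<open>g\<close> acquires the factor \<open>|T'|\<^sup>2\<close>, which is the Jacobian of the
  transition map.\<close>

lemma chart_area_compatible:
  assumes c: "c \<in> \<sigma>" and d: "d \<in> \<sigma>" and B: "B \<in> sets borelX" "B \<subseteq> fst c" "B \<subseteq> fst d"
  shows "emeasure (chart_area c) B = emeasure (chart_area d) B"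
proof -
  let ?T = "transition c d" and ?S = "overlap c d"
  have img: "?T ` (snd c ` B) = snd d ` B"
  proof -
    have "?T (snd c p) = snd d p" if "p \<in> B" for p
      using that B c by (auto simp: transition_def)
    then show ?thesis unfolding image_image by (intro image_cong) auto
  qed
  have sub: "snd c ` B \<subseteq> ?S"
    using B(2,3) unfolding overlap_def by blast
  have "emeasure (chart_area d) B = (\<integral>\<^sup>+w\<in>?T ` (snd c ` B). ennreal (g d (chart_inv d w)) \<partial>lborel)"
    unfolding emeasure_chart_area[OF d B(1)] img using B(3) by (simp add: Int_absorb2)
  also have "\<dots> = (\<integral>\<^sup>+z\<in>snd c ` B. ennreal (g d (chart_inv d (?T z))) * ennreal ((cmod (deriv ?T z))\<^sup>2) \<partial>lborel)"
    by (rule nn_integral_holomorphic_substitution[OF open_overlap[OF c d] holomorphic_transition[OF c d]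
          inj_transition[OF c d] borel_chart_image[OF c B(1,2)] sub
          continuous_on_subset[OF continuous_on_metric[OF d] transition_image[OF c d]]])
  also have "\<dots> = (\<integral>\<^sup>+z\<in>snd c ` B. ennreal (g c (chart_inv c z)) \<partial>lborel)"
  proof (intro nn_integral_cong)
    fix z
    have "ennreal (g d (chart_inv d (?T z))) * ennreal ((cmod (deriv ?T z))\<^sup>2) = ennreal (g c (chart_inv c z))"
      if z: "z \<in> snd c ` B"
    proof -
      obtain p where p: "p \<in> B" "z = snd c p" using z by blast
      have pcd: "p \<in> fst c" "p \<in> fst d" using p(1) B by auto
      have "chart_inv d (?T z) = p" "chart_inv c z = p"
        using pcd c d p(2) by (simp_all add: transition_def)
      then show ?thesis
        using metric_transition[OF c d pcd] metric_pos[OF d pcd(2)] p(2)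
        by (simp add: ennreal_mult)
    qed
    then show "ennreal (g d (chart_inv d (?T z))) * ennreal ((cmod (deriv ?T z))\<^sup>2) * indicator (snd c ` B) z
        = ennreal (g c (chart_inv c z)) * indicator (snd c ` B) z"
      by (simp add: indicator_def)
  qed
  also have "\<dots> = emeasure (chart_area c) B"
    unfolding emeasure_chart_area[OF c B(1)] using B(2) by (simp add: Int_absorb2)
  finally show ?thesis by simp
qed

text \<open>Making a finite cover by chart domains disjoint splits every Borel set into pieces that lie in one
  chart each. This gives both the existence and the uniqueness of the area measure.\<close>

lemma chart_partition:
  obtains n :: nat and f D where
    "\<And>k. k < n \<Longrightarrow> f k \<in> \<sigma>" "\<And>k. k < n \<Longrightarrow> D k \<in> sets borelX" "\<And>k. k < n \<Longrightarrow> D k \<subseteq> fst (f k)"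
    "disjoint_family_on D {..<n}" "topspace X \<subseteq> (\<Union>k<n. D k)"
proof -
  obtain I where I: "disc_cover I" using disc_cover_exists ..
  then have "finite (fst ` I)" by (simp add: disc_cover_def)
  then obtain n and f :: "nat \<Rightarrow> 'a chart" where f: "fst ` I = f ` {i. i < n}"
    by (auto simp: finite_conv_nat_seg_image)
  define D where "D = disjointed (\<lambda>k. fst (f k))"
  have f\<sigma>: "f k \<in> \<sigma>" if "k < n" for k
  proof -
    have "f k \<in> fst ` I" unfolding f using that by simp
    then show ?thesis using disc_coverD(1)[OF I] by auto
  qed
  have "D k \<in> sets borelX" if "k < n" for k
    unfolding D_def disjointed_def
    using that f\<sigma> by (intro sets.Diff sets.finite_UN chart_domain_borelX) auto
  moreover have "D k \<subseteq> fst (f k)" for k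
    unfolding D_def by (rule disjointed_subset)
  moreover have "disjoint_family_on D {..<n}"
    unfolding D_def by (rule disjoint_family_on_mono[OF _ disjoint_family_disjointed]) auto
  moreover have "topspace X \<subseteq> (\<Union>k<n. D k)"
  proof
    fix p assume "p \<in> topspace X"
    with I obtain c a r where i: "(c, a, r) \<in> I" "p \<in> fst c"
      by (rule disc_coverE)
    have "c \<in> fst ` I" using image_eqI[OF _ i(1), of c fst] by simp
    then obtain k where k: "k \<in> {0..<n}" "c = f k" unfolding f by auto
    have "p \<in> (\<Union>k\<in>{0..<n}. fst (f k))" using k(1) i(2)[unfolded k(2)] by (rule UN_I)
    then show "p \<in> (\<Union>k<n. D k)"
      unfolding D_def atLeast0LessThan[symmetric] finite_UN_disjointed_eq .
  qed
  ultimately show ?thesis by (intro that[of n f D] f\<sigma>)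
qed

text \<open>The property by which \<open>area_measure\<close> is described.\<close>

definition is_area_measure :: "'a measure \<Rightarrow> bool" where
  "is_area_measure \<mu> \<longleftrightarrow> space \<mu> = topspace X \<and> sets \<mu> = sigma_sets (topspace X) {W. openin X W} \<and>
     (\<forall>c\<in>\<sigma>. \<forall>B\<in>sets \<mu>. B \<subseteq> fst c \<longrightarrow>
        emeasure \<mu> B = (\<integral>\<^sup>+z\<in>snd c ` B. ennreal (g c (chart_inv c z)) \<partial>lborel))"

lemma emeasure_is_area_measure:
  assumes "is_area_measure \<mu>" "c \<in> \<sigma>" "B \<in> sets \<mu>" "B \<subseteq> fst c"
  shows "emeasure \<mu> B = (\<integral>\<^sup>+z\<in>snd c ` B. ennreal (g c (chart_inv c z)) \<partial>lborel)"
proof -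
  note a = assms(1)[unfolded is_area_measure_def]
  show ?thesis
    by (rule bspec[OF bspec[OF conjunct2[OF conjunct2[OF a]] assms(2)] assms(3), rule_format, OF assms(4)])
qed

lemma sets_is_area_measure: "is_area_measure \<mu> \<Longrightarrow> sets \<mu> = sets borelX"
  and space_is_area_measure: "is_area_measure \<mu> \<Longrightarrow> space \<mu> = topspace X"
  unfolding is_area_measure_def sets_borelX by (elim conjE, assumption)+

lemma is_area_measure_unique:
  assumes \<mu>: "is_area_measure \<mu>" and \<nu>: "is_area_measure \<nu>"
  shows "\<mu> = \<nu>"
proof (rule measure_eqI)
  show "sets \<mu> = sets \<nu>"
    using assms by (simp add: sets_is_area_measure)
  obtain n f D where D: "\<And>k. k < n \<Longrightarrow> f k \<in> \<sigma>" "\<And>k. k < n \<Longrightarrow> D k \<in> sets borelX"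
    "\<And>k. k < n \<Longrightarrow> D k \<subseteq> fst (f k)" "disjoint_family_on D {..<n :: nat}" "topspace X \<subseteq> (\<Union>k<n. D k)"
    by (rule chart_partition) blast
  fix B assume B: "B \<in> sets \<mu>"
  have sets: "sets \<mu> = sets borelX" "sets \<nu> = sets borelX"
    using assms by (simp_all add: sets_is_area_measure)
  have cover: "B \<subseteq> (\<Union>k<n. D k)"
    using D(5) sets.sets_into_space[of B borelX] B sets by auto
  have "emeasure \<mu> B = (\<Sum>k<n. emeasure \<mu> (B \<inter> D k))"
    using B D(2) sets by (intro sum_emeasure_cover[OF _ _ _ cover D(4)]) auto
  also have "\<dots> = (\<Sum>k<n. emeasure \<nu> (B \<inter> D k))"
  proof (intro sum.cong refl)
    fix k assume k: "k \<in> {..<n}"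
    have BD: "B \<inter> D k \<in> sets \<mu>" "B \<inter> D k \<in> sets \<nu>" "B \<inter> D k \<subseteq> fst (f k)"
      using B D(2,3)[of k] k sets by auto
    have "f k \<in> \<sigma>" using D(1) k by simp
    then show "emeasure \<mu> (B \<inter> D k) = emeasure \<nu> (B \<inter> D k)"
      using emeasure_is_area_measure[OF \<mu> _ BD(1,3)] emeasure_is_area_measure[OF \<nu> _ BD(2,3)] by simp
  qed
  also have "\<dots> = emeasure \<nu> B"
    using B D(2) sets by (intro sum_emeasure_cover[OF _ _ _ cover D(4), symmetric]) auto
  finally show "emeasure \<mu> B = emeasure \<nu> B" .
qed

lemma is_area_measure_exists: "\<exists>\<mu>. is_area_measure \<mu>"
proof -
  obtain n f D where D: "\<And>k. k < n \<Longrightarrow> f k \<in> \<sigma>" "\<And>k. k < n \<Longrightarrow> D k \<in> sets borelX"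
    "\<And>k. k < n \<Longrightarrow> D k \<subseteq> fst (f k)" "disjoint_family_on D {..<n :: nat}" "topspace X \<subseteq> (\<Union>k<n. D k)"
    by (rule chart_partition) blast
  define m where "m B = (\<Sum>k<n. emeasure (chart_area (f k)) (B \<inter> D k))" for B
  define \<mu> where "\<mu> = measure_of (topspace X) {W. openin X W} m"
  have sets: "sets \<mu> = sets borelX" and space: "space \<mu> = topspace X"
    unfolding \<mu>_def using openin_subset_Pow
    by (simp_all add: sets_borelX space_measure_of sets_measure_of)
  have m: "emeasure \<mu> B = m B" if B: "B \<in> sets borelX" for B
  proof (rule emeasure_measure_of[OF \<mu>_def openin_subset_Pow])
    show "B \<in> sets \<mu>" using B sets by simp
    show "positive (sets \<mu>) m" by (simp add: positive_def m_def)
    show "countably_additive (sets \<mu>) m"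
      unfolding countably_additive_def
    proof (intro allI impI)
      fix A :: "nat \<Rightarrow> 'a set"
      assume A: "range A \<subseteq> sets \<mu>" "disjoint_family A" "(\<Union>i. A i) \<in> sets \<mu>"
      have "suminf (\<lambda>i. m (A i)) = (\<Sum>k<n. suminf (\<lambda>i. emeasure (chart_area (f k)) (A i \<inter> D k)))"
        unfolding m_def by (rule suminf_sum) (rule summableI)
      also have "\<dots> = (\<Sum>k<n. emeasure (chart_area (f k)) (\<Union>i. A i \<inter> D k))"
      proof (intro sum.cong refl suminf_emeasure)
        fix k assume "k \<in> {..<n}"
        then show "range (\<lambda>i. A i \<inter> D k) \<subseteq> sets (chart_area (f k))"
          using A(1) D(2)[of k] sets by auto
        show "disjoint_family (\<lambda>i. A i \<inter> D k)"
          using A(2) by (auto simp: disjoint_family_on_def)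
      qed
      also have "\<dots> = m (\<Union>i. A i)"
        unfolding m_def by (simp only: Int_UN_distrib2 UN_extend_simps)
      finally show "suminf (\<lambda>i. m (A i)) = m (\<Union>i. A i)" .
    qed
  qed
  have "is_area_measure \<mu>"
    unfolding is_area_measure_def
  proof (intro conjI ballI impI)
    show "space \<mu> = topspace X" "sets \<mu> = sigma_sets (topspace X) {W. openin X W}"
      using space sets by (simp_all add: sets_borelX)
    fix c B assume c: "c \<in> \<sigma>" and B: "B \<in> sets \<mu>" "B \<subseteq> fst c"
    have B': "B \<in> sets (chart_area c)" using B(1) sets by simp
    have cover: "B \<subseteq> (\<Union>k<n. D k)"
      using D(5) B(2) chart_domain_subset[OF c] by blast
    have "emeasure \<mu> B = (\<Sum>k<n. emeasure (chart_area (f k)) (B \<inter> D k))"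
      using m B(1) sets by (simp add: m_def)
    also have "\<dots> = (\<Sum>k<n. emeasure (chart_area c) (B \<inter> D k))"
    proof (intro sum.cong refl chart_area_compatible c)
      fix k assume k: "k \<in> {..<n}"
      show "f k \<in> \<sigma>" using D(1) k by simp
      show "B \<inter> D k \<in> sets borelX" using B(1) sets D(2) k by auto
      show "B \<inter> D k \<subseteq> fst (f k)" using D(3)[of k] k by auto
      show "B \<inter> D k \<subseteq> fst c" using B(2) by auto
    qed
    also have "\<dots> = emeasure (chart_area c) B"
      using D(2) by (intro sum_emeasure_cover[OF _ B' _ cover D(4), symmetric]) auto
    also have "\<dots> = (\<integral>\<^sup>+z\<in>snd c ` B. ennreal (g c (chart_inv c z)) \<partial>lborel)"
      using emeasure_chart_area[OF c, of B] B B' by (simp add: Int_absorb2)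
    finally show "emeasure \<mu> B = (\<integral>\<^sup>+z\<in>snd c ` B. ennreal (g c (chart_inv c z)) \<partial>lborel)" .
  qed
  then show ?thesis ..
qed

abbreviation area :: "'a measure" where
  "area \<equiv> area_measure X \<sigma> g"

lemma is_area_measure_area: "is_area_measure area"
proof -
  have "area = (THE \<mu>. is_area_measure \<mu>)"
    unfolding area_measure_def is_area_measure_def ..
  then show ?thesis
    using theI'[OF ex_ex1I[of is_area_measure, OF is_area_measure_exists is_area_measure_unique]] by simp
qed

lemma sets_area [simp, measurable_cong]: "sets area = sets borelX"
  and space_area [simp]: "space area = topspace X"
  using is_area_measure_area by (simp_all add: sets_is_area_measure space_is_area_measure)

lemma emeasure_area:
  assumes c: "c \<in> \<sigma>" and B: "B \<in> sets borelX" "B \<subseteq> fst c"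
  shows "emeasure area B = (\<integral>\<^sup>+z\<in>snd c ` B. ennreal (g c (chart_inv c z)) \<partial>lborel)"
  by (rule emeasure_is_area_measure[OF is_area_measure_area c]) (simp_all add: B)

lemma finite_area: "finite_measure area"
proof
  obtain I where I: "disc_cover I" using disc_cover_exists ..
  let ?disc = "\<lambda>(c, a, r). chart_inv c ` ball a r"
  have fin: "finite I" using I by (simp add: disc_cover_def)
  have disc: "?disc i \<in> sets borelX \<and> emeasure area (?disc i) < \<infinity>" if "i \<in> I" for i
  proof -
    obtain c a r where i: "i = (c, a, r)" by (cases i)
    have c: "c \<in> \<sigma>" "cball a r \<subseteq> chart_range c"
      using disc_coverD[OF I that[unfolded i]] by simp_all
    have sub: "ball a r \<subseteq> chart_range c" using c(2) ball_subset_cball by blast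
    have W: "chart_inv c ` ball a r \<in> sets borelX"
      by (intro openin_borelX openin_chart_inv_image c sub) simp
    have "bounded ((\<lambda>z. g c (chart_inv c z)) ` cball a r)"
      by (intro compact_imp_bounded compact_continuous_image continuous_on_subset[OF continuous_on_metric[OF c(1)] c(2)] compact_cball)
    then obtain B where B: "\<And>z. z \<in> cball a r \<Longrightarrow> \<bar>g c (chart_inv c z)\<bar> \<le> B"
      unfolding bounded_iff by fastforce
    have img: "snd c ` chart_inv c ` ball a r = ball a r"
      unfolding image_image
      by (rule image_cong[OF refl, THEN trans, OF chart_chart_inv[OF subsetD[OF sub]]]) simp_all
    have "emeasure area (chart_inv c ` ball a r) = (\<integral>\<^sup>+z\<in>ball a r. ennreal (g c (chart_inv c z)) \<partial>lborel)"
      using emeasure_area[OF c(1) W] chart_inv_in[OF subsetD[OF sub]] unfolding img by blast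
    also have "\<dots> \<le> (\<integral>\<^sup>+z. ennreal B * indicator (ball a r) z \<partial>lborel)"
    proof (rule nn_integral_mono)
      fix z
      show "ennreal (g c (chart_inv c z)) * indicator (ball a r) z \<le> ennreal B * indicator (ball a r) z"
        using abs_le_D1[OF B[of z]] by (auto simp: indicator_def intro!: ennreal_leI)
    qed
    also have "\<dots> = ennreal B * emeasure lborel (ball a r)"
      by (rule nn_integral_cmult_indicator) simp
    also have "\<dots> < \<infinity>"
      using emeasure_bounded_finite[OF bounded_ball[of a r]] by (simp add: ennreal_mult_less_top)
    finally show ?thesis using W i by simp
  qed
  have "topspace X \<subseteq> (\<Union>i\<in>I. ?disc i)"
  proof
    fix p assume "p \<in> topspace X"
    with I obtain c a r where i: "(c, a, r) \<in> I" "p \<in> fst c" "snd c p \<in> ball a r"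
      by (rule disc_coverE)
    have "c \<in> \<sigma>" by (rule disc_coverD(1)[OF I i(1)])
    then have "p \<in> ?disc (c, a, r)"
      using i(2,3) image_eqI[of p "chart_inv c" "snd c p" "ball a r"] by simp
    with i(1) show "p \<in> (\<Union>i\<in>I. ?disc i)" by blast
  qed
  then have "emeasure area (space area) \<le> emeasure area (\<Union>i\<in>I. ?disc i)"
    using disc fin by (intro emeasure_mono) auto
  also have "\<dots> \<le> (\<Sum>i\<in>I. emeasure area (?disc i))"
    using disc fin by (intro emeasure_subadditive_finite) auto
  also have "\<dots> < \<infinity>"
    unfolding infinity_ennreal_def ennreal_sum_less_top[OF fin] using disc by simp
  finally show "emeasure area (space area) \<noteq> \<infinity>" by simp
qed

lemma integrable_chart_continuous:
  fixes F :: "'a \<Rightarrow> 'b::{banach, second_countable_topology}"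
  assumes "chart_continuous F"
  shows "integrable area F"
proof -
  interpret finite_measure area by (rule finite_area)
  obtain B where "\<forall>p\<in>topspace X. norm (F p) \<le> B"
    using chart_continuous_bound[OF assms] ..
  moreover have "F \<in> borel_measurable area"
    using borel_measurable_chart_continuous[OF assms] by (simp cong: measurable_cong_sets)
  ultimately show ?thesis
    by (intro integrable_const_bound[of _ B]) auto
qed

lemma integral_area_chart:
  fixes F :: "'a \<Rightarrow> real"
  assumes c: "c \<in> \<sigma>" and F: "F \<in> borel_measurable borelX"
    and supp: "\<And>p. p \<in> topspace X \<Longrightarrow> p \<notin> fst c \<Longrightarrow> F p = 0"
  shows "(\<integral>p. F p \<partial>area) =
    (\<integral>z. indicator (chart_range c) z * (g c (chart_inv c z) * F (chart_inv c z)) \<partial>lborel)"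
proof -
  let ?L = "restrict_space lborel (chart_range c)" and ?j = "\<lambda>z. g c (chart_inv c z)"
  have dom: "fst c \<inter> topspace X = fst c" "fst c \<in> sets borelX"
    using chart_domain_subset[OF c] chart_domain_borelX[OF c] by auto
  have eq: "restrict_space area (fst c) = restrict_space (chart_area c) (fst c)"
  proof (rule measure_eqI)
    show "sets (restrict_space area (fst c)) = sets (restrict_space (chart_area c) (fst c))"
      by (intro sets_restrict_space_cong) simp
    fix B assume "B \<in> sets (restrict_space area (fst c))"
    then have B: "B \<in> sets borelX" "B \<subseteq> fst c"
      using dom by (auto simp: sets_restrict_space)
    show "emeasure (restrict_space area (fst c)) B = emeasure (restrict_space (chart_area c) (fst c)) B"
      using B dom emeasure_area[OF c B] emeasure_chart_area[OF c B(1)]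
      by (simp add: emeasure_restrict_space Int_absorb2)
  qed
  have ind: "indicator (fst c) p *\<^sub>R F p = F p" if "p \<in> topspace X" for p
    using supp[OF that] by (cases "p \<in> fst c") simp_all
  have "(\<integral>p. F p \<partial>area) = (\<integral>p. F p \<partial>restrict_space area (fst c))"
    using dom ind by (subst integral_restrict_space) (auto intro!: Bochner_Integration.integral_cong)
  also have "\<dots> = (\<integral>p. F p \<partial>restrict_space (chart_area c) (fst c))"
    by (simp add: eq)
  also have "\<dots> = (\<integral>p. F p \<partial>chart_area c)"
    using dom ind by (subst integral_restrict_space) (auto intro!: Bochner_Integration.integral_cong)
  also have "\<dots> = (\<integral>z. F (chart_inv c z) \<partial>density ?L (\<lambda>z. ennreal (?j z)))"
    unfolding chart_area_def using measurable_chart_inv[OF c] F by (subst integral_distr) simp_all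
  also have "\<dots> = (\<integral>z. ?j z *\<^sub>R F (chart_inv c z) \<partial>?L)"
  proof (rule integral_density)
    show "(\<lambda>z. F (chart_inv c z)) \<in> borel_measurable ?L"
      by (rule measurable_compose[OF measurable_chart_inv[OF c] F])
    show "?j \<in> borel_measurable ?L" by (rule borel_measurable_metric[OF c])
    show "AE z in ?L. 0 \<le> ?j z"
      using metric_pos[OF c chart_inv_in] by (intro AE_I2) (auto simp: space_restrict_space less_imp_le)
  qed
  also have "\<dots> = (\<integral>z. indicator (chart_range c) z * (?j z * F (chart_inv c z)) \<partial>lborel)"
    using open_chart_range[OF c] by (subst integral_restrict_space) simp_all
  finally show ?thesis .
qed

end


section \<open>The divergence theorem\<close>

context conformal_surface
begin

definition surface_C2 :: "('a \<Rightarrow> real) \<Rightarrow> bool" where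
  "surface_C2 F \<longleftrightarrow> (\<forall>c\<in>\<sigma>. Ck_on 2 (\<lambda>z. F (chart_inv c z)) (chart_range c))"

lemma surface_C2D: "surface_C2 F \<Longrightarrow> c \<in> \<sigma> \<Longrightarrow> Ck_on 2 (\<lambda>z. F (chart_inv c z)) (chart_range c)"
  by (simp add: surface_C2_def)

lemma surface_C2_imp_continuous: "surface_C2 F \<Longrightarrow> chart_continuous F"
  unfolding surface_C2_def chart_continuous_def by (intro ballI Ck_on_imp_continuous_on[of 2]) simp

lemma overlapI: "p \<in> fst c \<Longrightarrow> p \<in> fst d \<Longrightarrow> snd c p \<in> overlap c d"
  unfolding overlap_def by blast

lemma flat_laplacian_chart_change:
  assumes F: "surface_C2 F" and c: "c \<in> \<sigma>" and d: "d \<in> \<sigma>" and p: "p \<in> fst c" "p \<in> fst d"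
  shows "flat_laplacian (\<lambda>z. F (chart_inv c z)) (snd c p) =
    (cmod (deriv (transition c d) (snd c p)))\<^sup>2 * flat_laplacian (\<lambda>z. F (chart_inv d z)) (snd d p)"
proof -
  let ?T = "transition c d"
  have z: "snd c p \<in> overlap c d" by (rule overlapI[OF p])
  have "flat_laplacian (\<lambda>z. F (chart_inv c z)) (snd c p) = flat_laplacian (\<lambda>z. F (chart_inv d (?T z))) (snd c p)"
    by (rule flat_laplacian_cong_open[OF open_overlap[OF c d] z]) (simp add: chart_inv_transition[OF c d])
  also have "\<dots> = (cmod (deriv ?T (snd c p)))\<^sup>2 * flat_laplacian (\<lambda>z. F (chart_inv d z)) (?T (snd c p))"
    by (rule flat_laplacian_compose_holomorphic[OF open_overlap[OF c d] open_chart_range[OF d]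
          holomorphic_transition[OF c d] transition_image[OF c d] surface_C2D[OF F d] z])
  also have "?T (snd c p) = snd d p"
    using p c by (simp add: transition_def)
  finally show ?thesis .
qed

text \<open>The factor \<open>|T'|\<^sup>2\<close> by which the flat Laplacian changes cancels against that of the metric.\<close>

lemma laplacian_chart_independent:
  assumes F: "surface_C2 F" and c: "c \<in> \<sigma>" and d: "d \<in> \<sigma>" and p: "p \<in> fst c" "p \<in> fst d"
  shows "flat_laplacian (\<lambda>z. F (chart_inv c z)) (snd c p) / g c p =
    flat_laplacian (\<lambda>z. F (chart_inv d z)) (snd d p) / g d p"
  unfolding flat_laplacian_chart_change[OF assms] metric_transition[OF c d p]
  using deriv_transition_nonzero[OF c d overlapI[OF p]] by simp

lemma laplace_beltrami_chart:
  assumes F: "surface_C2 F" and c: "c \<in> \<sigma>" and p: "p \<in> fst c"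
  shows "laplace_beltrami \<sigma> g F p = flat_laplacian (\<lambda>z. F (chart_inv c z)) (snd c p) / g c p"
proof -
  have "p \<in> topspace X" using chart_domain_subset[OF c] p by blast
  from laplacian_chart_independent[OF F chart_at(1)[OF this] c chart_at(2)[OF this] p]
  show ?thesis by (simp add: laplace_beltrami_def Let_def)
qed

lemma chart_continuous_laplace_beltrami:
  assumes F: "surface_C2 F"
  shows "chart_continuous (laplace_beltrami \<sigma> g F)"
  unfolding chart_continuous_def
proof
  fix c assume c: "c \<in> \<sigma>"
  have "continuous_on (chart_range c) (\<lambda>z. flat_laplacian (\<lambda>z. F (chart_inv c z)) z / g c (chart_inv c z))"
    using metric_pos[OF c chart_inv_in]
    by (intro continuous_on_divide continuous_on_flat_laplacian surface_C2D F c open_chart_range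
        continuous_on_metric) fastforce
  moreover have "laplace_beltrami \<sigma> g F (chart_inv c z) =
      flat_laplacian (\<lambda>z. F (chart_inv c z)) z / g c (chart_inv c z)" if "z \<in> chart_range c" for z
    using laplace_beltrami_chart[OF F c chart_inv_in[OF that]] chart_chart_inv[OF that] by simp
  ultimately show "continuous_on (chart_range c) (\<lambda>z. laplace_beltrami \<sigma> g F (chart_inv c z))"
    by (simp cong: continuous_on_cong)
qed

lemma laplace_beltrami_sum:
  assumes F: "\<And>i. i \<in> I \<Longrightarrow> surface_C2 (F i)" and p: "p \<in> topspace X"
  shows "laplace_beltrami \<sigma> g (\<lambda>q. \<Sum>i\<in>I. F i q) p = (\<Sum>i\<in>I. laplace_beltrami \<sigma> g (F i) p)"
  unfolding laplace_beltrami_def Let_def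
  by (subst flat_laplacian_sum[OF open_chart_range[OF chart_at(1)[OF p]] imageI[OF chart_at(2)[OF p]]])
    (simp_all add: surface_C2D[OF F chart_at(1)[OF p]] sum_divide_distrib)

text \<open>In the chart, the density \<open>g\<close> of the area cancels the denominator of the Laplacian, and what remains
  is the flat Laplacian of a function with compact support in the plane.\<close>

lemma integral_laplace_beltrami_supported:
  assumes F: "surface_C2 F" and c: "c \<in> \<sigma>" and disc: "cball a r \<subseteq> chart_range c"
    and supp: "\<And>p. p \<in> topspace X \<Longrightarrow> p \<notin> chart_inv c ` cball a r \<Longrightarrow> F p = 0"
  shows "(\<integral>p. laplace_beltrami \<sigma> g F p \<partial>area) = 0"
proof -
  let ?f = "\<lambda>z. F (chart_inv c z)"
  \<comment> \<open>Extension by zero outside the range of the chart; it is \<open>C\<^sup>2\<close> because the range and the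
    complement of the disc cover the plane.\<close>
  define H where "H z = (if z \<in> chart_range c then ?f z else 0)" for z
  have f0: "?f z = 0" if "z \<in> chart_range c" "z \<notin> cball a r" for z
  proof (rule supp[OF chart_inv_in_space[OF c that(1)]])
    show "chart_inv c z \<notin> chart_inv c ` cball a r"
    proof
      assume "chart_inv c z \<in> chart_inv c ` cball a r"
      then obtain w where w: "w \<in> cball a r" "chart_inv c z = chart_inv c w" by blast
      then have "snd c (chart_inv c z) = snd c (chart_inv c w)" by simp
      then have "z = w"
        using chart_chart_inv[OF that(1)] chart_chart_inv[OF subsetD[OF disc w(1)]] by simp
      with that(2) w(1) show False by simp
    qed
  qed
  have H0: "H z = 0" if "z \<notin> cball a r" for z
    using f0[OF _ that] by (simp add: H_def)
  have "Ck_on 2 H (chart_range c)"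
    by (rule Ck_on_cong[OF open_chart_range[OF c] _ surface_C2D[OF F c]]) (simp add: H_def)
  moreover have "Ck_on 2 H (- cball a r)"
    by (rule Ck_on_cong[OF _ _ Ck_on_const[of _ _ 0]]) (auto simp: H0)
  ultimately have "Ck_on 2 H (chart_range c \<union> - cball a r)"
    using open_chart_range[OF c] by (intro Ck_on_Un) auto
  moreover have "chart_range c \<union> - cball a r = UNIV"
    using disc by blast
  ultimately have C2: "Ck_on 2 H UNIV" by simp
  have lapH: "flat_laplacian H z = flat_laplacian ?f z" if "z \<in> chart_range c" for z
    by (rule flat_laplacian_cong_open[OF open_chart_range[OF c] that]) (simp add: H_def)
  have lapH0: "flat_laplacian H z = 0" if "z \<notin> cball a r" for z
  proof -
    have "flat_laplacian H z = flat_laplacian (\<lambda>_. 0) z"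
      by (rule flat_laplacian_cong_open[of "- cball a r"]) (use that H0 in auto)
    then show ?thesis by (simp add: flat_laplacian_def second_derivative_def)
  qed
  \<comment> \<open>Outside the chart \<open>F\<close> vanishes on a neighbourhood, so its Laplacian does too.\<close>
  have off: "laplace_beltrami \<sigma> g F p = 0" if p: "p \<in> topspace X" "p \<notin> fst c" for p
  proof -
    let ?d = "chart_at \<sigma> p"
    note d = chart_at[OF p(1)]
    define W where "W = topspace X - chart_inv c ` cball a r"
    have W: "openin X W"
      unfolding W_def by (intro openin_diff openin_topspace closedin_chart_inv_image c disc compact_cball)
    have pW: "p \<in> W"
    proof -
      have "chart_inv c ` cball a r \<subseteq> fst c"
        by (rule image_subsetI) (rule chart_inv_in[OF subsetD[OF disc]])
      then show ?thesis using p unfolding W_def by (meson DiffI subsetD)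
    qed
    have "flat_laplacian (\<lambda>z. F (chart_inv ?d z)) (snd ?d p) = flat_laplacian (\<lambda>_. 0) (snd ?d p)"
    proof (rule flat_laplacian_cong_open[OF open_chart_image[OF d(1) W]])
      show "snd ?d p \<in> {z \<in> chart_range ?d. chart_inv ?d z \<in> W}"
        using d pW by simp
      show "F (chart_inv ?d y) = 0" if "y \<in> {z \<in> chart_range ?d. chart_inv ?d z \<in> W}" for y
        using that unfolding W_def by (intro supp) auto
    qed
    then show ?thesis
      by (simp add: laplace_beltrami_def Let_def flat_laplacian_def second_derivative_def)
  qed
  have "(\<integral>p. laplace_beltrami \<sigma> g F p \<partial>area) =
      (\<integral>z. indicator (chart_range c) z * (g c (chart_inv c z) * laplace_beltrami \<sigma> g F (chart_inv c z)) \<partial>lborel)"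
    by (rule integral_area_chart[OF c borel_measurable_chart_continuous[OF
            chart_continuous_laplace_beltrami[OF F]] off])
  also have "\<dots> = (\<integral>z. flat_laplacian H z \<partial>lborel)"
  proof (rule Bochner_Integration.integral_cong[OF refl])
    fix z
    show "indicator (chart_range c) z * (g c (chart_inv c z) * laplace_beltrami \<sigma> g F (chart_inv c z)) =
        flat_laplacian H z"
    proof (cases "z \<in> chart_range c")
      case True
      then show ?thesis
        using laplace_beltrami_chart[OF F c chart_inv_in[OF True]] chart_chart_inv[OF True]
          metric_pos[OF c chart_inv_in[OF True]] lapH[OF True] by simp
    next
      case False
      then have "z \<notin> cball a r" using disc by blast
      then show ?thesis
        by (simp only: indicator_simps(2)[OF False] lapH0 mult_zero_left not_False_eq_True)
    qed
  qed
  also have "\<dots> = 0"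
    by (rule integral_flat_laplacian_eq_0(2)[OF C2 H0])
  finally show ?thesis .
qed

text \<open>The exponent \<open>3\<close> makes the function \<open>C\<^sup>2\<close> across the boundary circle.\<close>

definition bump :: "'a chart \<Rightarrow> complex \<Rightarrow> real \<Rightarrow> 'a \<Rightarrow> real" where
  "bump c a r p = (if p \<in> fst c then max 0 (r\<^sup>2 - (cmod (snd c p - a))\<^sup>2) ^ 3 else 0)"

lemma Ck_on_disc_function: "Ck_on k (\<lambda>z. r\<^sup>2 - (cmod (z - a))\<^sup>2) UNIV"
proof -
  have *: "Ck_on k (\<lambda>z. Re (z - a)) UNIV" "Ck_on k (\<lambda>z. Re (- \<i> * (z - a))) UNIV"
    by (rule Ck_on_Re_holomorphic, simp, intro holomorphic_intros)+
  have "Ck_on k (\<lambda>z. r\<^sup>2 + (-1) * (Re (z - a) * Re (z - a) + Re (- \<i> * (z - a)) * Re (- \<i> * (z - a)))) UNIV"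
    by (intro Ck_on_add Ck_on_mult Ck_on_const * open_UNIV)
  moreover have "(\<lambda>z. r\<^sup>2 + (-1) * (Re (z - a) * Re (z - a) + Re (- \<i> * (z - a)) * Re (- \<i> * (z - a))))
      = (\<lambda>z. r\<^sup>2 - (cmod (z - a))\<^sup>2)"
    unfolding cmod_power2 by (intro ext) (simp add: power2_eq_square algebra_simps)
  ultimately show ?thesis by simp
qed

lemma bump_eq_0:
  assumes "c \<in> \<sigma>" "0 < r" "p \<notin> chart_inv c ` cball a r"
  shows "bump c a r p = 0"
proof (cases "p \<in> fst c")
  case True
  have "snd c p \<notin> cball a r"
    using image_eqI[of p "chart_inv c" "snd c p" "cball a r"] assms(3) chart_inv[OF assms(1) True] by auto
  then have "r < cmod (snd c p - a)"
    by (simp add: dist_norm norm_minus_commute)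
  then have "r\<^sup>2 < (cmod (snd c p - a))\<^sup>2"
    using assms(2) by (intro power_strict_mono) auto
  then show ?thesis by (simp add: bump_def max_def)
qed (simp add: bump_def)

lemma surface_C2_bump:
  assumes c: "c \<in> \<sigma>" and r: "0 < r" and disc: "cball a r \<subseteq> chart_range c"
  shows "surface_C2 (bump c a r)"
  unfolding surface_C2_def
proof
  fix d assume d: "d \<in> \<sigma>"
  let ?b = "\<lambda>z. bump c a r (chart_inv d z)"
  define W where "W = topspace X - chart_inv c ` cball a r"
  define V where "V = {z \<in> chart_range d. chart_inv d z \<in> W}"
  have W: "openin X W"
    unfolding W_def by (intro openin_diff openin_topspace closedin_chart_inv_image c disc compact_cball)
  have V: "open V"
    unfolding V_def by (rule open_chart_image[OF d W])
  have "Ck_on 2 (\<lambda>z. max 0 (r\<^sup>2 - (cmod (transition d c z - a))\<^sup>2) ^ Suc 2) (overlap d c)"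
    by (rule Ck_on_compose_holomorphic[OF open_overlap[OF d c] open_UNIV holomorphic_transition[OF d c] subset_UNIV
          Ck_on_max_power[OF open_UNIV Ck_on_disc_function]])
  then have "Ck_on 2 ?b (overlap d c)"
    by (rule Ck_on_cong[OF open_overlap[OF d c], rotated])
      (simp add: bump_def overlap_eq[OF d] transition_def)
  moreover have "Ck_on 2 ?b V"
    by (rule Ck_on_cong[OF V _ Ck_on_const[OF V, of _ 0]])
      (simp add: V_def W_def bump_eq_0[OF c r])
  ultimately have "Ck_on 2 ?b (overlap d c \<union> V)"
    by (intro Ck_on_Un open_overlap d c V)
  moreover have "chart_range d \<subseteq> overlap d c \<union> V"
  proof
    fix z assume z: "z \<in> chart_range d"
    show "z \<in> overlap d c \<union> V"
    proof (cases "chart_inv d z \<in> fst c")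
      case True
      then show ?thesis using z by (simp add: overlap_eq[OF d])
    next
      case False
      have "chart_inv c ` cball a r \<subseteq> fst c"
        by (rule image_subsetI) (rule chart_inv_in[OF subsetD[OF disc]])
      with False have "chart_inv d z \<notin> chart_inv c ` cball a r"
        by (meson subsetD)
      then show ?thesis
        using z chart_inv_in_space[OF d z] by (simp add: V_def W_def)
    qed
  qed
  ultimately show "Ck_on 2 ?b (chart_range d)"
    by (rule Ck_on_subset)
qed

lemma surface_C2_mult:
  "surface_C2 F \<Longrightarrow> surface_C2 G \<Longrightarrow> surface_C2 (\<lambda>p. F p * G p)"
  unfolding surface_C2_def by (intro ballI Ck_on_mult open_chart_range) simp_all

lemma surface_C2_sum:
  "(\<And>i. i \<in> I \<Longrightarrow> surface_C2 (F i)) \<Longrightarrow> surface_C2 (\<lambda>p. \<Sum>i\<in>I. F i p)"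
  unfolding surface_C2_def by (intro ballI Ck_on_sum open_chart_range) simp_all

lemma surface_C2_inverse:
  "surface_C2 F \<Longrightarrow> (\<And>p. p \<in> topspace X \<Longrightarrow> F p \<noteq> 0) \<Longrightarrow> surface_C2 (\<lambda>p. inverse (F p))"
  unfolding surface_C2_def by (intro ballI Ck_on_inverse open_chart_range) (simp_all add: chart_inv_in_space)

text \<open>With \<open>B\<close> the sum of the bump functions of a disc cover, the functions \<open>F b\<^sub>i / B\<close> add up to \<open>F\<close>, and
  each of them is supported in one disc.\<close>

theorem integral_laplace_beltrami_eq_0:
  assumes F: "surface_C2 F"
  shows "(\<integral>p. laplace_beltrami \<sigma> g F p \<partial>area) = 0"
proof -
  obtain I where I: "disc_cover I" using disc_cover_exists ..
  have fin: "finite I" using I by (simp add: disc_cover_def)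
  define b where "b = (\<lambda>(c, a, r). bump c a r)"
  have b_nonneg: "0 \<le> b i p" for i p
    by (cases i) (simp add: b_def bump_def)
  have C2b: "surface_C2 (b i)" if "i \<in> I" for i
  proof -
    obtain c a r where car: "i = (c, a, r)" by (cases i)
    show ?thesis
      using surface_C2_bump[OF disc_coverD[OF I that[unfolded car]]] by (simp add: b_def car)
  qed
  define B where "B p = (\<Sum>i\<in>I. b i p)" for p
  have B_pos: "0 < B p" if p: "p \<in> topspace X" for p
  proof -
    obtain c a r where i: "(c, a, r) \<in> I" "p \<in> fst c" "snd c p \<in> ball a r"
      using I p by (rule disc_coverE)
    have "cmod (snd c p - a) < r"
      using i(3) by (simp add: dist_norm norm_minus_commute)
    then have "(cmod (snd c p - a))\<^sup>2 < r\<^sup>2"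
      by (intro power_strict_mono) auto
    then have "0 < b (c, a, r) p"
      using i(2) by (simp add: b_def bump_def max_def)
    also have "\<dots> \<le> B p"
      unfolding B_def using member_le_sum[OF i(1), of "\<lambda>i. b i p"] b_nonneg fin by simp
    finally show ?thesis .
  qed
  have C2B: "surface_C2 B"
    unfolding B_def by (rule surface_C2_sum[OF C2b])
  define G where "G i p = F p * (b i p * inverse (B p))" for i p
  have C2G: "surface_C2 (G i)" if "i \<in> I" for i
    unfolding G_def
    by (intro surface_C2_mult surface_C2_inverse F C2b that C2B) (use B_pos in fastforce)
  have FG: "F p = (\<Sum>i\<in>I. G i p)" if p: "p \<in> topspace X" for p
  proof -
    have "(\<Sum>i\<in>I. G i p) = F p * (B p * inverse (B p))"
      unfolding G_def B_def by (simp only: sum_distrib_left sum_distrib_right)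
    then show ?thesis using B_pos[OF p] by simp
  qed
  have lap: "laplace_beltrami \<sigma> g F p = (\<Sum>i\<in>I. laplace_beltrami \<sigma> g (G i) p)" if p: "p \<in> topspace X" for p
  proof -
    have "laplace_beltrami \<sigma> g F p = laplace_beltrami \<sigma> g (\<lambda>q. \<Sum>i\<in>I. G i q) p"
      unfolding laplace_beltrami_def Let_def
      using flat_laplacian_cong_open[OF open_chart_range[OF chart_at(1)[OF p]] imageI[OF chart_at(2)[OF p]],
          of "\<lambda>z. F (chart_inv (chart_at \<sigma> p) z)" "\<lambda>z. \<Sum>i\<in>I. G i (chart_inv (chart_at \<sigma> p) z)"]
        FG[OF chart_inv_in_space[OF chart_at(1)[OF p]]] by simp
    also have "\<dots> = (\<Sum>i\<in>I. laplace_beltrami \<sigma> g (G i) p)"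
      by (rule laplace_beltrami_sum[OF C2G p])
    finally show ?thesis .
  qed
  have "(\<integral>p. laplace_beltrami \<sigma> g F p \<partial>area) = (\<integral>p. (\<Sum>i\<in>I. laplace_beltrami \<sigma> g (G i) p) \<partial>area)"
    by (rule Bochner_Integration.integral_cong) (simp_all add: lap)
  also have "\<dots> = (\<Sum>i\<in>I. \<integral>p. laplace_beltrami \<sigma> g (G i) p \<partial>area)"
    by (intro Bochner_Integration.integral_sum integrable_chart_continuous
        chart_continuous_laplace_beltrami C2G)
  also have "\<dots> = 0"
  proof (intro sum.neutral ballI)
    fix i assume i: "i \<in> I"
    obtain c a r where car: "i = (c, a, r)" by (cases i)
    note D = disc_coverD[OF I i[unfolded car]]
    show "(\<integral>p. laplace_beltrami \<sigma> g (G i) p \<partial>area) = 0"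
      by (rule integral_laplace_beltrami_supported[OF C2G[OF i] D(1,3)])
        (simp add: G_def b_def car bump_eq_0[OF D(1,2)])
  qed
  finally show ?thesis .
qed

end


section \<open>Quadratic differentials\<close>

context conformal_surface
begin

lemma quadratic_differentialD:
  assumes "\<alpha> \<in> quadratic_differentials \<sigma>"
  shows qd_holomorphic: "\<And>c. c \<in> \<sigma> \<Longrightarrow> (\<lambda>z. \<alpha> c (chart_inv c z)) holomorphic_on chart_range c"
    and qd_transition: "\<And>c d p. c \<in> \<sigma> \<Longrightarrow> d \<in> \<sigma> \<Longrightarrow> p \<in> fst c \<Longrightarrow> p \<in> fst d \<Longrightarrow>
           \<alpha> c p = \<alpha> d p * (deriv (transition c d) (snd c p))\<^sup>2"
    and qd_default: "\<And>c p. c \<notin> \<sigma> \<or> p \<notin> fst c \<Longrightarrow> \<alpha> c p = 0"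
proof -
  note a = assms[unfolded quadratic_differentials_def mem_Collect_eq]
  show "(\<lambda>z. \<alpha> c (chart_inv c z)) holomorphic_on chart_range c" if "c \<in> \<sigma>" for c
    by (rule bspec[OF conjunct1[OF a] that])
  show "\<alpha> c p = \<alpha> d p * (deriv (transition c d) (snd c p))\<^sup>2"
    if "c \<in> \<sigma>" "d \<in> \<sigma>" "p \<in> fst c" "p \<in> fst d" for c d p
    by (rule bspec[OF bspec[OF bspec[OF conjunct1[OF conjunct2[OF a]] that(1)] that(2)] IntI[OF that(3,4)]])
  show "\<alpha> c p = 0" if "c \<notin> \<sigma> \<or> p \<notin> fst c" for c p
    using conjunct2[OF conjunct2[OF a]] that by blast
qed

lemma qcomb_quadratic_differential:
  assumes \<alpha>: "\<alpha> \<in> quadratic_differentials \<sigma>" and \<beta>: "\<beta> \<in> quadratic_differentials \<sigma>"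
  shows "qcomb t \<alpha> s \<beta> \<in> quadratic_differentials \<sigma>"
  unfolding quadratic_differentials_def mem_Collect_eq qcomb_def
proof (intro conjI ballI allI impI)
  fix c assume c: "c \<in> \<sigma>"
  show "(\<lambda>z. t * \<alpha> c (chart_inv c z) + s * \<beta> c (chart_inv c z)) holomorphic_on chart_range c"
    by (rule holomorphic_on_add[OF holomorphic_on_mult[OF holomorphic_on_const qd_holomorphic[OF \<alpha> c]]
          holomorphic_on_mult[OF holomorphic_on_const qd_holomorphic[OF \<beta> c]]])
  fix d p assume d: "d \<in> \<sigma>" "p \<in> fst c \<inter> fst d"
  then have p: "p \<in> fst c" "p \<in> fst d" by auto
  show "t * \<alpha> c p + s * \<beta> c p = (t * \<alpha> d p + s * \<beta> d p) * (deriv (transition c d) (snd c p))\<^sup>2"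
    unfolding qd_transition[OF \<alpha> c d(1) p] qd_transition[OF \<beta> c d(1) p] by (simp add: algebra_simps)
next
  fix c p assume "c \<notin> \<sigma> \<or> p \<notin> fst c"
  then show "t * \<alpha> c p + s * \<beta> c p = 0"
    using qd_default[OF \<alpha>] qd_default[OF \<beta>] by simp
qed

lemma qzero_quadratic_differential: "qzero \<in> quadratic_differentials \<sigma>"
  unfolding quadratic_differentials_def qzero_def by simp

lemma qdiff_minus_qzero [simp]: "qdiff_minus \<alpha> qzero = \<alpha>"
  by (simp add: qcomb_def qzero_def)

lemma qcomb_0_0 [simp]: "qcomb 0 \<alpha> 0 \<beta> = qzero"
  by (simp add: qcomb_def qzero_def)

text \<open>A step in a direction \<open>w\<alpha>\<close> of \<open>Q(\<sigma>)\<close> is a step of the parameter \<open>t\<close>, so the directional derivatives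
  of \<open>u\<close> along \<open>Q(\<sigma>)\<close> are partial derivatives of the two-parameter deformation.\<close>

lemma qcomb_shift: "qcomb 1 (qcomb t \<alpha> s \<beta>) r (qcomb w \<alpha> 0 \<beta>) = qcomb (t + r * w) \<alpha> s \<beta>"
  by (simp add: qcomb_def algebra_simps)

lemma qcomb_diff: "qdiff_minus (qcomb t \<alpha> s \<beta>) (qcomb t' \<alpha> s' \<beta>) = qcomb (t - t') \<alpha> (s - s') \<beta>"
  by (simp add: qcomb_def algebra_simps)

definition pairing :: "'a qdiff \<Rightarrow> 'a qdiff \<Rightarrow> 'a \<Rightarrow> complex" where
  "pairing \<alpha> \<beta> p = (let c = chart_at \<sigma> p in \<alpha> c p * cnj (\<beta> c p) / of_real ((g c p)\<^sup>2))"

lemma weil_petersson_eq: "weil_petersson X \<sigma> g \<alpha> \<beta> = (\<integral>p. pairing \<alpha> \<beta> p \<partial>area)"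
  by (simp add: weil_petersson_def pairing_def)

text \<open>Numerator and denominator of the Weil-Petersson integrand both change by the factor \<open>|T'|\<^sup>4\<close>, so the
  arbitrary choice of a chart at each point does not affect continuity.\<close>

lemma chart_continuous_pairing:
  assumes \<alpha>: "\<alpha> \<in> quadratic_differentials \<sigma>" and \<beta>: "\<beta> \<in> quadratic_differentials \<sigma>"
  shows "chart_continuous (pairing \<alpha> \<beta>)"
  unfolding pairing_def Let_def
proof (rule chart_continuous_chart_at)
  fix c assume c: "c \<in> \<sigma>"
  have "of_real ((g c (chart_inv c z))\<^sup>2) \<noteq> (0::complex)" if "z \<in> chart_range c" for z
    using metric_pos[OF c chart_inv_in[OF that]] by simp
  then show "continuous_on (chart_range c) (\<lambda>z. \<alpha> c (chart_inv c z) * cnj (\<beta> c (chart_inv c z))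
      / of_real ((g c (chart_inv c z))\<^sup>2))"
    by (intro continuous_on_divide continuous_on_mult continuous_on_cnj continuous_on_of_real continuous_on_power
        continuous_on_metric c holomorphic_on_imp_continuous_on qd_holomorphic[OF \<alpha> c] qd_holomorphic[OF \<beta> c] ballI)
next
  fix c d p assume c: "c \<in> \<sigma>" and d: "d \<in> \<sigma>" and p: "p \<in> fst c" "p \<in> fst d"
  define T where "T = deriv (transition c d) (snd c p)"
  have T: "T \<noteq> 0"
    unfolding T_def by (rule deriv_transition_nonzero[OF c d overlapI[OF p]])
  have "of_real ((g c p)\<^sup>2) = (of_real ((g d p)\<^sup>2) * (of_real ((cmod T)\<^sup>2))\<^sup>2 :: complex)"
    unfolding metric_transition[OF c d p] T_def[symmetric] by (simp add: power_mult_distrib)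
  then have *: "of_real ((g c p)\<^sup>2) = of_real ((g d p)\<^sup>2) * (T * cnj T)\<^sup>2"
    unfolding complex_norm_square .
  show "\<alpha> c p * cnj (\<beta> c p) / of_real ((g c p)\<^sup>2) = \<alpha> d p * cnj (\<beta> d p) / of_real ((g d p)\<^sup>2)"
    unfolding * qd_transition[OF \<alpha> c d p] qd_transition[OF \<beta> c d p] T_def[symmetric]
    using T by (simp add: power_mult_distrib)
qed

definition pointwise_norm :: "'a qdiff \<Rightarrow> 'a \<Rightarrow> real" where
  "pointwise_norm \<alpha> p = cmod (\<alpha> (chart_at \<sigma> p) p) / g (chart_at \<sigma> p) p"

lemma metric_chart_at_pos: "p \<in> topspace X \<Longrightarrow> 0 < g (chart_at \<sigma> p) p"
  by (rule metric_pos[OF chart_at])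

lemma pointwise_norm_nonneg: "p \<in> topspace X \<Longrightarrow> 0 \<le> pointwise_norm \<alpha> p"
  using metric_chart_at_pos unfolding pointwise_norm_def by (simp add: less_imp_le)

lemma pairing_self: "pairing \<alpha> \<alpha> p = of_real ((pointwise_norm \<alpha> p)\<^sup>2)"
proof -
  have "of_real ((pointwise_norm \<alpha> p)\<^sup>2) =
      (of_real ((cmod (\<alpha> (chart_at \<sigma> p) p))\<^sup>2) / of_real ((g (chart_at \<sigma> p) p)\<^sup>2) :: complex)"
    by (simp add: pointwise_norm_def power_divide)
  then show ?thesis
    unfolding complex_norm_square pairing_def Let_def by simp
qed

text \<open>The terms are grouped by \<open>t\<close>, so that the derivative at \<open>t = 0\<close> can be read off.\<close>

lemma Re_pairing_qcomb:
  "Re (pairing (qcomb t \<alpha> s \<beta>) (qcomb t \<alpha> s \<beta>) p) =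
    Re (t * (cnj t * pairing \<alpha> \<alpha> p + 2 * cnj s * pairing \<alpha> \<beta> p)) + (cmod s)\<^sup>2 * Re (pairing \<beta> \<beta> p)"
proof -
  define a b k where "a = \<alpha> (chart_at \<sigma> p) p" and "b = \<beta> (chart_at \<sigma> p) p"
    and "k = inverse ((g (chart_at \<sigma> p) p)\<^sup>2)"
  have pair: "pairing \<alpha> \<alpha> p = k *\<^sub>R (a * cnj a)" "pairing \<alpha> \<beta> p = k *\<^sub>R (a * cnj b)"
    "pairing \<beta> \<beta> p = k *\<^sub>R (b * cnj b)"
    "pairing (qcomb t \<alpha> s \<beta>) (qcomb t \<alpha> s \<beta>) p = k *\<^sub>R ((t * a + s * b) * cnj (t * a + s * b))"
    unfolding pairing_def Let_def a_def b_def k_def qcomb_def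
    by (simp_all add: scaleR_conv_of_real divide_inverse mult.commute)
  have "(t * a + s * b) * cnj (t * a + s * b) =
      t * (cnj t * (a * cnj a)) + (t * cnj s * (a * cnj b) + cnj (t * cnj s * (a * cnj b))) + (s * cnj s) * (b * cnj b)"
    by (simp add: algebra_simps)
  moreover have "Re (x + (y + cnj y) + z) = Re x + 2 * Re y + Re z" for x y z
    by simp
  ultimately have "Re ((t * a + s * b) * cnj (t * a + s * b)) =
      Re (t * (cnj t * (a * cnj a))) + 2 * Re (t * cnj s * (a * cnj b)) + Re ((s * cnj s) * (b * cnj b))"
    by (simp only:)
  also have "(s * cnj s) * (b * cnj b) = of_real ((cmod s)\<^sup>2) * (b * cnj b)"
    by (simp only: complex_norm_square)
  finally have *: "Re ((t * a + s * b) * cnj (t * a + s * b)) =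
      Re (t * (cnj t * (a * cnj a))) + 2 * Re (t * cnj s * (a * cnj b)) + (cmod s)\<^sup>2 * Re (b * cnj b)"
    by simp
  show ?thesis
    unfolding pair scaleR_complex.sel * by (simp add: algebra_simps)
qed

lemma pointwise_norm_bounded:
  assumes "\<alpha> \<in> quadratic_differentials \<sigma>"
  shows "bdd_above (pointwise_norm \<alpha> ` topspace X)"
proof -
  obtain B where B: "\<forall>p\<in>topspace X. norm (pairing \<alpha> \<alpha> p) \<le> B"
    using chart_continuous_bound[OF chart_continuous_pairing[OF assms assms]] ..
  have "pointwise_norm \<alpha> p \<le> sqrt B" if p: "p \<in> topspace X" for p
  proof -
    have "(pointwise_norm \<alpha> p)\<^sup>2 \<le> B"
      using bspec[OF B p] unfolding pairing_self norm_of_real by simp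
    then show ?thesis by (rule real_le_rsqrt)
  qed
  then show ?thesis by (rule bdd_aboveI2)
qed

lemma qnorm_eq: "qnorm X \<sigma> g \<alpha> = (SUP p\<in>topspace X. pointwise_norm \<alpha> p)"
  by (simp add: qnorm_def pointwise_norm_def)

lemma pointwise_norm_le_qnorm:
  assumes "\<alpha> \<in> quadratic_differentials \<sigma>" "p \<in> topspace X"
  shows "pointwise_norm \<alpha> p \<le> qnorm X \<sigma> g \<alpha>"
  unfolding qnorm_eq by (rule cSUP_upper[OF assms(2) pointwise_norm_bounded[OF assms(1)]])

lemma qnorm_qcomb_le:
  assumes \<alpha>: "\<alpha> \<in> quadratic_differentials \<sigma>" and \<beta>: "\<beta> \<in> quadratic_differentials \<sigma>"
    and ne: "topspace X \<noteq> {}"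
  shows "qnorm X \<sigma> g (qcomb t \<alpha> s \<beta>) \<le> cmod t * qnorm X \<sigma> g \<alpha> + cmod s * qnorm X \<sigma> g \<beta>"
  unfolding qnorm_eq[of "qcomb t \<alpha> s \<beta>"]
proof (rule cSUP_least[OF ne])
  fix p assume p: "p \<in> topspace X"
  have "pointwise_norm (qcomb t \<alpha> s \<beta>) p \<le> cmod t * pointwise_norm \<alpha> p + cmod s * pointwise_norm \<beta> p"
    using norm_triangle_ineq[of "t * \<alpha> (chart_at \<sigma> p) p" "s * \<beta> (chart_at \<sigma> p) p"] metric_chart_at_pos[OF p]
    by (simp add: pointwise_norm_def qcomb_def norm_mult field_simps)
  also have "\<dots> \<le> cmod t * qnorm X \<sigma> g \<alpha> + cmod s * qnorm X \<sigma> g \<beta>"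
    by (intro add_mono mult_left_mono pointwise_norm_le_qnorm \<alpha> \<beta> p norm_ge_zero)
  finally show "pointwise_norm (qcomb t \<alpha> s \<beta>) p \<le> cmod t * qnorm X \<sigma> g \<alpha> + cmod s * qnorm X \<sigma> g \<beta>" .
qed

text \<open>Joint regularity in the direction \<open>0\<close> of \<open>Q(\<sigma>)\<close> is regularity in the coordinate \<open>z\<close> alone.\<close>

lemma Ck_on_qdiffs_imp_Ck_on:
  assumes "Ck_on_qdiffs k X \<sigma> g U V \<Psi>" "\<gamma> \<in> U" "open V"
    and ne: "topspace X \<noteq> {}"
  shows "Ck_on k (\<Psi> \<gamma>) V"
  using assms(1)
proof (induction k arbitrary: \<Psi>)
  case 0
  have norm0: "qnorm X \<sigma> g (qdiff_minus \<gamma> \<gamma>) = 0"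
    using ne by (simp add: qnorm_def qcomb_def)
  show ?case
    unfolding Ck_on.simps continuous_on_iff
  proof (intro ballI allI impI)
    fix z :: complex and e :: real assume z: "z \<in> V" and e: "e > 0"
    from 0[unfolded Ck_on_qdiffs.simps continuous_on_qdiffs_def, rule_format, OF assms(2) z e]
    obtain d where d: "d > 0" "\<forall>\<beta>\<in>U. \<forall>w\<in>V. qnorm X \<sigma> g (qdiff_minus \<beta> \<gamma>) < d \<and> dist w z < d
        \<longrightarrow> \<bar>\<Psi> \<beta> w - \<Psi> \<gamma> z\<bar> < e" by blast
    show "\<exists>d>0. \<forall>x'\<in>V. dist x' z < d \<longrightarrow> dist (\<Psi> \<gamma> x') (\<Psi> \<gamma> z) < e"
    proof (intro exI[of _ d] conjI d(1) ballI impI)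
      fix w assume w: "w \<in> V" "dist w z < d"
      then show "dist (\<Psi> \<gamma> w) (\<Psi> \<gamma> z) < e"
        using bspec[OF bspec[OF d(2) assms(2)] w(1)] norm0 d(1) unfolding dist_real_def by simp
    qed
  qed
next
  case (Suc k)
  have q0: "qcomb 1 \<gamma> r qzero = \<gamma>" for r by (simp add: qcomb_def qzero_def)
  note S = Suc.prems[unfolded Ck_on_qdiffs.simps, THEN conjunct2, rule_format, OF qzero_quadratic_differential]
  obtain P where P: "\<forall>\<alpha>\<in>U. \<forall>z\<in>V. ((\<lambda>r. \<Psi> (qcomb 1 \<alpha> (of_real r) qzero) (z + of_real r * 1))
      has_real_derivative P \<alpha> z) (at 0)" "Ck_on_qdiffs k X \<sigma> g U V P"
    using S[of 1] by blast
  obtain Q where Q: "\<forall>\<alpha>\<in>U. \<forall>z\<in>V. ((\<lambda>r. \<Psi> (qcomb 1 \<alpha> (of_real r) qzero) (z + of_real r * \<i>))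
      has_real_derivative Q \<alpha> z) (at 0)" "Ck_on_qdiffs k X \<sigma> g U V Q"
    using S[of \<i>] by blast
  have CP: "Ck_on k (P \<gamma>) V" and CQ: "Ck_on k (Q \<gamma>) V"
    using Suc.IH P(2) Q(2) by blast+
  have P': "((\<lambda>r. \<Psi> \<gamma> (z + of_real r)) has_real_derivative P \<gamma> z) (at 0)" if "z \<in> V" for z
    using bspec[OF bspec[OF P(1) assms(2)] that] unfolding q0 by simp
  have Q': "((\<lambda>r. \<Psi> \<gamma> (z + of_real r * \<i>)) has_real_derivative Q \<gamma> z) (at 0)" if "z \<in> V" for z
    using bspec[OF bspec[OF Q(1) assms(2)] that] unfolding q0 by simp
  show ?case
  proof (rule Ck_on_SucI[OF assms(3)])
    show "(\<Psi> \<gamma> has_derivative (\<lambda>w. Re w * P \<gamma> z + Im w * Q \<gamma> z)) (at z)" if "z \<in> V" for z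
      by (rule has_derivative_of_continuous_partials[OF assms(3) that P' Q'
            Ck_on_imp_continuous_on[OF CP] Ck_on_imp_continuous_on[OF CQ]])
    show "Ck_on k (\<lambda>z. Re w * P \<gamma> z + Im w * Q \<gamma> z) V" for w
      by (intro Ck_on_add Ck_on_mult Ck_on_const CP CQ assms(3))
  qed
qed

text \<open>The integrand is bounded on the compact parameter set, and the area is finite, so dominated
  convergence applies along sequences of parameters.\<close>

lemma continuous_on_integral_area:
  fixes F :: "'k::metric_space \<Rightarrow> 'a \<Rightarrow> 'b::{banach, second_countable_topology}"
  assumes K: "compact K"
    and F: "\<And>c. c \<in> \<sigma> \<Longrightarrow> continuous_on (K \<times> chart_range c) (\<lambda>(k, z). F k (chart_inv c z))"
  shows "continuous_on K (\<lambda>k. \<integral>p. F k p \<partial>area)"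
proof -
  interpret finite_measure area by (rule finite_area)
  obtain B where B: "\<And>k p. k \<in> K \<Longrightarrow> p \<in> topspace X \<Longrightarrow> norm (F k p) \<le> B"
    using compact_parameter_bound[OF K F] by blast
  have slice: "chart_continuous (F k)" if "k \<in> K" for k
    unfolding chart_continuous_def
  proof
    fix c assume c: "c \<in> \<sigma>"
    have "continuous_on (chart_range c) (\<lambda>z. (\<lambda>(k, z). F k (chart_inv c z)) (k, z))"
      by (rule continuous_on_compose2[OF F[OF c]]) (use that in \<open>auto intro: continuous_intros\<close>)
    then show "continuous_on (chart_range c) (\<lambda>z. F k (chart_inv c z))" by simp
  qed
  show ?thesis
  proof (rule continuous_on_sequentiallyI)
    fix x a assume x: "\<forall>n. x n \<in> K" "a \<in> K" "x \<longlonglongrightarrow> a"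
    show "(\<lambda>n. \<integral>p. F (x n) p \<partial>area) \<longlonglongrightarrow> (\<integral>p. F a p \<partial>area)"
    proof (rule integral_dominated_convergence[where w="\<lambda>_. B"])
      show "F a \<in> borel_measurable area" "F (x n) \<in> borel_measurable area" for n
        using borel_measurable_chart_continuous[OF slice] x by (simp_all cong: measurable_cong_sets)
      show "AE p in area. (\<lambda>n. F (x n) p) \<longlonglongrightarrow> F a p"
      proof (rule AE_I2)
        fix p assume "p \<in> space area"
        then have "p \<in> topspace X" by simp
        then obtain c where c: "c \<in> \<sigma>" "p \<in> fst c" using charts_cover by blast
        have "continuous_on K (\<lambda>k. (\<lambda>(k, z). F k (chart_inv c z)) (k, snd c p))"
          by (rule continuous_on_compose2[OF F[OF c(1)]]) (use c(2) in \<open>auto intro: continuous_intros\<close>)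
        then have "continuous_on K (\<lambda>k. F k p)" using c by simp
        from continuous_on_tendsto_compose[OF this x(3,2)] x(1)
        show "(\<lambda>n. F (x n) p) \<longlonglongrightarrow> F a p" by simp
      qed
      show "AE p in area. norm (F (x n) p) \<le> B" for n
        using B x(1) by (intro AE_I2) simp
    qed simp
  qed
qed

end


section \<open>The area of a family of minimal surfaces\<close>

locale minimal_surfaces = conformal_surface +
  fixes U :: "'a qdiff set" and u :: "'a qdiff \<Rightarrow> 'a \<Rightarrow> real"
  assumes family: "minimal_surface_family X \<sigma> g U u"
begin

lemma family_properties:
  shows open_U: "open_in_qdiffs X \<sigma> g U"
    and qzero_U: "qzero \<in> U"
    and gauss: "\<And>\<alpha>. \<alpha> \<in> U \<Longrightarrow> gauss_equation X \<sigma> g \<alpha> (u \<alpha>)"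
    and smooth: "\<And>c k. c \<in> \<sigma> \<Longrightarrow> Ck_on_qdiffs k X \<sigma> g U (chart_range c) (\<lambda>\<alpha> z. u \<alpha> (chart_inv c z))"
    and u_qzero: "\<And>p. p \<in> topspace X \<Longrightarrow> u qzero p = 0"
    and quasi_fuchsian_exists: "\<exists>\<Gamma>. quasi_fuchsian X \<Gamma>"
proof -
  note a = family[unfolded minimal_surface_family_def]
  note b = conjunct1[OF conjunct2[OF conjunct2[OF a]]]
  note d = conjunct2[OF conjunct2[OF conjunct2[OF a]]]
  show "open_in_qdiffs X \<sigma> g U" by (rule conjunct1[OF a])
  show 0: "qzero \<in> U" by (rule conjunct1[OF conjunct2[OF a]])
  show "gauss_equation X \<sigma> g \<alpha> (u \<alpha>)" if "\<alpha> \<in> U" for \<alpha>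
    by (rule conjunct1[OF bspec[OF b that]])
  show "Ck_on_qdiffs k X \<sigma> g U (chart_range c) (\<lambda>\<alpha> z. u \<alpha> (chart_inv c z))" if "c \<in> \<sigma>" for c k
    using bspec[OF conjunct1[OF d, unfolded smooth_family_def] that] by (rule spec)
  show "u qzero p = 0" if "p \<in> topspace X" for p
    by (rule bspec[OF conjunct2[OF d] that])
  show "\<exists>\<Gamma>. quasi_fuchsian X \<Gamma>"
    using conjunct2[OF bspec[OF b 0]] by blast
qed

text \<open>The quotient map from hyperbolic space onto \<open>\<Sigma> \<times> \<real>\<close> shows that the surface has a
  point, so that the supremum norm of a quadratic differential is nonnegative.\<close>

lemma topspace_nonempty: "topspace X \<noteq> {}"
proof -
  obtain q :: "real^4 \<Rightarrow> 'a \<times> real" where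
    q: "quotient_map (top_of_set hyperbolic_space) (prod_topology X euclideanreal) q"
    using quasi_fuchsian_exists unfolding quasi_fuchsian_def by blast
  have "(\<chi> i. if i = 4 then 1 else 0) \<in> hyperbolic_space"
    by (simp add: hyperbolic_space_def lorentz_def)
  then have "q (\<chi> i. if i = 4 then 1 else 0) \<in> topspace (prod_topology X euclideanreal)"
    using quotient_imp_surjective_map[OF q] by (metis imageI topspace_euclidean_subtopology)
  then show ?thesis by auto
qed

lemma U_subset: "\<alpha> \<in> U \<Longrightarrow> \<alpha> \<in> quadratic_differentials \<sigma>"
  using open_U unfolding open_in_qdiffs_def by blast

lemma qnorm_nonneg: "\<alpha> \<in> quadratic_differentials \<sigma> \<Longrightarrow> 0 \<le> qnorm X \<sigma> g \<alpha>"
  using topspace_nonempty pointwise_norm_nonneg pointwise_norm_le_qnorm by (metis ex_in_conv order_trans)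

lemma surface_C2_u: "\<alpha> \<in> U \<Longrightarrow> surface_C2 (u \<alpha>)"
  unfolding surface_C2_def
  using Ck_on_qdiffs_imp_Ck_on[OF smooth _ open_chart_range topspace_nonempty] by fast

text \<open>Integrating the Gauss equation, the Laplacian drops out by the divergence theorem and the area
  becomes an expression that is quadratic in \<open>\<alpha>\<close> up to the factor \<open>e\<^sup>-\<^sup>2\<^sup>u\<close>.\<close>

lemma area_functional_eq:
  assumes \<alpha>: "\<alpha> \<in> U"
  shows "area_functional X \<sigma> g u \<alpha> =
    measure area (topspace X) - (\<integral>p. Re (pairing \<alpha> \<alpha> p) * exp (- 2 * u \<alpha> p) \<partial>area)"
proof -
  note Q = U_subset[OF \<alpha>]
  have pw: "exp (2 * u \<alpha> p) = laplace_beltrami \<sigma> g (u \<alpha>) p + (1 - Re (pairing \<alpha> \<alpha> p) * exp (- 2 * u \<alpha> p))"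
    if p: "p \<in> topspace X" for p
  proof -
    have "laplace_beltrami \<sigma> g (u \<alpha>) p + 1 - exp (2 * u \<alpha> p)
        - (pointwise_norm \<alpha> p)\<^sup>2 * exp (- 2 * u \<alpha> p) = 0"
      using bspec[OF gauss[OF \<alpha>, unfolded gauss_equation_def] p]
      by (simp add: pointwise_norm_def Let_def power_divide)
    then show ?thesis by (simp add: pairing_self)
  qed
  have cont: "chart_continuous (\<lambda>p. Re (pairing \<alpha> \<alpha> p) * exp (- 2 * u \<alpha> p))"
    using chart_continuous_pairing[OF Q Q] surface_C2_imp_continuous[OF surface_C2_u[OF \<alpha>]]
    unfolding chart_continuous_def by (auto intro!: continuous_intros)
  interpret finite_measure area by (rule finite_area)
  have "area_functional X \<sigma> g u \<alpha> =
      (\<integral>p. laplace_beltrami \<sigma> g (u \<alpha>) p + (1 - Re (pairing \<alpha> \<alpha> p) * exp (- 2 * u \<alpha> p)) \<partial>area)"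
    unfolding area_functional_def using pw by (intro Bochner_Integration.integral_cong) auto
  also have "\<dots> = (\<integral>p. laplace_beltrami \<sigma> g (u \<alpha>) p \<partial>area) +
      (\<integral>p. 1 - Re (pairing \<alpha> \<alpha> p) * exp (- 2 * u \<alpha> p) \<partial>area)"
    by (intro Bochner_Integration.integral_add Bochner_Integration.integrable_diff integrable_chart_continuous[OF cont]
        integrable_chart_continuous[OF chart_continuous_laplace_beltrami[OF surface_C2_u[OF \<alpha>]]]) simp
  also have "\<dots> = measure area (topspace X) - (\<integral>p. Re (pairing \<alpha> \<alpha> p) * exp (- 2 * u \<alpha> p) \<partial>area)"
    unfolding integral_laplace_beltrami_eq_0[OF surface_C2_u[OF \<alpha>]]
    by (subst Bochner_Integration.integral_diff[OF _ integrable_chart_continuous[OF cont]]) simp_all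
  finally show ?thesis .
qed

lemma continuous_u: "c \<in> \<sigma> \<Longrightarrow> continuous_on_qdiffs X \<sigma> g U (chart_range c) (\<lambda>\<alpha> z. u \<alpha> (chart_inv c z))"
  using smooth[of c 0] by simp

text \<open>Continuity of \<open>u\<close> at \<open>(0, z)\<close>, where its value is \<open>0\<close>, gives a neighbourhood in \<open>Q(\<sigma>)\<close> for each
  point of the surface; by compactness finitely many of them suffice.\<close>

lemma u_small_near_0:
  obtains \<delta> where "0 < \<delta>" "\<And>\<beta> p. \<beta> \<in> U \<Longrightarrow> qnorm X \<sigma> g \<beta> < \<delta> \<Longrightarrow> p \<in> topspace X \<Longrightarrow> \<bar>u \<beta> p\<bar> < 1"
proof -
  obtain I where I: "disc_cover I" using disc_cover_exists ..
  have fin: "finite I" using I by (simp add: disc_cover_def)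
  have "\<exists>\<delta>>0. \<forall>\<beta>\<in>U. qnorm X \<sigma> g \<beta> < \<delta> \<longrightarrow> (\<forall>z\<in>cball a r. \<bar>u \<beta> (chart_inv c z)\<bar> < 1)"
    if i: "(c, a, r) \<in> I" for c a r
  proof -
    note D = disc_coverD[OF I i]
    have "\<exists>\<delta>>0. \<forall>\<beta>\<in>U. \<forall>w\<in>chart_range c. qnorm X \<sigma> g \<beta> < \<delta> \<and> dist w z < \<delta> \<longrightarrow> \<bar>u \<beta> (chart_inv c w)\<bar> < 1"
      if z: "z \<in> cball a r" for z
    proof -
      have zr: "z \<in> chart_range c" using D(3) z by blast
      from continuous_u[OF D(1), unfolded continuous_on_qdiffs_def, rule_format, OF qzero_U zr, of 1]
      show ?thesis by (simp add: u_qzero[OF chart_inv_in_space[OF D(1) zr]])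
    qed
    then obtain d where d: "\<And>z. z \<in> cball a r \<Longrightarrow> 0 < d z \<and> (\<forall>\<beta>\<in>U. \<forall>w\<in>chart_range c.
        qnorm X \<sigma> g \<beta> < d z \<and> dist w z < d z \<longrightarrow> \<bar>u \<beta> (chart_inv c w)\<bar> < 1)"
      by metis
    have cov: "cball a r \<subseteq> (\<Union>z\<in>cball a r. ball z (d z))"
    proof
      fix z assume z: "z \<in> cball a r"
      show "z \<in> (\<Union>z\<in>cball a r. ball z (d z))"
        by (rule UN_I[OF z]) (use d[OF z] in simp)
    qed
    obtain Z where Z: "Z \<subseteq> cball a r" "finite Z" "cball a r \<subseteq> (\<Union>z\<in>Z. ball z (d z))"
      by (rule compactE_image[OF compact_cball[of a r], of "cball a r" "\<lambda>z. ball z (d z)"])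
        (use cov in auto)
    obtain e where e: "0 < e" "\<And>z. z \<in> Z \<Longrightarrow> e \<le> d z"
      using finite_positive_lower_bound[OF Z(2), of d] d Z(1) by blast
    have "\<bar>u \<beta> (chart_inv c w)\<bar> < 1" if \<beta>: "\<beta> \<in> U" "qnorm X \<sigma> g \<beta> < e" and w: "w \<in> cball a r" for \<beta> w
    proof -
      obtain z where z: "z \<in> Z" "w \<in> ball z (d z)" using Z(3) w by blast
      have "w \<in> chart_range c" using D(3) w by blast
      moreover have "qnorm X \<sigma> g \<beta> < d z" using \<beta>(2) e(2)[OF z(1)] by simp
      moreover have "dist w z < d z" using z(2) by (simp add: dist_commute)
      ultimately show ?thesis using d[of z] Z(1) z(1) \<beta>(1) by blast
    qed
    with e(1) show ?thesis by blast
  qed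
  then have "\<forall>i\<in>I. \<exists>\<delta>. case i of (c, a, r) \<Rightarrow> 0 < \<delta> \<and> (\<forall>\<beta>\<in>U. qnorm X \<sigma> g \<beta> < \<delta> \<longrightarrow>
      (\<forall>z\<in>cball a r. \<bar>u \<beta> (chart_inv c z)\<bar> < 1))"
    by auto
  from bchoice[OF this] obtain d where d: "\<forall>i\<in>I. case i of (c, a, r) \<Rightarrow> 0 < d i \<and> (\<forall>\<beta>\<in>U. qnorm X \<sigma> g \<beta> < d i \<longrightarrow>
      (\<forall>z\<in>cball a r. \<bar>u \<beta> (chart_inv c z)\<bar> < 1))" ..
  have "0 < d i" if "i \<in> I" for i using bspec[OF d that] by (cases i) simp
  then obtain e where e: "0 < e" "\<And>i. i \<in> I \<Longrightarrow> e \<le> d i"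
    using finite_positive_lower_bound[OF fin, of d] by blast
  have "\<bar>u \<beta> p\<bar> < 1" if \<beta>: "\<beta> \<in> U" "qnorm X \<sigma> g \<beta> < e" and p: "p \<in> topspace X" for \<beta> p
  proof -
    obtain c a r where i: "(c, a, r) \<in> I" "p \<in> fst c" "snd c p \<in> ball a r"
      using I p by (rule disc_coverE)
    have "qnorm X \<sigma> g \<beta> < d (c, a, r)" using \<beta>(2) e(2)[OF i(1)] by simp
    then have "\<forall>z\<in>cball a r. \<bar>u \<beta> (chart_inv c z)\<bar> < 1"
      using bspec[OF d i(1)] \<beta>(1) by simp
    moreover have "snd c p \<in> cball a r" using i(3) by simp
    ultimately have "\<bar>u \<beta> (chart_inv c (snd c p))\<bar> < 1" by blast
    then show ?thesis using chart_inv[OF disc_coverD(1)[OF I i(1)] i(2)] by simp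
  qed
  with e(1) show ?thesis by (rule that)
qed

text \<open>The integrated Gauss equation shows that the area differs from its value at \<open>0\<close> by
  \<open>O(\<parallel>\<alpha>\<parallel>\<^sup>2)\<close>.\<close>

lemma critical_point_area: "critical_point X \<sigma> g U (area_functional X \<sigma> g u) qzero"
  unfolding critical_point_def qdiff_minus_qzero
proof (intro conjI allI impI qzero_U)
  fix \<epsilon> :: real assume \<epsilon>: "\<epsilon> > 0"
  interpret finite_measure area by (rule finite_area)
  obtain \<delta>1 where \<delta>1: "0 < \<delta>1"
    "\<And>\<beta> p. \<beta> \<in> U \<Longrightarrow> qnorm X \<sigma> g \<beta> < \<delta>1 \<Longrightarrow> p \<in> topspace X \<Longrightarrow> \<bar>u \<beta> p\<bar> < 1"
    using u_small_near_0 by blast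
  \<comment> \<open>Where \<open>|u| < 1\<close>, the integrand \<open>|\<beta>|\<^sup>2/g\<^sup>2 e\<^sup>-\<^sup>2\<^sup>u\<close> is at most \<open>e\<^sup>2 \<parallel>\<beta>\<parallel>\<^sup>2\<close>.\<close>
  define C where "C = exp 2 * measure area (topspace X)"
  have C: "0 \<le> C" by (simp add: C_def)
  define \<delta> where "\<delta> = min \<delta>1 (\<epsilon> / (C + 1))"
  have \<delta>: "0 < \<delta>" using \<delta>1(1) \<epsilon> C by (simp add: \<delta>_def)
  show "\<exists>\<delta>>0. \<forall>\<beta>\<in>U. qnorm X \<sigma> g \<beta> < \<delta> \<longrightarrow>
      \<bar>area_functional X \<sigma> g u \<beta> - area_functional X \<sigma> g u qzero\<bar> \<le> \<epsilon> * qnorm X \<sigma> g \<beta>"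
  proof (intro exI[of _ \<delta>] conjI \<delta> ballI impI)
    fix \<beta> assume \<beta>: "\<beta> \<in> U" and small: "qnorm X \<sigma> g \<beta> < \<delta>"
    note Q = U_subset[OF \<beta>]
    let ?N = "qnorm X \<sigma> g \<beta>"
    have N: "0 \<le> ?N" by (rule qnorm_nonneg[OF Q])
    let ?f = "\<lambda>p. Re (pairing \<beta> \<beta> p) * exp (- 2 * u \<beta> p)"
    have "area_functional X \<sigma> g u qzero = measure area (topspace X)"
      unfolding area_functional_eq[OF qzero_U] by (simp add: pairing_def qzero_def Let_def)
    then have "\<bar>area_functional X \<sigma> g u \<beta> - area_functional X \<sigma> g u qzero\<bar> = \<bar>\<integral>p. ?f p \<partial>area\<bar>"
      unfolding area_functional_eq[OF \<beta>] by simp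
    also have "\<dots> \<le> (\<integral>p. \<bar>?f p\<bar> \<partial>area)"
      by (rule integral_abs_bound)
    also have "\<dots> \<le> (\<integral>p. ?N\<^sup>2 * exp 2 \<partial>area)"
    proof (rule integral_mono')
      show "integrable area (\<lambda>p. ?N\<^sup>2 * exp 2)" by simp
      show "\<bar>?f p\<bar> \<le> ?N\<^sup>2 * exp 2" if "p \<in> space area" for p
      proof -
        have p: "p \<in> topspace X" using that by simp
        have "(pointwise_norm \<beta> p)\<^sup>2 \<le> ?N\<^sup>2"
          by (intro power_mono pointwise_norm_le_qnorm Q p pointwise_norm_nonneg)
        moreover have "exp (- 2 * u \<beta> p) \<le> exp 2"
          using \<delta>1(2)[OF \<beta> _ p] small by (simp add: \<delta>_def)
        ultimately show ?thesis
          unfolding pairing_self by (simp add: abs_mult mult_mono)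
      qed
    qed simp
    also have "\<dots> = (C * ?N) * ?N"
      by (simp add: C_def power2_eq_square)
    also have "\<dots> \<le> \<epsilon> * ?N"
    proof (rule mult_right_mono[OF _ N])
      have "?N * (C + 1) \<le> \<epsilon>"
        using small C by (simp add: \<delta>_def field_simps)
      then show "C * ?N \<le> \<epsilon>" using N by (simp add: algebra_simps)
    qed
    finally show "\<bar>area_functional X \<sigma> g u \<beta> - area_functional X \<sigma> g u qzero\<bar> \<le> \<epsilon> * ?N" .
  qed
qed

end


section \<open>The second variation\<close>

locale deformation = minimal_surfaces +
  fixes \<alpha> \<beta> :: "'a qdiff"
  assumes \<alpha>: "\<alpha> \<in> quadratic_differentials \<sigma>" and \<beta>: "\<beta> \<in> quadratic_differentials \<sigma>"
begin

abbreviation N :: real where "N \<equiv> qnorm X \<sigma> g \<alpha> + qnorm X \<sigma> g \<beta>"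

lemma N_nonneg: "0 \<le> N"
  using qnorm_nonneg \<alpha> \<beta> by simp

lemma qnorm_diff_le:
  assumes "cmod (t - t') \<le> d" "cmod (s - s') \<le> d"
  shows "qnorm X \<sigma> g (qdiff_minus (qcomb t \<alpha> s \<beta>) (qcomb t' \<alpha> s' \<beta>)) \<le> d * N"
proof -
  have "qnorm X \<sigma> g (qcomb (t - t') \<alpha> (s - s') \<beta>)
      \<le> cmod (t - t') * qnorm X \<sigma> g \<alpha> + cmod (s - s') * qnorm X \<sigma> g \<beta>"
    by (rule qnorm_qcomb_le[OF \<alpha> \<beta> topspace_nonempty])
  also have "\<dots> \<le> d * qnorm X \<sigma> g \<alpha> + d * qnorm X \<sigma> g \<beta>"
    by (intro add_mono mult_right_mono assms qnorm_nonneg \<alpha> \<beta>)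
  finally show ?thesis
    unfolding qcomb_diff by (simp add: distrib_left)
qed

lemma radius_exists: "\<exists>\<rho>>0. \<forall>t s. cmod t \<le> \<rho> \<and> cmod s \<le> \<rho> \<longrightarrow> qcomb t \<alpha> s \<beta> \<in> U"
proof -
  obtain \<epsilon> where \<epsilon>: "\<epsilon> > 0" "\<forall>\<gamma>\<in>quadratic_differentials \<sigma>. qnorm X \<sigma> g (qdiff_minus \<gamma> qzero) < \<epsilon> \<longrightarrow> \<gamma> \<in> U"
    using open_U qzero_U unfolding open_in_qdiffs_def by blast
  \<comment> \<open>The summand \<open>1\<close> makes the denominator positive and the inequality \<open>\<rho> N < \<epsilon>\<close> strict.\<close>
  define \<rho> where "\<rho> = \<epsilon> / (N + 1)"
  have \<rho>: "0 < \<rho>" "\<rho> * N < \<epsilon>"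
    using \<epsilon>(1) N_nonneg by (simp_all add: \<rho>_def field_simps)
  have "qcomb t \<alpha> s \<beta> \<in> U" if "cmod t \<le> \<rho>" "cmod s \<le> \<rho>" for t s
  proof -
    have "qnorm X \<sigma> g (qdiff_minus (qcomb t \<alpha> s \<beta>) qzero) \<le> \<rho> * N"
      using qnorm_diff_le[of t 0 \<rho> s 0] that by simp
    then show ?thesis
      using \<epsilon>(2) qcomb_quadratic_differential[OF \<alpha> \<beta>] \<rho>(2) by (meson order_le_less_trans)
  qed
  with \<rho>(1) show ?thesis by blast
qed

definition radius :: real where
  "radius = (SOME \<rho>. \<rho> > 0 \<and> (\<forall>t s. cmod t \<le> \<rho> \<and> cmod s \<le> \<rho> \<longrightarrow> qcomb t \<alpha> s \<beta> \<in> U))"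

lemma radius_pos: "0 < radius"
  and qcomb_in_U: "cmod t \<le> radius \<Longrightarrow> cmod s \<le> radius \<Longrightarrow> qcomb t \<alpha> s \<beta> \<in> U"
  using someI_ex[OF radius_exists] unfolding radius_def by blast+

definition polydisc :: "(complex \<times> complex) set" where
  "polydisc = cball 0 radius \<times> cball 0 radius"

lemma compact_polydisc: "compact polydisc"
  unfolding polydisc_def by (intro compact_Times compact_cball)

definition q :: "complex \<times> complex \<Rightarrow> 'a qdiff" where
  "q k = qcomb (fst k) \<alpha> (snd k) \<beta>"

lemma q_in_U: "k \<in> polydisc \<Longrightarrow> q k \<in> U"
  unfolding polydisc_def q_def by (cases k) (simp add: qcomb_in_U)

lemma continuous_on_parameters:
  assumes cont: "continuous_on_qdiffs X \<sigma> g U V \<Psi>"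
  shows "continuous_on (polydisc \<times> V) (\<lambda>(k, z). \<Psi> (q k) z)"
  unfolding continuous_on_iff
proof (intro ballI allI impI)
  fix x and e :: real assume x: "x \<in> polydisc \<times> V" and e: "e > 0"
  obtain k z where kz: "x = (k, z)" "k \<in> polydisc" "z \<in> V" using x by blast
  from cont[unfolded continuous_on_qdiffs_def, rule_format, OF q_in_U[OF kz(2)] kz(3) e]
  obtain d where d: "d > 0" "\<forall>\<gamma>\<in>U. \<forall>w\<in>V. qnorm X \<sigma> g (qdiff_minus \<gamma> (q k)) < d \<and> dist w z < d
      \<longrightarrow> \<bar>\<Psi> \<gamma> w - \<Psi> (q k) z\<bar> < e" by blast
  define d' where "d' = min d (d / (N + 1))"
  have d': "0 < d'" "d' \<le> d" "d' * N < d"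
  proof -
    show "0 < d'" "d' \<le> d" using d(1) N_nonneg by (simp_all add: d'_def)
    have "d' * N \<le> d / (N + 1) * N"
      using N_nonneg by (intro mult_right_mono) (simp_all add: d'_def)
    also have "\<dots> < d" using d(1) N_nonneg by (simp add: field_simps)
    finally show "d' * N < d" .
  qed
  show "\<exists>d>0. \<forall>x'\<in>polydisc \<times> V. dist x' x < d \<longrightarrow>
      dist (case x' of (k, z) \<Rightarrow> \<Psi> (q k) z) (case x of (k, z) \<Rightarrow> \<Psi> (q k) z) < e"
  proof (intro exI[of _ d'] conjI d'(1) ballI impI)
    fix x' assume x': "x' \<in> polydisc \<times> V" "dist x' x < d'"
    obtain l w where lw: "x' = (l, w)" "l \<in> polydisc" "w \<in> V" using x'(1) by blast
    have lk: "dist l k < d'" and wz: "dist w z < d'"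
      using x'(2) dist_fst_le[of x' x] dist_snd_le[of x' x] by (simp_all add: kz lw)
    have "cmod (fst l - fst k) \<le> d'" "cmod (snd l - snd k) \<le> d'"
      using lk dist_fst_le[of l k] dist_snd_le[of l k] by (simp_all add: dist_norm)
    then have "qnorm X \<sigma> g (qdiff_minus (q l) (q k)) < d"
      using qnorm_diff_le[of "fst l" "fst k" d' "snd l" "snd k"] d'(3) by (simp add: q_def)
    moreover have "dist w z < d" using wz d'(2) by simp
    ultimately have "\<bar>\<Psi> (q l) w - \<Psi> (q k) z\<bar> < e"
      using bspec[OF bspec[OF d(2) q_in_U[OF lw(2)]] lw(3)] by simp
    then show "dist (case x' of (k, z) \<Rightarrow> \<Psi> (q k) z) (case x of (k, z) \<Rightarrow> \<Psi> (q k) z) < e"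
      by (simp add: kz lw dist_real_def)
  qed
qed

text \<open>The parameter \<open>k = (t, s)\<close> ranges over a compact bidisc, so such functions are bounded, and their
  integrals over the surface depend continuously on \<open>k\<close>.\<close>

definition parameter_continuous :: "(complex \<times> complex \<Rightarrow> 'a \<Rightarrow> 'b::topological_space) \<Rightarrow> bool" where
  "parameter_continuous F \<longleftrightarrow>
     (\<forall>c\<in>\<sigma>. continuous_on (polydisc \<times> chart_range c) (\<lambda>(k, z). F k (chart_inv c z)))"

lemma parameter_continuousD:
  "parameter_continuous F \<Longrightarrow> c \<in> \<sigma> \<Longrightarrow>
    continuous_on (polydisc \<times> chart_range c) (\<lambda>(k, z). F k (chart_inv c z))"
  unfolding parameter_continuous_def by blast

lemma parameter_continuous_u: "parameter_continuous (\<lambda>k. u (q k))"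
  unfolding parameter_continuous_def using continuous_on_parameters[OF continuous_u] by blast

lemma parameter_continuous_const:
  assumes "chart_continuous m"
  shows "parameter_continuous (\<lambda>k. m)"
  unfolding parameter_continuous_def case_prod_unfold
proof
  fix c assume c: "c \<in> \<sigma>"
  show "continuous_on (polydisc \<times> chart_range c) (\<lambda>p. m (chart_inv c (snd p)))"
    by (rule continuous_on_compose2[OF assms[unfolded chart_continuous_def, rule_format, OF c]])
      (auto intro: continuous_intros)
qed

lemma parameter_continuous_bound:
  fixes F :: "complex \<times> complex \<Rightarrow> 'a \<Rightarrow> 'b::real_normed_vector"
  assumes "parameter_continuous F"
  shows "\<exists>B. \<forall>k\<in>polydisc. \<forall>p\<in>topspace X. norm (F k p) \<le> B"
  by (rule compact_parameter_bound[OF compact_polydisc parameter_continuousD[OF assms]])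

lemma parameter_continuous_slice:
  assumes F: "parameter_continuous F" and k: "k \<in> polydisc"
  shows "chart_continuous (F k)"
  unfolding chart_continuous_def
proof
  fix c assume c: "c \<in> \<sigma>"
  have "continuous_on (chart_range c) (\<lambda>z. (\<lambda>(k, z). F k (chart_inv c z)) (k, z))"
    by (rule continuous_on_compose2[OF parameter_continuousD[OF F c]])
      (use k in \<open>auto intro: continuous_intros\<close>)
  then show "continuous_on (chart_range c) (\<lambda>z. F k (chart_inv c z))" by simp
qed

definition udot :: "complex \<Rightarrow> complex \<times> complex \<Rightarrow> 'a \<Rightarrow> real" where
  "udot w k p = deriv (\<lambda>r. u (qcomb (fst k + of_real r * w) \<alpha> (snd k) \<beta>) p) 0"

text \<open>The regularity of the family provides the derivative in each chart separately. Since it is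
  determined by its values, the functions \<open>\<Psi>\<close> of different charts are restrictions of one function,
  which \<open>udot\<close> names.\<close>

lemma udot_chart:
  assumes c: "c \<in> \<sigma>"
  shows "\<exists>\<Psi>. continuous_on_qdiffs X \<sigma> g U (chart_range c) \<Psi> \<and>
    (\<forall>k\<in>polydisc. \<forall>z\<in>chart_range c. ((\<lambda>r. u (qcomb (fst k + of_real r * w) \<alpha> (snd k) \<beta>) (chart_inv c z)) has_real_derivative \<Psi> (q k) z) (at 0))"
proof -
  note S = smooth[OF c, of "Suc 0", unfolded Ck_on_qdiffs.simps, THEN conjunct2, rule_format,
      OF qcomb_quadratic_differential[OF \<alpha> \<beta>, of w 0], of 0]
  obtain \<Psi> where \<Psi>: "\<forall>\<gamma>\<in>U. \<forall>z\<in>chart_range c. ((\<lambda>r. u (qcomb 1 \<gamma> (of_real r) (qcomb w \<alpha> 0 \<beta>))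
      (chart_inv c (z + of_real r * 0))) has_real_derivative \<Psi> \<gamma> z) (at 0)"
    "continuous_on_qdiffs X \<sigma> g U (chart_range c) \<Psi>"
    using S by blast
  show ?thesis
  proof (intro exI[of _ \<Psi>] conjI ballI \<Psi>(2))
    fix k z assume "k \<in> polydisc" "z \<in> chart_range c"
    from bspec[OF bspec[OF \<Psi>(1) q_in_U[OF this(1)]] this(2)]
    show "((\<lambda>r. u (qcomb (fst k + of_real r * w) \<alpha> (snd k) \<beta>) (chart_inv c z)) has_real_derivative \<Psi> (q k) z) (at 0)"
      unfolding q_def qcomb_shift by simp
  qed
qed

lemma has_real_derivative_udot:
  assumes k: "k \<in> polydisc" and p: "p \<in> topspace X"
  shows "((\<lambda>r. u (qcomb (fst k + of_real r * w) \<alpha> (snd k) \<beta>) p) has_real_derivative udot w k p) (at 0)"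
proof -
  obtain c where c: "c \<in> \<sigma>" "p \<in> fst c" using charts_cover[OF p] by blast
  obtain \<Psi> where \<Psi>: "\<forall>k\<in>polydisc. \<forall>z\<in>chart_range c.
      ((\<lambda>r. u (qcomb (fst k + of_real r * w) \<alpha> (snd k) \<beta>) (chart_inv c z)) has_real_derivative \<Psi> (q k) z) (at 0)"
    using udot_chart[OF c(1), of w] by (elim exE conjE)
  have "((\<lambda>r. u (qcomb (fst k + of_real r * w) \<alpha> (snd k) \<beta>) p) has_real_derivative \<Psi> (q k) (snd c p)) (at 0)"
    using bspec[OF bspec[OF \<Psi> k] imageI[OF c(2)]] chart_inv[OF c] by simp
  from this DERIV_imp_deriv[OF this] show ?thesis
    by (simp add: udot_def)
qed

lemma parameter_continuous_udot: "parameter_continuous (udot w)"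
  unfolding parameter_continuous_def
proof
  fix c assume c: "c \<in> \<sigma>"
  obtain \<Psi> where \<Psi>: "continuous_on_qdiffs X \<sigma> g U (chart_range c) \<Psi>"
    "\<forall>k\<in>polydisc. \<forall>z\<in>chart_range c.
      ((\<lambda>r. u (qcomb (fst k + of_real r * w) \<alpha> (snd k) \<beta>) (chart_inv c z)) has_real_derivative \<Psi> (q k) z) (at 0)"
    using udot_chart[OF c, of w] by (elim exE conjE)
  have "udot w k (chart_inv c z) = \<Psi> (q k) z" if "k \<in> polydisc" "z \<in> chart_range c" for k z
    unfolding udot_def by (rule DERIV_imp_deriv[OF bspec[OF bspec[OF \<Psi>(2) that(1)] that(2)]])
  then have "continuous_on (polydisc \<times> chart_range c) (\<lambda>(k, z). udot w k (chart_inv c z)) \<longleftrightarrow>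
      continuous_on (polydisc \<times> chart_range c) (\<lambda>(k, z). \<Psi> (q k) z)"
    by (intro continuous_on_cong refl) auto
  then show "continuous_on (polydisc \<times> chart_range c) (\<lambda>(k, z). udot w k (chart_inv c z))"
    using continuous_on_parameters[OF \<Psi>(1)] by simp
qed

definition weight :: "complex \<times> complex \<Rightarrow> 'a \<Rightarrow> real" where
  "weight k p = exp (- 2 * u (q k) p)"

lemma parameter_continuous_weight:
  fixes m :: "'a \<Rightarrow> 'b::real_normed_vector"
  assumes "chart_continuous m"
  shows "parameter_continuous (\<lambda>k p. weight k p *\<^sub>R m p)"
  using parameter_continuous_u parameter_continuous_const[OF assms]
  unfolding parameter_continuous_def weight_def case_prod_unfold
  by (auto intro!: continuous_intros)

lemma parameter_continuous_weight_derivative: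
  assumes "chart_continuous m"
  shows "parameter_continuous (\<lambda>k p. - 2 * udot w k p * weight k p * m p)"
  using parameter_continuous_u parameter_continuous_udot[of w] parameter_continuous_const[OF assms]
  unfolding parameter_continuous_def weight_def case_prod_unfold
  by (auto intro!: continuous_intros)

text \<open>The area of \<open>\<Sigma>(t\<alpha> + s\<beta>)\<close> is a combination of such integrals, where \<open>m\<close> is independent of the
  parameters and all the dependence on \<open>u\<close> is in the weight \<open>e\<^sup>-\<^sup>2\<^sup>u\<close>.\<close>

definition weighted :: "('a \<Rightarrow> 'b::{banach, second_countable_topology}) \<Rightarrow> complex \<times> complex \<Rightarrow> 'b" where
  "weighted m k = (\<integral>p. weight k p *\<^sub>R m p \<partial>area)"

definition weighted_dot :: "complex \<Rightarrow> ('a \<Rightarrow> real) \<Rightarrow> complex \<times> complex \<Rightarrow> real" where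
  "weighted_dot w m k = (\<integral>p. - 2 * udot w k p * weight k p * m p \<partial>area)"

lemma continuous_on_weighted:
  assumes "chart_continuous m"
  shows "continuous_on polydisc (weighted m)"
  unfolding weighted_def[abs_def]
  by (rule continuous_on_integral_area[of polydisc "\<lambda>k p. weight k p *\<^sub>R m p", OF compact_polydisc
        parameter_continuousD[OF parameter_continuous_weight[OF assms]]])

lemma continuous_on_weighted_dot:
  assumes "chart_continuous m"
  shows "continuous_on polydisc (weighted_dot w m)"
  unfolding weighted_dot_def[abs_def]
  by (rule continuous_on_integral_area[of polydisc "\<lambda>k p. - 2 * udot w k p * weight k p * m p",
        OF compact_polydisc parameter_continuousD[OF parameter_continuous_weight_derivative[OF assms]]])

text \<open>The interval of differentiation is chosen so short that \<open>t + r w\<close> stays in the disc, where the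
  derivative of the integrand is bounded.\<close>

lemma has_real_derivative_weighted:
  fixes m :: "'a \<Rightarrow> real"
  assumes m: "chart_continuous m" and t: "cmod t < radius" and s: "cmod s \<le> radius"
  shows "((\<lambda>r. weighted m (t + of_real r * w, s)) has_real_derivative weighted_dot w m (t, s)) (at 0)"
proof -
  interpret finite_measure area by (rule finite_area)
  obtain B where B: "\<forall>k\<in>polydisc. \<forall>p\<in>topspace X. norm (- 2 * udot w k p * weight k p * m p) \<le> B"
    using parameter_continuous_bound[OF parameter_continuous_weight_derivative[OF m, of w]] ..
  \<comment> \<open>The summand \<open>1\<close> in the denominator allows for \<open>w = 0\<close>.\<close>
  define d where "d = (radius - cmod t) / (cmod w + 1)"
  have cw: "0 < cmod w + 1" by (simp add: add_nonneg_pos)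
  have d: "0 < d" using t cw by (simp add: d_def)
  have dw: "d * cmod w \<le> radius - cmod t"
  proof -
    have "d * cmod w \<le> d * (cmod w + 1)" using d by (intro mult_left_mono) simp_all
    also have "\<dots> = radius - cmod t" using cw by (simp add: d_def)
    finally show ?thesis .
  qed
  have k: "(t + of_real r * w, s) \<in> polydisc" if "\<bar>r\<bar> < d" for r
  proof -
    have "cmod (t + of_real r * w) \<le> cmod t + \<bar>r\<bar> * cmod w"
      using norm_triangle_ineq[of t "of_real r * w"] by (simp add: norm_mult)
    also have "\<dots> \<le> cmod t + d * cmod w" using that by (intro add_left_mono mult_right_mono) auto
    also have "\<dots> \<le> radius" using dw by simp
    finally show ?thesis using s by (simp add: polydisc_def)
  qed
  have "((\<lambda>r. \<integral>p. weight (t + of_real r * w, s) p *\<^sub>R m p \<partial>area) has_real_derivative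
      (\<integral>p. - 2 * udot w (t + of_real 0 * w, s) p * weight (t + of_real 0 * w, s) p * m p \<partial>area)) (at 0)"
  proof (rule has_real_derivative_integral(2)[OF d, where w="\<lambda>_. B"])
    fix r :: real assume r: "\<bar>r\<bar> < d"
    show "integrable area (\<lambda>p. weight (t + of_real r * w, s) p *\<^sub>R m p)"
      by (rule integrable_chart_continuous[OF parameter_continuous_slice[OF parameter_continuous_weight[OF m] k[OF r]]])
    fix p assume "p \<in> space area"
    then have p: "p \<in> topspace X" by simp
    have "((\<lambda>h. u (qcomb (t + of_real r * w + of_real h * w) \<alpha> s \<beta>) p) has_real_derivative
        udot w (t + of_real r * w, s) p) (at 0)"
      using has_real_derivative_udot[OF k[OF r] p, of w] by simp
    from has_real_derivative_along_line[of "\<lambda>t. u (qcomb t \<alpha> s \<beta>) p" t r w, OF this]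
    have D: "((\<lambda>r. u (qcomb (t + of_real r * w) \<alpha> s \<beta>) p) has_real_derivative
        udot w (t + of_real r * w, s) p) (at r)" .
    show "((\<lambda>r. weight (t + of_real r * w, s) p *\<^sub>R m p) has_real_derivative
        - 2 * udot w (t + of_real r * w, s) p * weight (t + of_real r * w, s) p * m p) (at r)"
      unfolding weight_def q_def fst_conv snd_conv real_scaleR_def
      by (rule derivative_eq_intros D refl | simp)+
    show "\<bar>- 2 * udot w (t + of_real r * w, s) p * weight (t + of_real r * w, s) p * m p\<bar> \<le> B"
      using bspec[OF bspec[OF B k[OF r]] p] by simp
  qed simp
  then show ?thesis
    by (simp add: weighted_def weighted_dot_def)
qed

lemma has_derivative_weighted:
  fixes m :: "'a \<Rightarrow> real"
  assumes m: "chart_continuous m" and s: "cmod s \<le> radius"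
  shows "((\<lambda>t. weighted m (t, s)) has_derivative
    (\<lambda>h. Re h * weighted_dot 1 m (0, s) + Im h * weighted_dot \<i> m (0, s))) (at 0)"
proof (rule has_derivative_of_continuous_partials[of "ball 0 radius"])
  fix t :: complex assume "t \<in> ball 0 radius"
  then have t: "cmod t < radius" by simp
  show "((\<lambda>r. weighted m (t + of_real r, s)) has_real_derivative weighted_dot 1 m (t, s)) (at 0)"
    using has_real_derivative_weighted[OF m t s, of 1] by simp
  show "((\<lambda>r. weighted m (t + of_real r * \<i>, s)) has_real_derivative weighted_dot \<i> m (t, s)) (at 0)"
    by (rule has_real_derivative_weighted[OF m t s])
next
  have cont: "continuous_on (ball 0 radius) (\<lambda>t. weighted_dot w m (t, s))" for w
    by (rule continuous_on_compose2[OF continuous_on_weighted_dot[OF m]])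
      (use s in \<open>auto simp: polydisc_def intro!: continuous_intros\<close>)
  show "continuous_on (ball 0 radius) (\<lambda>t. weighted_dot 1 m (t, s))"
    "continuous_on (ball 0 radius) (\<lambda>t. weighted_dot \<i> m (t, s))"
    by (rule cont)+
qed (use radius_pos in auto)

text \<open>The terms of the area with a factor \<open>t\<close> are collected as \<open>- Re (t \<kappa>)\<close>. The conjugate of \<open>t\<close> is
  absorbed into \<open>\<kappa>\<close>, whose value and continuity at \<open>t = 0\<close> determine the derivative.\<close>

definition \<kappa> :: "complex \<Rightarrow> complex \<Rightarrow> complex" where
  "\<kappa> s t = cnj t * weighted (pairing \<alpha> \<alpha>) (t, s) + 2 * cnj s * weighted (pairing \<alpha> \<beta>) (t, s)"

lemma chart_continuous_pairings:
  "chart_continuous (pairing \<alpha> \<alpha>)" "chart_continuous (pairing \<alpha> \<beta>)" "chart_continuous (\<lambda>p. Re (pairing \<beta> \<beta> p))"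
  using chart_continuous_pairing[OF \<alpha> \<alpha>] chart_continuous_pairing[OF \<alpha> \<beta>] chart_continuous_pairing[OF \<beta> \<beta>]
  by (auto simp: chart_continuous_def intro: continuous_intros)

text \<open>The integrated Gauss equation, expanded in \<open>t\<close> and \<open>s\<close>.\<close>

lemma area_functional_qcomb:
  assumes t: "cmod t \<le> radius" and s: "cmod s \<le> radius"
  shows "area_functional X \<sigma> g u (qcomb t \<alpha> s \<beta>) = measure area (topspace X) -
    (Re (t * \<kappa> s t) + (cmod s)\<^sup>2 * weighted (\<lambda>p. Re (pairing \<beta> \<beta> p)) (t, s))"
proof -
  have k: "(t, s) \<in> polydisc" using t s by (simp add: polydisc_def)
  have int: "integrable area (\<lambda>p. weight (t, s) p *\<^sub>R m p)" if "chart_continuous m"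
    for m :: "'a \<Rightarrow> 'b::{banach, second_countable_topology}"
    by (rule integrable_chart_continuous[OF parameter_continuous_slice[OF parameter_continuous_weight[OF that] k]])
  note I = int[OF chart_continuous_pairings(1)] int[OF chart_continuous_pairings(2)] int[OF chart_continuous_pairings(3)]
  let ?A = "\<lambda>p. weight (t, s) p *\<^sub>R pairing \<alpha> \<alpha> p" and ?B = "\<lambda>p. weight (t, s) p *\<^sub>R pairing \<alpha> \<beta> p"
    and ?C = "\<lambda>p. weight (t, s) p *\<^sub>R Re (pairing \<beta> \<beta> p)"
  have IAB: "integrable area (\<lambda>p. t * (cnj t * ?A p + 2 * cnj s * ?B p))"
    by (intro integrable_mult_right Bochner_Integration.integrable_add I)
  have "(\<integral>p. Re (pairing (qcomb t \<alpha> s \<beta>) (qcomb t \<alpha> s \<beta>) p) * exp (- 2 * u (qcomb t \<alpha> s \<beta>) p) \<partial>area)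
      = (\<integral>p. Re (t * (cnj t * ?A p + 2 * cnj s * ?B p)) + (cmod s)\<^sup>2 * ?C p \<partial>area)"
  proof (rule Bochner_Integration.integral_cong[OF refl])
    fix p
    have E: "exp (- 2 * u (qcomb t \<alpha> s \<beta>) p) = weight (t, s) p"
      by (simp add: weight_def q_def)
    have "t * (cnj t * ?A p + 2 * cnj s * ?B p) =
        weight (t, s) p *\<^sub>R (t * (cnj t * pairing \<alpha> \<alpha> p + 2 * cnj s * pairing \<alpha> \<beta> p))"
      by (simp add: scaleR_conv_of_real algebra_simps)
    then have eq: "Re (t * (cnj t * ?A p + 2 * cnj s * ?B p)) =
        weight (t, s) p * Re (t * (cnj t * pairing \<alpha> \<alpha> p + 2 * cnj s * pairing \<alpha> \<beta> p))"
      by (simp only: scaleR_complex.sel)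
    show "Re (pairing (qcomb t \<alpha> s \<beta>) (qcomb t \<alpha> s \<beta>) p) * exp (- 2 * u (qcomb t \<alpha> s \<beta>) p) =
        Re (t * (cnj t * ?A p + 2 * cnj s * ?B p)) + (cmod s)\<^sup>2 * ?C p"
      unfolding Re_pairing_qcomb E eq distrib_right real_scaleR_def by (simp only: mult_ac)
  qed
  also have "\<dots> = (\<integral>p. Re (t * (cnj t * ?A p + 2 * cnj s * ?B p)) \<partial>area) + (\<integral>p. (cmod s)\<^sup>2 * ?C p \<partial>area)"
    by (intro Bochner_Integration.integral_add integrable_Re IAB integrable_mult_right I)
  also have "\<dots> = Re (\<integral>p. t * (cnj t * ?A p + 2 * cnj s * ?B p) \<partial>area) + (cmod s)\<^sup>2 * (\<integral>p. ?C p \<partial>area)"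
    using integral_Re[OF IAB] by simp
  also have "(\<integral>p. t * (cnj t * ?A p + 2 * cnj s * ?B p) \<partial>area) = t * \<kappa> s t"
    unfolding \<kappa>_def weighted_def
    by (simp only: integral_mult_right_zero Bochner_Integration.integral_add[OF integrable_mult_right[OF I(1)] integrable_mult_right[OF I(2)]])
  finally show ?thesis
    unfolding area_functional_eq[OF qcomb_in_U[OF t s]] by (simp add: weighted_def)
qed

lemma continuous_on_weighted_slices:
  assumes "chart_continuous m"
  shows "cmod s \<le> radius \<Longrightarrow> isCont (\<lambda>t. weighted m (t, s)) 0"
    and "isCont (\<lambda>s. weighted m (0, s)) 0"
proof -
  have "continuous_on (ball 0 radius) (\<lambda>t. weighted m (t, s))" if "cmod s \<le> radius"
    by (rule continuous_on_compose2[OF continuous_on_weighted[OF assms]])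
      (use that in \<open>auto simp: polydisc_def intro!: continuous_intros\<close>)
  then show "isCont (\<lambda>t. weighted m (t, s)) 0" if "cmod s \<le> radius"
    using that radius_pos by (simp add: continuous_on_eq_continuous_at)
  have "continuous_on (ball 0 radius) (\<lambda>s. weighted m (0, s))"
    by (rule continuous_on_compose2[OF continuous_on_weighted[OF assms]])
      (use radius_pos in \<open>auto simp: polydisc_def intro!: continuous_intros\<close>)
  then show "isCont (\<lambda>s. weighted m (0, s)) 0"
    using radius_pos by (simp add: continuous_on_eq_continuous_at)
qed

abbreviation "area_at t s \<equiv> complex_of_real (area_functional X \<sigma> g u (qcomb t \<alpha> s \<beta>))"

text \<open>The Wirtinger derivative at \<open>t = 0\<close> of the integral of \<open>|\<beta>|\<^sup>2/g\<^sup>2 e\<^sup>-\<^sup>2\<^sup>u\<close>. It occurs in the area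
  with the factor \<open>|s|\<^sup>2\<close>, so its contribution is of second order in \<open>s\<close>.\<close>

definition remainder :: "complex \<Rightarrow> complex" where
  "remainder s = (of_real (weighted_dot 1 (\<lambda>p. Re (pairing \<beta> \<beta> p)) (0, s))
     - \<i> * of_real (weighted_dot \<i> (\<lambda>p. Re (pairing \<beta> \<beta> p)) (0, s))) / 2"

text \<open>The derivative is written as a multiple of \<open>cnj s\<close> by a continuous function of \<open>s\<close>, using
  \<open>|s|\<^sup>2 = s cnj s\<close>; this form makes it differentiable at \<open>s = 0\<close>.\<close>

lemma wirtinger_derivative_area:
  assumes s: "cmod s \<le> radius"
  shows "has_wirtinger_derivative (\<lambda>t. area_at t s)
    (- (cnj s * (weighted (pairing \<alpha> \<beta>) (0, s) + s * remainder s))) 0"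
proof -
  let ?b = "\<lambda>p. Re (pairing \<beta> \<beta> p)"
  let ?J1 = "weighted_dot 1 ?b (0, s)" and ?Ji = "weighted_dot \<i> ?b (0, s)"
  let ?f' = "\<lambda>h. of_real (0 - (Re (h * \<kappa> s 0) + (cmod s)\<^sup>2 * (Re h * ?J1 + Im h * ?Ji))) :: complex"
  have cont: "isCont (\<kappa> s) 0"
    unfolding \<kappa>_def[abs_def]
    by (intro continuous_intros continuous_on_weighted_slices(1) chart_continuous_pairings s)
  have "((\<lambda>t. of_real (measure area (topspace X) - (Re (t * \<kappa> s t) + (cmod s)\<^sup>2 * weighted ?b (t, s))))
      has_derivative ?f') (at 0)"
    by (intro has_derivative_of_real has_derivative_diff has_derivative_const has_derivative_add has_derivative_Re
        has_derivative_mult_at_0[OF bounded_linear_ident cont] has_derivative_mult_right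
        has_derivative_weighted[OF chart_continuous_pairings(3) s])
  then have D: "((\<lambda>t. area_at t s) has_derivative ?f') (at 0)"
    by (rule has_derivative_transform_within_open[of _ _ _ _ "ball 0 radius"])
      (use radius_pos s area_functional_qcomb in auto)
  have \<kappa>0: "\<kappa> s 0 = 2 * (cnj s * weighted (pairing \<alpha> \<beta>) (0, s))"
    by (simp add: \<kappa>_def)
  have "of_real ((cmod s)\<^sup>2) = s * cnj s" by (rule complex_norm_square)
  then have "- (cnj s * (weighted (pairing \<alpha> \<beta>) (0, s) + s * remainder s)) =
      - (\<kappa> s 0 + of_real ((cmod s)\<^sup>2) * (of_real ?J1 - \<i> * of_real ?Ji)) / 2"
    unfolding \<kappa>0 by (simp only:) (simp add: remainder_def field_simps)
  also have "\<dots> = (?f' 1 - \<i> * ?f' \<i>) / 2"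
    by (simp add: complex_eq_iff)
  finally show ?thesis
    unfolding has_wirtinger_derivative_def using D by blast
qed

text \<open>At \<open>s = 0\<close> only the coefficient of \<open>cnj s\<close> survives. It is taken at \<open>t = s = 0\<close>, where \<open>u = 0\<close> and the
  weight is \<open>1\<close>, so it is the Weil-Petersson pairing.\<close>

theorem mixed_wirtinger_derivative_area:
  "has_mixed_wirtinger_derivative area_at (- weil_petersson X \<sigma> g \<alpha> \<beta>)"
proof -
  let ?h = "\<lambda>s. - (cnj s * (weighted (pairing \<alpha> \<beta>) (0, s) + s * remainder s))"
  let ?b = "\<lambda>p. Re (pairing \<beta> \<beta> p)"
  have W0: "weighted (pairing \<alpha> \<beta>) (0, 0) = weil_petersson X \<sigma> g \<alpha> \<beta>"
    unfolding weighted_def weil_petersson_eq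
    by (rule Bochner_Integration.integral_cong) (simp_all add: weight_def q_def u_qzero)
  have "isCont (\<lambda>s. s * remainder s) 0"
  proof -
    have "continuous_on (ball 0 radius) (\<lambda>s. weighted_dot w ?b (0, s))" for w
      by (rule continuous_on_compose2[OF continuous_on_weighted_dot[OF chart_continuous_pairings(3)]])
        (use radius_pos in \<open>auto simp: polydisc_def intro!: continuous_intros\<close>)
    then have "isCont (\<lambda>s. weighted_dot w ?b (0, s)) 0" for w
      using radius_pos by (simp add: continuous_on_eq_continuous_at)
    then show ?thesis
      unfolding remainder_def by (intro continuous_intros) simp_all
  qed
  then have cont: "isCont (\<lambda>s. weighted (pairing \<alpha> \<beta>) (0, s) + s * remainder s) 0"
    by (intro continuous_add continuous_on_weighted_slices(2) chart_continuous_pairings)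
  have "(?h has_derivative (\<lambda>s. - (cnj s * (weighted (pairing \<alpha> \<beta>) (0, 0) + 0 * remainder 0)))) (at 0)"
    by (rule has_derivative_minus[OF has_derivative_mult_at_0[OF bounded_linear_cnj cont]])
  then have "has_conj_wirtinger_derivative ?h (- weil_petersson X \<sigma> g \<alpha> \<beta>) 0"
    unfolding has_conj_wirtinger_derivative_def
    by (intro exI conjI) (assumption, simp add: W0 field_simps)
  moreover have "\<forall>\<^sub>F s in nhds 0. has_wirtinger_derivative (\<lambda>t. area_at t s) (?h s) 0"
    unfolding eventually_nhds
    by (intro exI[of _ "ball 0 radius"] conjI ballI wirtinger_derivative_area) (use radius_pos in auto)
  ultimately show ?thesis
    unfolding has_mixed_wirtinger_derivative_def by (intro exI[of _ ?h] conjI)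
qed

end

lemma minimal_surfacesI:
  assumes "closed_surface genus X \<A>" "\<tau> \<in> teichmueller_space X \<A>" "\<sigma> \<in> \<tau>"
    "hyperbolic_metric \<sigma> g" "minimal_surface_family X \<sigma> g U u"
  shows "minimal_surfaces X \<sigma> g U u"
proof
  show "compact_space X" "Hausdorff_space X"
    using assms(1) by (simp_all add: closed_surface_def)
  have "\<sigma> \<in> conformal_structures X \<A>"
    using assms(2,3) by (auto simp: teichmueller_space_def quotient_def teichmueller_rel_def)
  then show "maximal_atlas X holomorphic_compatible \<sigma>"
    by (simp add: conformal_structures_def)
  show "conformal_metric \<sigma> g" using assms(4) by (simp add: hyperbolic_metric_def)
  show "minimal_surface_family X \<sigma> g U u" by (rule assms(5))
qed

theorem theorem1p4:
  fixes X :: "'a topology" and \<A> :: "'a chart set" and genus :: nat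
  assumes "genus \<ge> 2" and "closed_surface genus X \<A>"
  shows
    "(\<forall>\<tau>\<in>teichmueller_space X \<A>. \<forall>\<sigma>\<in>\<tau>. \<forall>g U u.
        hyperbolic_metric \<sigma> g \<and> minimal_surface_family X \<sigma> g U u \<longrightarrow>
        critical_point X \<sigma> g U (area_functional X \<sigma> g u) qzero)
     \<and>
     (\<exists>c::real. c \<noteq> 0 \<and>
        (\<forall>\<tau>\<in>teichmueller_space X \<A>. \<forall>\<sigma>\<in>\<tau>. \<forall>g U u.
           hyperbolic_metric \<sigma> g \<and> minimal_surface_family X \<sigma> g U u \<longrightarrow>
           (\<forall>\<alpha>\<in>quadratic_differentials \<sigma>. \<forall>\<beta>\<in>quadratic_differentials \<sigma>.
              has_mixed_wirtinger_derivative
                (\<lambda>t s. of_real (area_functional X \<sigma> g u (qcomb t \<alpha> s \<beta>)))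
                (of_real c * weil_petersson X \<sigma> g \<alpha> \<beta>))))"
proof (intro conjI exI[of _ "-1"] ballI allI impI)
  fix \<tau> \<sigma> g U u
  assume *: "\<tau> \<in> teichmueller_space X \<A>" "\<sigma> \<in> \<tau>"
    "hyperbolic_metric \<sigma> g \<and> minimal_surface_family X \<sigma> g U u"
  interpret minimal_surfaces X \<sigma> g U u
    by (rule minimal_surfacesI[OF assms(2) *(1,2) conjunct1[OF *(3)] conjunct2[OF *(3)]])
  show "critical_point X \<sigma> g U (area_functional X \<sigma> g u) qzero"
    by (rule critical_point_area)
  fix \<alpha> \<beta> assume ab: "\<alpha> \<in> quadratic_differentials \<sigma>" "\<beta> \<in> quadratic_differentials \<sigma>"
  interpret deformation X \<sigma> g U u \<alpha> \<beta>
    by unfold_locales (rule ab)+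
  show "has_mixed_wirtinger_derivative
      (\<lambda>t s. of_real (area_functional X \<sigma> g u (qcomb t \<alpha> s \<beta>)))
      (of_real (-1) * weil_petersson X \<sigma> g \<alpha> \<beta>)"
    using mixed_wirtinger_derivative_area by simp
qed simp

end
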